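(* Let $M$ be a pre-ordered commutative monoid, $G$ a group, $R$ a commutative associative unital ring, and $Q$ an $R$-module. For every filter $\phi:M\to 2^G$ and every layering $\pi:M\to 2^G$, if $$(\forall s,t\in M)\qquad [\phi_s,\pi^{s+t}]\leq\pi^t,$$ then $L^*(\pi;Q)=\bigoplus_{s\in M}L^s(\pi;Q)$ is a graded module of the $M$-graded Lie ring $L_*(\phi;R)$, with the action described in the context.
   Context: Monoid: $M=\langle M,+,0,\prec\rangle$ is a commutative monoid with a pre-order $\prec$ such that $0\prec s$ for all $s\in M$, and $s\prec t$, $u\prec v$ imply $s+u\prec t+v$. Commutators are $[g,h]=g^{-1}h^{-1}gh$ and $[X,Y]=\langle[x,y]:x\in X,y\in Y\rangle$; $2^G$ is the set of subsets of $G$. Filter: a function $\phi:M\to2^G$, $s\mapsto\phi_s$, with each $\phi_s$ a subgroup, $[\phi_s,\phi_t]\leq\phi_{s+t}$ for all $s,t$, and $\phi_s\geq\phi_t$ whenever $s\prec t$. Put $\partial_s\phi=\langle\phi_{s+t}:t\neq0\rangle$. Define $L_0(\phi;R)=0$ and, for $s\neq0$, $L_s(\phi;R)=(\phi_s/\partial_s\phi)\otimes_{\mathbb{Z}}R$. Then $L_*(\phi;R)=\bigoplus_{s\in M}L_s(\phi;R)$ is an $M$-graded Lie ring with product $(\bar x_s\otimes r)\circ(\bar y_t\otimes r')=\overline{[x,y]}_{s+t}\otimes rr'$, where $\bar x_s$ is the coset of $x\in\phi_s$ modulo $\partial_s\phi$ (terms in degree $0$ being $0$). Layering: a function $\pi:M\to2^G$,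 $s\mapsto\pi^s$, with each $\pi^s$ a subgroup, $[\pi^s,\bigcap_{u\neq0}\pi^{t+u}]\leq\pi^t$ for all $s,t\in M$, and $\pi^s\leq\pi^t$ whenever $s\prec t$. Put $\partial^s\pi=\bigcap_{t\neq0}\pi^{s+t}$. Define $L^0(\pi)=0$ and $L^s(\pi)=\partial^s\pi/\pi^s$ for $s\neq0$ (an abelian group), and $L^s(\pi;Q)=\hom_{\mathbb{Z}}(L^s(\pi),Q)$. Action: for $s,t\in M$ with $s\ne 0$, $t\neq 0$, $x\in\phi_s$, $r\in R$, $f\in L^t(\pi;Q)$, the element $(\bar x\otimes r)\cdot f\in L^{s+t}(\pi;Q)$ is the map $L^{s+t}(\pi)\to Q$, $\bar y\mapsto-r\,f(\overline{[x,y]})$ for $y\in\partial^{s+t}\pi$, where $\overline{[x,y]}$ is the class of $[x,y]$ in $L^t(\pi)=\partial^t\pi/\pi^t$; the action is zero when $s=0$ or $t=0$ (and lands in $0$ if $s+t=0$). It is extended biadditively. A graded module $V=\bigoplus_t V^t$ of an $M$-graded Lie ring $L=\bigoplus_s L_s$ has a biadditive action with $(a\circ b)\cdot v=a\cdot(b\cdot v)-b\cdot(a\cdot v)$ and $L_s\cdot V^t\subseteq V^{s+t}$; here the action is moreover $R$-bilinear. *)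

theory Defs
  imports "HOL-Algebra.Algebra"
begin

locale preordered_comm_monoid =
  fixes prec :: "'m::comm_monoid_add \<Rightarrow> 'm \<Rightarrow> bool"  (infix \<open>\<preceq>\<close> 50)
  assumes reflp: "reflp (\<preceq>)"
    and transp: "transp (\<preceq>)"
    and zero_le: "0 \<preceq> s"
    and add_mono: "s \<preceq> t \<Longrightarrow> u \<preceq> v \<Longrightarrow> s + u \<preceq> t + v"


section \<open>Graded Lie rings and graded modules\<close>

definition biadditive ::
  "('a, 'x) monoid_scheme \<Rightarrow> ('b, 'y) monoid_scheme \<Rightarrow> ('c, 'z) monoid_scheme \<Rightarrow> ('a \<Rightarrow> 'b \<Rightarrow> 'c) \<Rightarrow> bool"
  where "biadditive A B C \<beta> \<longleftrightarrow>
    (\<forall>a\<in>carrier A. \<beta> a \<in> hom B C) \<and> (\<forall>b\<in>carrier B. (\<lambda>a. \<beta> a b) \<in> hom A C)"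

definition bilinear ::
  "('r, 'x) ring_scheme \<Rightarrow> ('r, 'a, 'y) module_scheme \<Rightarrow> ('r, 'b, 'z) module_scheme \<Rightarrow>
    ('r, 'c, 'w) module_scheme \<Rightarrow> ('a \<Rightarrow> 'b \<Rightarrow> 'c) \<Rightarrow> bool"
  where "bilinear R A B C \<beta> \<longleftrightarrow>
    module R A \<and> module R B \<and> module R C \<and>
    biadditive (add_monoid A) (add_monoid B) (add_monoid C) \<beta> \<and>
    (\<forall>r\<in>carrier R. \<forall>a\<in>carrier A. \<forall>b\<in>carrier B.
      \<beta> (r \<odot>\<^bsub>A\<^esub> a) b = r \<odot>\<^bsub>C\<^esub> \<beta> a b \<and> \<beta> a (r \<odot>\<^bsub>B\<^esub> b) = r \<odot>\<^bsub>C\<^esub> \<beta> a b)"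

text \<open>
  A Lie ring is stored in a ring record: the product is the Lie product, and the field \<open>one\<close>
  carries no meaning. The same holds for the product of an abelian group stored in a ring record.
\<close>

locale lie_ring = abelian_group L for L (structure) +
  assumes biadditive_mult: "biadditive (add_monoid L) (add_monoid L) (add_monoid L) (\<otimes>)"
    and alternating: "a \<in> carrier L \<Longrightarrow> a \<otimes> a = \<zero>"
    and jacobi: "\<lbrakk>a \<in> carrier L; b \<in> carrier L; c \<in> carrier L\<rbrakk> \<Longrightarrow>
      a \<otimes> (b \<otimes> c) \<oplus> b \<otimes> (c \<otimes> a) \<oplus> c \<otimes> (a \<otimes> b) = \<zero>"

definition internal_direct_sum :: "('a, 'x) ring_scheme \<Rightarrow> ('m \<Rightarrow> 'a set) \<Rightarrow> bool"
  where "internal_direct_sum V Vc \<longleftrightarrow>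
    (\<forall>s. subgroup (Vc s) (add_monoid V)) \<and>
    (\<forall>v\<in>carrier V. \<exists>!f. (\<forall>s. f s \<in> Vc s) \<and> finite {s. f s \<noteq> \<zero>\<^bsub>V\<^esub>} \<and>
      v = finsum V f {s. f s \<noteq> \<zero>\<^bsub>V\<^esub>})"

locale graded_lie_ring = lie_ring L for L (structure) +
  fixes Lc :: "'m::comm_monoid_add \<Rightarrow> 'a set"
  assumes grading: "internal_direct_sum L Lc"
    and mult_graded: "a \<in> Lc s \<Longrightarrow> b \<in> Lc t \<Longrightarrow> a \<otimes> b \<in> Lc (s + t)"

locale graded_lie_module = graded_lie_ring L Lc + V: abelian_group V
  for L :: "('a, 'x) ring_scheme" (structure) and Lc :: "'m::comm_monoid_add \<Rightarrow> 'a set"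
    and V :: "('v, 'y) ring_scheme" +
  fixes Vc :: "'m \<Rightarrow> 'v set"
    and act :: "'a \<Rightarrow> 'v \<Rightarrow> 'v"  (infixr \<open>\<rhd>\<close> 75)
  assumes module_grading: "internal_direct_sum V Vc"
    and biadditive_act: "biadditive (add_monoid L) (add_monoid V) (add_monoid V) (\<rhd>)"
    and mult_act: "\<lbrakk>a \<in> carrier L; b \<in> carrier L; v \<in> carrier V\<rbrakk> \<Longrightarrow>
      (a \<otimes> b) \<rhd> v = (a \<rhd> b \<rhd> v) \<ominus>\<^bsub>V\<^esub> (b \<rhd> a \<rhd> v)"
    and act_graded: "a \<in> Lc s \<Longrightarrow> v \<in> Vc t \<Longrightarrow> a \<rhd> v \<in> Vc (s + t)"

text \<open>Inclusions and homogeneous components of the direct sum \<open>sum_group UNIV C\<close>.\<close>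

definition sum_inj :: "('m \<Rightarrow> ('a, 'x) monoid_scheme) \<Rightarrow> 'm \<Rightarrow> 'a \<Rightarrow> 'm \<Rightarrow> 'a"
  where "sum_inj C s c = (\<lambda>u. if u = s then c else \<one>\<^bsub>C u\<^esub>)"

definition homogeneous :: "('m \<Rightarrow> ('a, 'x) monoid_scheme) \<Rightarrow> 'm \<Rightarrow> ('m \<Rightarrow> 'a) set"
  where "homogeneous C s = sum_inj C s ` carrier (C s)"


section \<open>Tensor products over the integers\<close>

text \<open>
  For a multiplicatively written abelian group \<open>A\<close> and a ring \<open>R\<close>, the tensor product of \<open>A\<close> with
  the additive group of \<open>R\<close> is the free abelian group on pairs modulo the biadditivity relations.
\<close>

abbreviation tensor_free :: "('a, 'x) monoid_scheme \<Rightarrow> ('r, 'y) ring_scheme \<Rightarrow> ('a \<times> 'r \<Rightarrow>\<^sub>0 int) monoid"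
  where "tensor_free A R \<equiv> free_Abelian_group (carrier A \<times> carrier R)"

definition tensor_relations ::
  "('a, 'x) monoid_scheme \<Rightarrow> ('r, 'y) ring_scheme \<Rightarrow> ('a \<times> 'r \<Rightarrow>\<^sub>0 int) set"
  where "tensor_relations A R = generate (tensor_free A R)
    ({frag_of (x \<otimes>\<^bsub>A\<^esub> y, r) - frag_of (x, r) - frag_of (y, r) | x y r.
        x \<in> carrier A \<and> y \<in> carrier A \<and> r \<in> carrier R} \<union>
     {frag_of (x, r \<oplus>\<^bsub>R\<^esub> r') - frag_of (x, r) - frag_of (x, r') | x r r'.
        x \<in> carrier A \<and> r \<in> carrier R \<and> r' \<in> carrier R})"

definition tensor ::
  "('a, 'x) monoid_scheme \<Rightarrow> ('r, 'y) ring_scheme \<Rightarrow> ('a \<times> 'r \<Rightarrow>\<^sub>0 int) set monoid"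
  where "tensor A R = tensor_free A R Mod tensor_relations A R"

definition pure_tensor ::
  "('a, 'x) monoid_scheme \<Rightarrow> ('r, 'y) ring_scheme \<Rightarrow> 'a \<Rightarrow> 'r \<Rightarrow> ('a \<times> 'r \<Rightarrow>\<^sub>0 int) set"
  where "pure_tensor A R x r = tensor_relations A R #>\<^bsub>tensor_free A R\<^esub> frag_of (x, r)"

text \<open>
  The action of \<open>r\<close> on the second factor. The map \<open>(x, r') \<mapsto> (x, r r')\<close> is extended linearly to the
  free abelian group; it preserves the relations, so the union below is a single coset.
\<close>

definition tensor_smult ::
  "('a, 'x) monoid_scheme \<Rightarrow> ('r, 'y) ring_scheme \<Rightarrow> 'r \<Rightarrow> ('a \<times> 'r \<Rightarrow>\<^sub>0 int) set \<Rightarrow> ('a \<times> 'r \<Rightarrow>\<^sub>0 int) set"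
  where "tensor_smult A R r c = (\<Union>p\<in>c. tensor_relations A R #>\<^bsub>tensor_free A R\<^esub>
    frag_extend (\<lambda>(x, r'). frag_of (x, r \<otimes>\<^bsub>R\<^esub> r')) p)"


section \<open>Filters and layerings\<close>

text \<open>The convention here is \<open>[g, h] = g\<^sup>-\<^sup>1 h\<^sup>-\<^sup>1 g h\<close>, unlike in \<open>derived_set\<close> of the library.\<close>

definition commutator :: "('g, 'x) monoid_scheme \<Rightarrow> 'g \<Rightarrow> 'g \<Rightarrow> 'g"
  where "commutator G g h = inv\<^bsub>G\<^esub> g \<otimes>\<^bsub>G\<^esub> inv\<^bsub>G\<^esub> h \<otimes>\<^bsub>G\<^esub> g \<otimes>\<^bsub>G\<^esub> h"

definition commutator_subgroup :: "('g, 'x) monoid_scheme \<Rightarrow> 'g set \<Rightarrow> 'g set \<Rightarrow> 'g set"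
  where "commutator_subgroup G A B = generate G {commutator G x y | x y. x \<in> A \<and> y \<in> B}"

definition group_filter ::
  "('g, 'x) monoid_scheme \<Rightarrow> ('m::comm_monoid_add \<Rightarrow> 'm \<Rightarrow> bool) \<Rightarrow> ('m \<Rightarrow> 'g set) \<Rightarrow> bool"
  where "group_filter G prec \<phi> \<longleftrightarrow>
    (\<forall>s. subgroup (\<phi> s) G) \<and>
    (\<forall>s t. commutator_subgroup G (\<phi> s) (\<phi> t) \<subseteq> \<phi> (s + t)) \<and>
    (\<forall>s t. prec s t \<longrightarrow> \<phi> t \<subseteq> \<phi> s)"

definition filter_boundary ::
  "('g, 'x) monoid_scheme \<Rightarrow> ('m::comm_monoid_add \<Rightarrow> 'g set) \<Rightarrow> 'm \<Rightarrow> 'g set"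
  where "filter_boundary G \<phi> s = generate G (\<Union>t\<in>{t. t \<noteq> 0}. \<phi> (s + t))"

text \<open>
  The intersection is taken among subsets of the group, so it is the whole group if the monoid
  is trivial.
\<close>

definition layer_boundary ::
  "('g, 'x) monoid_scheme \<Rightarrow> ('m::comm_monoid_add \<Rightarrow> 'g set) \<Rightarrow> 'm \<Rightarrow> 'g set"
  where "layer_boundary G \<pi> s = carrier G \<inter> (\<Inter>t\<in>{t. t \<noteq> 0}. \<pi> (s + t))"

definition layering ::
  "('g, 'x) monoid_scheme \<Rightarrow> ('m::comm_monoid_add \<Rightarrow> 'm \<Rightarrow> bool) \<Rightarrow> ('m \<Rightarrow> 'g set) \<Rightarrow> bool"
  where "layering G prec \<pi> \<longleftrightarrow>
    (\<forall>s. subgroup (\<pi> s) G) \<and>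
    (\<forall>s t. commutator_subgroup G (\<pi> s) (layer_boundary G \<pi> t) \<subseteq> \<pi> t) \<and>
    (\<forall>s t. prec s t \<longrightarrow> \<pi> s \<subseteq> \<pi> t)"


section \<open>The graded Lie ring of a filter\<close>

definition filter_quotient ::
  "('g, 'x) monoid_scheme \<Rightarrow> ('m::comm_monoid_add \<Rightarrow> 'g set) \<Rightarrow> 'm \<Rightarrow> 'g set monoid"
  where "filter_quotient G \<phi> s = G\<lparr>carrier := \<phi> s\<rparr> Mod filter_boundary G \<phi> s"

definition filter_component ::
  "('g, 'x) monoid_scheme \<Rightarrow> ('r, 'y) ring_scheme \<Rightarrow> ('m::comm_monoid_add \<Rightarrow> 'g set) \<Rightarrow> 'm \<Rightarrow>
    ('g set \<times> 'r \<Rightarrow>\<^sub>0 int) set monoid"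
  where "filter_component G R \<phi> s =
    (if s = 0 then singleton_group {0} else tensor (filter_quotient G \<phi> s) R)"

text \<open>The element of degree \<open>s \<noteq> 0\<close> given by the class of \<open>x\<close> tensored with \<open>r\<close>.\<close>

definition filter_elem ::
  "('g, 'x) monoid_scheme \<Rightarrow> ('r, 'y) ring_scheme \<Rightarrow> ('m::comm_monoid_add \<Rightarrow> 'g set) \<Rightarrow>
    'm \<Rightarrow> 'g \<Rightarrow> 'r \<Rightarrow> 'm \<Rightarrow> ('g set \<times> 'r \<Rightarrow>\<^sub>0 int) set"
  where "filter_elem G R \<phi> s x r = sum_inj (filter_component G R \<phi>) s
    (pure_tensor (filter_quotient G \<phi> s) R (filter_boundary G \<phi> s #>\<^bsub>G\<^esub> x) r)"

abbreviation filter_sum ::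
  "('g, 'x) monoid_scheme \<Rightarrow> ('r, 'y) ring_scheme \<Rightarrow> ('m::comm_monoid_add \<Rightarrow> 'g set) \<Rightarrow>
    ('m \<Rightarrow> ('g set \<times> 'r \<Rightarrow>\<^sub>0 int) set) monoid"
  where "filter_sum G R \<phi> \<equiv> sum_group UNIV (filter_component G R \<phi>)"

text \<open>Extensionality is required only so that the product is unique as a HOL function.\<close>

definition is_filter_product ::
  "('g, 'x) monoid_scheme \<Rightarrow> ('r, 'y) ring_scheme \<Rightarrow> ('m::comm_monoid_add \<Rightarrow> 'g set) \<Rightarrow>
    (('m \<Rightarrow> ('g set \<times> 'r \<Rightarrow>\<^sub>0 int) set) \<Rightarrow> ('m \<Rightarrow> ('g set \<times> 'r \<Rightarrow>\<^sub>0 int) set) \<Rightarrow>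
      ('m \<Rightarrow> ('g set \<times> 'r \<Rightarrow>\<^sub>0 int) set)) \<Rightarrow> bool"
  where "is_filter_product G R \<phi> b \<longleftrightarrow>
    case_prod b \<in> extensional (carrier (filter_sum G R \<phi>) \<times> carrier (filter_sum G R \<phi>)) \<and>
    biadditive (filter_sum G R \<phi>) (filter_sum G R \<phi>) (filter_sum G R \<phi>) b \<and>
    (\<forall>s t. s \<noteq> 0 \<longrightarrow> t \<noteq> 0 \<longrightarrow>
      (\<forall>x\<in>\<phi> s. \<forall>y\<in>\<phi> t. \<forall>r\<in>carrier R. \<forall>r'\<in>carrier R.
        b (filter_elem G R \<phi> s x r) (filter_elem G R \<phi> t y r') =
          (if s + t = 0 then \<one>\<^bsub>filter_sum G R \<phi>\<^esub>
           else filter_elem G R \<phi> (s + t) (commutator G x y) (r \<otimes>\<^bsub>R\<^esub> r'))))"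

definition filter_lie_ring ::
  "('g, 'x) monoid_scheme \<Rightarrow> ('r, 'y) ring_scheme \<Rightarrow> ('m::comm_monoid_add \<Rightarrow> 'g set) \<Rightarrow>
    ('r, 'm \<Rightarrow> ('g set \<times> 'r \<Rightarrow>\<^sub>0 int) set) module"
  where "filter_lie_ring G R \<phi> =
    \<lparr>carrier = carrier (filter_sum G R \<phi>),
     monoid.mult = (THE b. is_filter_product G R \<phi> b),
     monoid.one = undefined,
     ring.zero = \<one>\<^bsub>filter_sum G R \<phi>\<^esub>,
     ring.add = monoid.mult (filter_sum G R \<phi>),
     module.smult = (\<lambda>r a s. if s = 0 then \<one>\<^bsub>filter_component G R \<phi> 0\<^esub>
       else tensor_smult (filter_quotient G \<phi> s) R r (a s))\<rparr>"


section \<open>The graded module of a layering\<close>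

definition layer_quotient ::
  "('g, 'x) monoid_scheme \<Rightarrow> ('m::comm_monoid_add \<Rightarrow> 'g set) \<Rightarrow> 'm \<Rightarrow> 'g set monoid"
  where "layer_quotient G \<pi> s =
    (if s = 0 then singleton_group {\<one>\<^bsub>G\<^esub>} else G\<lparr>carrier := layer_boundary G \<pi> s\<rparr> Mod \<pi> s)"

definition layer_component ::
  "('g, 'x) monoid_scheme \<Rightarrow> ('r, 'q, 'y) module_scheme \<Rightarrow> ('m::comm_monoid_add \<Rightarrow> 'g set) \<Rightarrow> 'm \<Rightarrow>
    ('g set \<Rightarrow> 'q) monoid"
  where "layer_component G Q \<pi> s =
    \<lparr>carrier = hom (layer_quotient G \<pi> s) (add_monoid Q) \<inter> extensional (carrier (layer_quotient G \<pi> s)),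
     monoid.mult = (\<lambda>f g. \<lambda>Y\<in>carrier (layer_quotient G \<pi> s). f Y \<oplus>\<^bsub>Q\<^esub> g Y),
     monoid.one = (\<lambda>Y\<in>carrier (layer_quotient G \<pi> s). \<zero>\<^bsub>Q\<^esub>)\<rparr>"

abbreviation layer_sum ::
  "('g, 'x) monoid_scheme \<Rightarrow> ('r, 'q, 'y) module_scheme \<Rightarrow> ('m::comm_monoid_add \<Rightarrow> 'g set) \<Rightarrow>
    ('m \<Rightarrow> 'g set \<Rightarrow> 'q) monoid"
  where "layer_sum G Q \<pi> \<equiv> sum_group UNIV (layer_component G Q \<pi>)"

definition layer_module ::
  "('g, 'x) monoid_scheme \<Rightarrow> ('r, 'q, 'y) module_scheme \<Rightarrow> ('m::comm_monoid_add \<Rightarrow> 'g set) \<Rightarrow>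
    ('r, 'm \<Rightarrow> 'g set \<Rightarrow> 'q) module"
  where "layer_module G Q \<pi> =
    \<lparr>carrier = carrier (layer_sum G Q \<pi>),
     monoid.mult = undefined,
     monoid.one = undefined,
     ring.zero = \<one>\<^bsub>layer_sum G Q \<pi>\<^esub>,
     ring.add = monoid.mult (layer_sum G Q \<pi>),
     module.smult = (\<lambda>r v s. \<lambda>Y\<in>carrier (layer_quotient G \<pi> s). r \<odot>\<^bsub>Q\<^esub> v s Y)\<rparr>"

text \<open>
  The homomorphism \<open>h\<close> below is unique: its values on all cosets are prescribed if \<open>s + t \<noteq> 0\<close>, and
  the component of degree \<open>0\<close> is trivial. The vanishing of the action for \<open>s = 0\<close> or \<open>t = 0\<close>
  follows from biadditivity, since the components of degree \<open>0\<close> vanish.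
\<close>

definition is_layer_action ::
  "('g, 'x) monoid_scheme \<Rightarrow> ('r, 'y) ring_scheme \<Rightarrow> ('r, 'q, 'z) module_scheme \<Rightarrow>
    ('m::comm_monoid_add \<Rightarrow> 'g set) \<Rightarrow> ('m \<Rightarrow> 'g set) \<Rightarrow>
    (('m \<Rightarrow> ('g set \<times> 'r \<Rightarrow>\<^sub>0 int) set) \<Rightarrow> ('m \<Rightarrow> 'g set \<Rightarrow> 'q) \<Rightarrow> ('m \<Rightarrow> 'g set \<Rightarrow> 'q)) \<Rightarrow> bool"
  where "is_layer_action G R Q \<phi> \<pi> act \<longleftrightarrow>
    case_prod act \<in> extensional (carrier (filter_sum G R \<phi>) \<times> carrier (layer_sum G Q \<pi>)) \<and>
    biadditive (filter_sum G R \<phi>) (layer_sum G Q \<pi>) (layer_sum G Q \<pi>) act \<and>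
    (\<forall>s t. s \<noteq> 0 \<longrightarrow> t \<noteq> 0 \<longrightarrow>
      (\<forall>x\<in>\<phi> s. \<forall>r\<in>carrier R. \<forall>f\<in>carrier (layer_component G Q \<pi> t).
        \<exists>h\<in>carrier (layer_component G Q \<pi> (s + t)).
          act (filter_elem G R \<phi> s x r) (sum_inj (layer_component G Q \<pi>) t f) =
            sum_inj (layer_component G Q \<pi>) (s + t) h \<and>
          (s + t \<noteq> 0 \<longrightarrow> (\<forall>y\<in>layer_boundary G \<pi> (s + t).
            h (\<pi> (s + t) #>\<^bsub>G\<^esub> y) = \<ominus>\<^bsub>Q\<^esub> (r \<odot>\<^bsub>Q\<^esub> f (\<pi> t #>\<^bsub>G\<^esub> commutator G x y))))))"

definition layer_action ::
  "('g, 'x) monoid_scheme \<Rightarrow> ('r, 'y) ring_scheme \<Rightarrow> ('r, 'q, 'z) module_scheme \<Rightarrow>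
    ('m::comm_monoid_add \<Rightarrow> 'g set) \<Rightarrow> ('m \<Rightarrow> 'g set) \<Rightarrow>
    ('m \<Rightarrow> ('g set \<times> 'r \<Rightarrow>\<^sub>0 int) set) \<Rightarrow> ('m \<Rightarrow> 'g set \<Rightarrow> 'q) \<Rightarrow> ('m \<Rightarrow> 'g set \<Rightarrow> 'q)"
  where "layer_action G R Q \<phi> \<pi> = (THE act. is_layer_action G R Q \<phi> \<pi> act)"

end

theory Submission
  imports Defs
begin

text \<open>
  Every identity in the theorem is additive in each argument, and the two direct sums are generated
  by simple elements: the ring by the classes of \<open>x \<in> \<phi> s\<close> tensored with a scalar, in degrees
  \<open>s \<noteq> 0\<close>, and the module by single homomorphisms placed in one degree. So uniqueness of the product
  and of the action, and each law, are checked on these elements only. Existence is the dual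
  statement, a universal property: a biadditive map out of the ring is a homomorphism from the ring
  into a group of homomorphisms (\<open>biadditive_lift\<close>), and such a homomorphism is given by values on
  the generators that are multiplicative in \<open>x\<close>, additive in the scalar, and trivial for \<open>x\<close> in the
  boundary (\<open>filter_sum_lift\<close>).

  What remains is about commutators in the group. Both kinds of quotients, \<open>\<phi> s\<close> modulo its boundary
  and the boundary of \<open>\<pi> s\<close> modulo \<open>\<pi> s\<close>, are sections \<open>H / K\<close> with \<open>[H, H] \<subseteq> K\<close>. In such a section
  the identities \<open>[x x', y] = [x, y] [[x, y], x'] [x', y]\<close> and
  \<open>[x, y y'] = [x, y'] [x, y] [[x, y], y']\<close> become biadditivity, because the triple commutators lie in
  \<open>K\<close>: a factor of nonzero degree pushes a commutator one step further along the filter or the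
  layering. The bracket, and the map \<open>y \<mapsto> [x, y]\<close> between the sections of the layering whose
  dual is the action, are therefore well defined on classes.

  The Jacobi identity and the module law are both the Hall--Witt identity, read in a section where
  its outer conjugations are trivial (\<open>cls_hall_witt\<close>). The inverses in its inner commutators
  become signs. In the ring this happens by biadditivity of the bracket (\<open>lie_gen_cyclic\<close>); in the
  module one of the three elements is not a ring element but the argument of the functionals, so the
  signs are computed in the sections themselves (\<open>cls_comm_comm\<close>).

  Sums of degrees that happen to be \<open>0\<close> need care, since degree \<open>0\<close> is killed by definition. If
  \<open>s + t = 0\<close> with \<open>s \<noteq> 0\<close>, then \<open>u + s\<close> and \<open>u\<close> precede each other, so each \<open>\<phi> u = \<phi> (u + s)\<close>
  equals its boundary, and the whole ring is trivial (\<open>filter_eq_boundary\<close>, \<open>L_trivial\<close>).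
  Otherwise no sum of nonzero degrees vanishes and the generic computation applies.
\<close>

section \<open>Homomorphisms and generators\<close>

lemma hom_eq_on_generators:
  assumes "group A" "group B" "f \<in> hom A B" "g \<in> hom A B"
    and gen: "carrier A = generate A T"
    and eq: "\<And>x. x \<in> T \<Longrightarrow> f x = g x"
    and "a \<in> carrier A"
  shows "f a = g a"
proof -
  interpret f: group_hom A B f by (simp add: assms group_hom.intro group_hom_axioms.intro)
  interpret g: group_hom A B g by (simp add: assms group_hom.intro group_hom_axioms.intro)
  have "T \<subseteq> carrier A" using gen generate.incl by fast
  have "a \<in> generate A T" using assms by simp
  then show ?thesis
  proof (induction a rule: generate.induct)
    case one then show ?case by simp
  next
    case (incl h) then show ?case by (rule eq)
  next
    case (inv h) then show ?case using \<open>T \<subseteq> carrier A\<close> eq by (metis f.hom_inv g.hom_inv subsetD)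
  next
    case (eng h1 h2) then show ?case using gen by simp
  qed
qed

lemma hom_generators_in_subgroup:
  assumes "group A" "group B" "f \<in> hom A B" "subgroup K B"
    and gen: "carrier A = generate A T"
    and "\<And>x. x \<in> T \<Longrightarrow> f x \<in> K"
    and "a \<in> carrier A"
  shows "f a \<in> K"
proof -
  interpret f: group_hom A B f by (simp add: assms group_hom.intro group_hom_axioms.intro)
  interpret K: subgroup K B by fact
  have "T \<subseteq> carrier A" using gen generate.incl by fast
  have "a \<in> generate A T" using assms by simp
  then show ?thesis
  proof (induction a rule: generate.induct)
    case (inv h) then show ?case using \<open>T \<subseteq> carrier A\<close> assms(6) by (metis K.m_inv_closed f.hom_inv subsetD)
  next
    case (eng h1 h2) then show ?case using gen by simp
  qed (use assms in auto)
qed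

lemma biadditiveI:
  assumes "\<And>a. a \<in> carrier A \<Longrightarrow> \<beta> a \<in> hom B C"
    and "\<And>b. b \<in> carrier B \<Longrightarrow> (\<lambda>a. \<beta> a b) \<in> hom A C"
  shows "biadditive A B C \<beta>"
  using assms by (simp add: biadditive_def)

lemma biadditive_homs:
  assumes "biadditive A B C \<beta>"
  shows biadditive_hom_right: "a \<in> carrier A \<Longrightarrow> \<beta> a \<in> hom B C"
    and biadditive_hom_left: "b \<in> carrier B \<Longrightarrow> (\<lambda>a. \<beta> a b) \<in> hom A C"
  using assms by (auto simp: biadditive_def)

lemma biadditive_closed:
  "biadditive A B C \<beta> \<Longrightarrow> a \<in> carrier A \<Longrightarrow> b \<in> carrier B \<Longrightarrow> \<beta> a b \<in> carrier C"
  by (rule hom_in_carrier[OF biadditive_hom_right])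

lemma biadditive_eq_on_generators:
  assumes grp: "group A" "group B" "group C"
    and bi: "biadditive A B C \<beta>" "biadditive A B C \<gamma>"
    and gen: "carrier A = generate A T" "carrier B = generate B Y"
    and eq: "\<And>x y. x \<in> T \<Longrightarrow> y \<in> Y \<Longrightarrow> \<beta> x y = \<gamma> x y"
    and a: "a \<in> carrier A" and b: "b \<in> carrier B"
  shows "\<beta> a b = \<gamma> a b"
proof -
  have T: "x \<in> carrier A" if "x \<in> T" for x using gen(1) that generate.incl by fast
  have "\<beta> x b = \<gamma> x b" if "x \<in> T" for x
    by (rule hom_eq_on_generators[OF grp(2,3) biadditive_hom_right[OF bi(1) T[OF that]]
          biadditive_hom_right[OF bi(2) T[OF that]] gen(2) eq[OF that] b])
  then show ?thesis
    by (rule hom_eq_on_generators[OF grp(1,3) biadditive_hom_left[OF bi(1) b]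
          biadditive_hom_left[OF bi(2) b] gen(1) _ a])
qed

text \<open>
  The graded components of the module of a layering are of this form, with values in \<open>Q\<close>. With the direct sums as
  source and target it makes biadditive maps into homomorphisms, so that the universal property of
  the graded ring also constructs maps of two arguments. Extensionality makes equality in the group
  the same as equality on the source.
\<close>

definition hom_group :: "('a, 'x) monoid_scheme \<Rightarrow> ('b, 'y) monoid_scheme \<Rightarrow> ('a \<Rightarrow> 'b) monoid" where
  "hom_group A B =
    \<lparr>carrier = hom A B \<inter> extensional (carrier A),
     monoid.mult = (\<lambda>f g. \<lambda>a\<in>carrier A. f a \<otimes>\<^bsub>B\<^esub> g a),
     monoid.one = (\<lambda>a\<in>carrier A. \<one>\<^bsub>B\<^esub>)\<rparr>"

lemma restrict_in_hom_group:
  "group A \<Longrightarrow> f \<in> hom A B \<Longrightarrow> restrict f (carrier A) \<in> carrier (hom_group A B)"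
  by (auto simp: hom_group_def hom_def Pi_iff group.is_monoid monoid.m_closed)

lemma comm_group_hom_group:
  assumes "group A" "comm_group B"
  shows "comm_group (hom_group A B)"
proof -
  interpret A: group A by fact
  interpret B: comm_group B by fact
  show ?thesis
  proof (rule comm_groupI)
    fix f assume f: "f \<in> carrier (hom_group A B)"
    then have "(\<lambda>a\<in>carrier A. inv\<^bsub>B\<^esub> f a) \<in> carrier (hom_group A B)"
      by (auto simp: hom_group_def hom_def Pi_iff B.inv_mult)
    moreover have "(\<lambda>a\<in>carrier A. inv\<^bsub>B\<^esub> f a) \<otimes>\<^bsub>hom_group A B\<^esub> f = \<one>\<^bsub>hom_group A B\<^esub>"
      using f by (auto simp: hom_group_def hom_def Pi_iff)
    ultimately show "\<exists>g\<in>carrier (hom_group A B). g \<otimes>\<^bsub>hom_group A B\<^esub> f = \<one>\<^bsub>hom_group A B\<^esub>" by blast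
  qed (auto simp: hom_group_def hom_def Pi_iff B.m_ac extensional_def fun_eq_iff)
qed

lemma eval_hom_group:
  "a \<in> carrier A \<Longrightarrow> (\<lambda>f. f a) \<in> hom (hom_group A B) B"
  by (auto simp: hom_group_def hom_def Pi_iff)

lemma biadditive_of_hom_to_hom_group:
  assumes "F \<in> hom A (hom_group B C)"
  shows "biadditive A B C F"
proof (rule biadditiveI)
  show "F a \<in> hom B C" if "a \<in> carrier A" for a
    using hom_in_carrier[OF assms that] by (simp add: hom_group_def)
  show "(\<lambda>a. F a b) \<in> hom A C" if "b \<in> carrier B" for b
    using hom_compose[OF assms eval_hom_group[OF that]] by (simp add: comp_def)
qed

text \<open>
  Relations between values of a map into a group of homomorphisms are proved in this way: by evaluating
  both sides on generators of the source.
\<close>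

lemma hom_group_eqI:
  assumes "group B" "group C"
    and "f \<in> carrier (hom_group B C)" "g \<in> carrier (hom_group B C)"
    and "carrier B = generate B Y"
    and "\<And>y. y \<in> Y \<Longrightarrow> f y = g y"
  shows "f = g"
proof
  fix b
  show "f b = g b"
  proof (cases "b \<in> carrier B")
    case True
    then show ?thesis
      using hom_eq_on_generators[OF assms(1,2) _ _ assms(5), of f g] assms by (simp add: hom_group_def)
  next
    case False
    then show ?thesis using assms(3,4) by (simp add: hom_group_def extensional_def)
  qed
qed

lemma hom_group_map:
  assumes "group A'" "group B'" "d \<in> hom A' A" "q \<in> hom B B'"
  shows "(\<lambda>f. \<lambda>a\<in>carrier A'. q (f (d a))) \<in> hom (hom_group A B) (hom_group A' B')"
proof (rule homI)
  fix f assume "f \<in> carrier (hom_group A B)"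
  then have "f \<in> hom A B" by (simp add: hom_group_def)
  then have "(\<lambda>a. q (f (d a))) \<in> hom A' B'"
    using Group.hom_compose[OF Group.hom_compose[OF assms(3)] assms(4)] by (simp add: comp_def)
  then show "(\<lambda>a\<in>carrier A'. q (f (d a))) \<in> carrier (hom_group A' B')"
    by (rule restrict_in_hom_group[OF assms(1)])
next
  fix f g assume f: "f \<in> carrier (hom_group A B)" "g \<in> carrier (hom_group A B)"
  then have "f (d a) \<in> carrier B" "g (d a) \<in> carrier B" if "a \<in> carrier A'" for a
    using that hom_in_carrier[OF assms(3)] by (auto simp: hom_group_def hom_def Pi_iff)
  then show "(\<lambda>a\<in>carrier A'. q ((f \<otimes>\<^bsub>hom_group A B\<^esub> g) (d a))) =
    (\<lambda>a\<in>carrier A'. q (f (d a))) \<otimes>\<^bsub>hom_group A' B'\<^esub> (\<lambda>a\<in>carrier A'. q (g (d a)))"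
    using hom_in_carrier[OF assms(3)] hom_mult[OF assms(4)]
    by (simp add: hom_group_def fun_eq_iff)
qed

lemma extensional_biadditive_eqI:
  assumes grp: "group A" "group B" "group C"
    and bi: "biadditive A B C \<beta>" "biadditive A B C \<gamma>"
    and extl: "case_prod \<beta> \<in> extensional (carrier A \<times> carrier B)"
      "case_prod \<gamma> \<in> extensional (carrier A \<times> carrier B)"
    and gen: "carrier A = generate A T" "carrier B = generate B U"
    and eq: "\<And>x y. x \<in> T \<Longrightarrow> y \<in> U \<Longrightarrow> \<beta> x y = \<gamma> x y"
  shows "\<beta> = \<gamma>"
proof (intro ext)
  fix a b
  show "\<beta> a b = \<gamma> a b"
  proof (cases "a \<in> carrier A \<and> b \<in> carrier B")
    case True
    then show ?thesis using biadditive_eq_on_generators[OF grp bi gen eq] by blast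
  next
    case False
    then show ?thesis using extl by (auto simp: extensional_def)
  qed
qed

lemma comp_biadditive:
  assumes "biadditive A B C \<beta>" "h \<in> hom C D"
  shows "biadditive A B D (\<lambda>a b. h (\<beta> a b))"
  using assms by (fastforce simp: biadditive_def hom_def Pi_iff)

lemma (in comm_group) inv_in_hom: "m_inv G \<in> hom G G"
  by (rule homI) (simp_all add: inv_mult)

lemma (in comm_group) hom_mult_pointwise:
  "f \<in> hom A G \<Longrightarrow> g \<in> hom A G \<Longrightarrow> (\<lambda>a. f a \<otimes> g a) \<in> hom A G"
  by (auto simp: hom_def Pi_iff m_ac)

lemma biadditive_transpose: "biadditive A B C \<beta> \<Longrightarrow> biadditive B A C (\<lambda>b a. \<beta> a b)"
  by (simp add: biadditive_def)

lemma biadditive_inv: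
  assumes "group A" "group B" "group C" "biadditive A B C \<beta>" "a \<in> carrier A" "b \<in> carrier B"
  shows biadditive_inv_left: "\<beta> (inv\<^bsub>A\<^esub> a) b = inv\<^bsub>C\<^esub> \<beta> a b"
    and biadditive_inv_right: "\<beta> a (inv\<^bsub>B\<^esub> b) = inv\<^bsub>C\<^esub> \<beta> a b"
proof -
  interpret l: group_hom A C "\<lambda>a. \<beta> a b"
    by (intro group_hom.intro group_hom_axioms.intro assms biadditive_hom_left[OF assms(4)])
  show "\<beta> (inv\<^bsub>A\<^esub> a) b = inv\<^bsub>C\<^esub> \<beta> a b" using l.hom_inv assms by blast
  interpret r: group_hom B C "\<beta> a"
    by (intro group_hom.intro group_hom_axioms.intro assms biadditive_hom_right[OF assms(4)])
  show "\<beta> a (inv\<^bsub>B\<^esub> b) = inv\<^bsub>C\<^esub> \<beta> a b" using r.hom_inv assms by blast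
qed

lemma biadditive_one:
  assumes "group A" "group B" "group C" "biadditive A B C \<beta>"
  shows biadditive_one_left: "b \<in> carrier B \<Longrightarrow> \<beta> \<one>\<^bsub>A\<^esub> b = \<one>\<^bsub>C\<^esub>"
    and biadditive_one_right: "a \<in> carrier A \<Longrightarrow> \<beta> a \<one>\<^bsub>B\<^esub> = \<one>\<^bsub>C\<^esub>"
  using hom_one[OF biadditive_hom_left[OF assms(4)] assms(1,3)]
    hom_one[OF biadditive_hom_right[OF assms(4)] assms(2,3)] by auto

text \<open>
  Used for identities such as \<open>[x, y] [x, inv y] [[x, inv y], y] = 1\<close>, where \<open>h\<close> kills the triple
  commutator: an inverse inside a commutator becomes an inverse of its class.
\<close>

lemma (in group_hom) hom_eq_inv_if_trivial_product:
  assumes "a \<in> carrier G" "b \<in> carrier G" "e \<in> carrier G"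
    and "a \<otimes> b \<otimes> e = \<one> \<or> a \<otimes> e \<otimes> b = \<one>" and "h e = \<one>\<^bsub>H\<^esub>"
  shows "h b = inv\<^bsub>H\<^esub> h a"
proof -
  have "h a \<otimes>\<^bsub>H\<^esub> h b = \<one>\<^bsub>H\<^esub>"
  proof -
    have "h a \<otimes>\<^bsub>H\<^esub> h b \<otimes>\<^bsub>H\<^esub> h e = \<one>\<^bsub>H\<^esub> \<or> h a \<otimes>\<^bsub>H\<^esub> h e \<otimes>\<^bsub>H\<^esub> h b = \<one>\<^bsub>H\<^esub>"
      using assms by (metis G.m_closed hom_mult hom_one)
    then show ?thesis using assms by auto
  qed
  then show ?thesis using assms by (metis H.inv_equality H.inv_inv hom_closed)
qed

text \<open>
  The graded ring and module are records whose additive structure is copied from a multiplicatively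
  written direct sum; the next lemmas move statements from the latter to the former.
\<close>

lemma abelian_group_of_comm_group:
  assumes "comm_group M" "carrier V = carrier M" "ring.add V = monoid.mult M" "ring.zero V = \<one>\<^bsub>M\<^esub>"
  shows "abelian_group V"
proof -
  interpret M: comm_group M by fact
  show ?thesis
    by (rule abelian_groupI)
      (use assms M.m_closed M.one_closed M.m_assoc M.m_comm M.l_one M.l_inv_ex in auto)
qed

lemma hom_add_monoid_dom:
  "carrier V = carrier M \<Longrightarrow> ring.add V = monoid.mult M \<Longrightarrow> hom (add_monoid V) B = hom M B"
  by (simp add: hom_def)

lemma hom_add_monoid_cod:
  "carrier V = carrier M \<Longrightarrow> ring.add V = monoid.mult M \<Longrightarrow> hom B (add_monoid V) = hom B M"
  by (simp add: hom_def)

lemma a_inv_eq_m_inv: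
  "carrier V = carrier M \<Longrightarrow> ring.add V = monoid.mult M \<Longrightarrow> ring.zero V = \<one>\<^bsub>M\<^esub> \<Longrightarrow>
    \<ominus>\<^bsub>V\<^esub> a = inv\<^bsub>M\<^esub> a"
  by (simp add: a_inv_def m_inv_def)

section \<open>Direct sums\<close>

locale comm_group_family =
  fixes C :: "'m \<Rightarrow> ('a, 'x) monoid_scheme"
  assumes comm_group_component: "comm_group (C s)"
begin

abbreviation "S \<equiv> sum_group UNIV C"

lemma group_component: "group (C s)"
  using comm_group_component comm_group.axioms(2) by blast

sublocale component: comm_group "C s" for s
  by (rule comm_group_component)

lemma carrier_S: "carrier S = {v. (\<forall>s. v s \<in> carrier (C s)) \<and> finite {s. v s \<noteq> \<one>\<^bsub>C s\<^esub>}}"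
  by (auto simp: carrier_sum_group[OF group_component])

lemma comm_group_S: "comm_group S"
  by (rule group.group_comm_groupI[OF sum_group[OF group_component]])
    (auto simp: carrier_S component.m_comm)

sublocale S: comm_group S
  by (rule comm_group_S)

lemma sum_inj_hom: "sum_inj C s \<in> hom (C s) S"
  by (auto simp: hom_def carrier_S sum_inj_def intro: rev_finite_subset[of "{s}"])

sublocale inj: group_hom "C s" S "sum_inj C s" for s
  by (intro group_hom.intro group_hom_axioms.intro group_component S.is_group sum_inj_hom)

lemma component_closed: "v \<in> carrier S \<Longrightarrow> v s \<in> carrier (C s)"
  by (simp add: carrier_S)

lemma subgroup_homogeneous: "subgroup (homogeneous C s) S"
  unfolding homogeneous_def by (rule inj.img_is_subgroup)

lemma homogeneous_in_carrier: "v \<in> homogeneous C s \<Longrightarrow> v \<in> carrier S"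
  using subgroup.mem_carrier[OF subgroup_homogeneous] .

lemma homogeneous_component:
  assumes "v \<in> homogeneous C s"
  shows "v u = (if u = s then v s else \<one>\<^bsub>C u\<^esub>)"
  using assms by (auto simp: homogeneous_def sum_inj_def)

lemma finprod_homogeneous_component:
  assumes "\<And>s. f s \<in> homogeneous C s" "finite A"
  shows "finprod S f A u = (if u \<in> A then f u u else \<one>\<^bsub>C u\<^esub>)"
  using \<open>finite A\<close>
proof (induction A rule: finite_induct)
  case empty then show ?case by simp
next
  case (insert s A)
  have [simp]: "f s \<in> carrier S" for s using assms(1) homogeneous_in_carrier by blast
  have c: "f s u \<in> carrier (C u)" for s by (rule component_closed) simp
  show ?case
    using insert c homogeneous_component[OF assms(1), of s u]
    by (subst S.finprod_insert) (auto simp: Pi_iff)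
qed

lemma finprod_components:
  assumes "v \<in> carrier S"
  shows "v = finprod S (\<lambda>s. sum_inj C s (v s)) {s. v s \<noteq> \<one>\<^bsub>C s\<^esub>}"
proof
  fix u
  show "v u = finprod S (\<lambda>s. sum_inj C s (v s)) {s. v s \<noteq> \<one>\<^bsub>C s\<^esub>} u"
    by (subst finprod_homogeneous_component)
      (use assms in \<open>auto simp: carrier_S homogeneous_def\<close>, simp add: sum_inj_def)
qed

lemma sum_inj_eq_one_iff:
  "c \<in> carrier (C s) \<Longrightarrow> sum_inj C s c = \<one>\<^bsub>S\<^esub> \<longleftrightarrow> c = \<one>\<^bsub>C s\<^esub>"
  by (auto simp: sum_inj_def fun_eq_iff)

text \<open>Comparing coordinates shows that the only decomposition is the one into coordinates.\<close>

lemma decomposition_unique: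
  assumes v: "v \<in> carrier S"
  shows "\<exists>!f. (\<forall>s. f s \<in> homogeneous C s) \<and> finite {s. f s \<noteq> \<one>\<^bsub>S\<^esub>} \<and>
    v = finprod S f {s. f s \<noteq> \<one>\<^bsub>S\<^esub>}"
proof (rule ex1I)
  let ?f = "\<lambda>s. sum_inj C s (v s)"
  have "v s \<in> carrier (C s)" for s using v by (simp add: carrier_S)
  then have "{s. ?f s \<noteq> \<one>\<^bsub>S\<^esub>} = {s. v s \<noteq> \<one>\<^bsub>C s\<^esub>}"
    using sum_inj_eq_one_iff by blast
  then show "(\<forall>s. ?f s \<in> homogeneous C s) \<and> finite {s. ?f s \<noteq> \<one>\<^bsub>S\<^esub>} \<and> v = finprod S ?f {s. ?f s \<noteq> \<one>\<^bsub>S\<^esub>}"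
    using v finprod_components[OF v] by (auto simp: carrier_S homogeneous_def)
next
  fix f
  assume f: "(\<forall>s. f s \<in> homogeneous C s) \<and> finite {s. f s \<noteq> \<one>\<^bsub>S\<^esub>} \<and> v = finprod S f {s. f s \<noteq> \<one>\<^bsub>S\<^esub>}"
  have "v s = f s s" for s
  proof -
    have "v s = (if s \<in> {s. f s \<noteq> \<one>\<^bsub>S\<^esub>} then f s s else \<one>\<^bsub>C s\<^esub>)"
      using f finprod_homogeneous_component by metis
    then show ?thesis by auto
  qed
  moreover have "f s = sum_inj C s (f s s)" for s
  proof
    show "f s u = sum_inj C s (f s s) u" for u
      using homogeneous_component[of "f s" s u] f by (auto simp: sum_inj_def)
  qed
  ultimately show "f = (\<lambda>s. sum_inj C s (v s))" by (metis (no_types))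
qed

lemma S_generated: "carrier S = generate S {sum_inj C s c | s c. c \<in> carrier (C s)}"
proof
  let ?T = "{sum_inj C s c | s c. c \<in> carrier (C s)}"
  have T: "?T \<subseteq> carrier S" using inj.hom_closed by blast
  show "generate S ?T \<subseteq> carrier S" by (rule S.generate_incl[OF T])
  show "carrier S \<subseteq> generate S ?T"
  proof
    fix v assume v: "v \<in> carrier S"
    interpret K: subgroup "generate S ?T" S by (rule S.generate_is_subgroup[OF T])
    have "finprod S (\<lambda>s. sum_inj C s (v s)) A \<in> generate S ?T" if "finite A" for A
      using that
    proof (induction A rule: finite_induct)
      case empty then show ?case by (simp add: K.one_closed del: one_sum_group)
    next
      case (insert s A)
      have c: "v s \<in> carrier (C s)" for s using v by (simp add: carrier_S)
      then have "sum_inj C s (v s) \<in> generate S ?T" by (intro generate.incl) blast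
      then show ?case using insert c K.m_closed by (subst S.finprod_insert) (auto simp del: mult_sum_group)
    qed
    then show "v \<in> generate S ?T"
      by (subst finprod_components[OF v]) (use v in \<open>simp add: carrier_S\<close>)
  qed
qed

lemma sum_lift:
  assumes "comm_group D" "\<And>s. h s \<in> hom (C s) D"
  obtains k where "k \<in> hom S D" "\<And>s c. c \<in> carrier (C s) \<Longrightarrow> k (sum_inj C s c) = h s c"
proof
  interpret D: comm_group D by fact
  interpret h: group_hom "C s" D "h s" for s
    by (intro group_hom.intro group_hom_axioms.intro group_component D.is_group assms)
  let ?k = "\<lambda>v. gfinprod D (\<lambda>s. h s (v s)) UNIV"
  show "?k \<in> hom S D"
    by (rule D.hom_group_sum[OF assms(2) group_component])
  show "?k (sum_inj C s c) = h s c" if "c \<in> carrier (C s)" for s c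
  proof -
    have "?k (sum_inj C s c) = gfinprod D (\<lambda>u. h u (sum_inj C s c u)) {s}"
      by (rule D.gfinprod_mono_neutral_cong_right) (use that in \<open>auto simp: sum_inj_def\<close>)
    also have "\<dots> = h s c" using that by (simp add: sum_inj_def)
    finally show ?thesis .
  qed
qed

text \<open>
  Scalars act on both direct sums in this way.
\<close>

lemma componentwise_hom:
  assumes h: "\<And>s. h s \<in> hom (C s) (C s)"
  shows componentwise_in_hom: "(\<lambda>v s. h s (v s)) \<in> hom S S"
    and componentwise_sum_inj: "(\<lambda>u. h u (sum_inj C s c u)) = sum_inj C s (h s c)"
proof -
  have one: "h s \<one>\<^bsub>C s\<^esub> = \<one>\<^bsub>C s\<^esub>" for s
    by (rule hom_one[OF h group_component group_component])
  then show "(\<lambda>u. h u (sum_inj C s c u)) = sum_inj C s (h s c)"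
    by (auto simp: sum_inj_def)
  show "(\<lambda>v s. h s (v s)) \<in> hom S S"
  proof (rule homI)
    fix v assume v: "v \<in> carrier S"
    have "{s. h s (v s) \<noteq> \<one>\<^bsub>C s\<^esub>} \<subseteq> {s. v s \<noteq> \<one>\<^bsub>C s\<^esub>}" using one by auto
    then show "(\<lambda>s. h s (v s)) \<in> carrier S"
      using v hom_in_carrier[OF h] by (auto simp: carrier_S intro: finite_subset)
  next
    fix v w assume "v \<in> carrier S" "w \<in> carrier S"
    then show "(\<lambda>s. h s ((v \<otimes>\<^bsub>S\<^esub> w) s)) = (\<lambda>s. h s (v s)) \<otimes>\<^bsub>S\<^esub> (\<lambda>s. h s (w s))"
      by (simp add: carrier_S hom_mult[OF h] fun_eq_iff)
  qed
qed

lemma internal_direct_sum_homogeneous: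
  assumes V: "carrier V = carrier S" "ring.add V = monoid.mult S" "ring.zero V = \<one>\<^bsub>S\<^esub>"
  shows "internal_direct_sum V (homogeneous C)"
proof -
  interpret V: abelian_group V by (rule abelian_group_of_comm_group[OF comm_group_S V])
  have "subgroup (homogeneous C s) (add_monoid V)" for s
  proof (rule group.subgroupI[OF V.a_group])
    interpret H: subgroup "homogeneous C s" S by (rule subgroup_homogeneous)
    show "homogeneous C s \<subseteq> carrier (add_monoid V)" using H.subset V by simp
    show "homogeneous C s \<noteq> {}" using H.one_closed by blast
    show "inv\<^bsub>add_monoid V\<^esub> v \<in> homogeneous C s" if "v \<in> homogeneous C s" for v
      using H.m_inv_closed[OF that] a_inv_eq_m_inv[OF V] by (simp add: a_inv_def)
    show "v \<otimes>\<^bsub>add_monoid V\<^esub> w \<in> homogeneous C s" if "v \<in> homogeneous C s" "w \<in> homogeneous C s" for v w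
      using H.m_closed[OF that] V by (simp del: mult_sum_group)
  qed
  moreover have "\<exists>!f. (\<forall>s. f s \<in> homogeneous C s) \<and> finite {s. f s \<noteq> \<zero>\<^bsub>V\<^esub>} \<and>
      v = finsum V f {s. f s \<noteq> \<zero>\<^bsub>V\<^esub>}" if "v \<in> carrier V" for v
  proof -
    have "finsum V f A = finprod S f A" for f :: "'m \<Rightarrow> _" and A
      unfolding finsum_def finprod_def using V by simp
    then show ?thesis
      using decomposition_unique[of v] that unfolding V by presburger
  qed
  ultimately show ?thesis
    unfolding internal_direct_sum_def by blast
qed

end

section \<open>Tensor products\<close>

locale tensor_factors = A: comm_group A + R: abelian_group R
  for A :: "('a, 'x) monoid_scheme" and R :: "('r, 'y) ring_scheme"
begin

abbreviation "F \<equiv> tensor_free A R"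
abbreviation "Rel \<equiv> tensor_relations A R"
abbreviation "cl p \<equiv> Rel #>\<^bsub>F\<^esub> p"
abbreviation "AR \<equiv> tensor A R"

sublocale F: comm_group F
  by (rule abelian_free_Abelian_group)

lemma pair_in_F: "x \<in> carrier A \<Longrightarrow> r \<in> carrier R \<Longrightarrow> frag_of (x, r) \<in> carrier F"
  by simp

lemma minus_in_F: "p \<in> carrier F \<Longrightarrow> q \<in> carrier F \<Longrightarrow> p - q \<in> carrier F"
  using keys_diff[of p q] by auto

lemma plus_in_F: "p \<in> carrier F \<Longrightarrow> q \<in> carrier F \<Longrightarrow> p + q \<in> carrier F"
  using F.m_closed[of p q] by simp

lemma subgroup_Rel: "subgroup Rel F"
  unfolding tensor_relations_def
  by (rule F.generate_is_subgroup) (auto intro!: minus_in_F simp del: carrier_free_Abelian_group_iff)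

sublocale Rel: normal Rel F
  using F.subgroup_imp_normal[OF subgroup_Rel] .

lemma comm_group_tensor: "comm_group AR"
  unfolding tensor_def by (rule F.abelian_FactGroup[OF subgroup_Rel])

sublocale AR: comm_group AR
  by (rule comm_group_tensor)

lemma cl_hom: "(\<lambda>p. cl p) \<in> hom F AR"
  using Rel.r_coset_hom_Mod by (simp add: tensor_def)

lemma pure_tensor_closed:
  "x \<in> carrier A \<Longrightarrow> r \<in> carrier R \<Longrightarrow> pure_tensor A R x r \<in> carrier AR"
  unfolding pure_tensor_def by (rule hom_in_carrier[OF cl_hom]) simp

lemma cl_eq_of_relation:
  assumes "p \<in> carrier F" "q \<in> carrier F" "q' \<in> carrier F" "p - q - q' \<in> Rel"
  shows "cl p = cl q \<otimes>\<^bsub>AR\<^esub> cl q'"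
proof -
  have "p = (p - q - q') \<otimes>\<^bsub>F\<^esub> (q \<otimes>\<^bsub>F\<^esub> q')" by simp
  also have "cl \<dots> = cl (p - q - q') \<otimes>\<^bsub>AR\<^esub> cl (q \<otimes>\<^bsub>F\<^esub> q')"
    using assms by (intro hom_mult[OF cl_hom]) (auto intro: minus_in_F plus_in_F simp del: carrier_free_Abelian_group_iff)
  also have "cl (p - q - q') = \<one>\<^bsub>AR\<^esub>"
    using Rel.rcos_const[OF F.is_group assms(4)] by (simp add: tensor_def)
  also have "cl (q \<otimes>\<^bsub>F\<^esub> q') = cl q \<otimes>\<^bsub>AR\<^esub> cl q'"
    by (rule hom_mult[OF cl_hom assms(2,3)])
  finally show ?thesis
    using hom_in_carrier[OF cl_hom] assms by simp
qed

lemma pure_tensor_hom_left: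
  assumes "r \<in> carrier R"
  shows "(\<lambda>x. pure_tensor A R x r) \<in> hom A AR"
proof (rule homI)
  show "pure_tensor A R (x \<otimes>\<^bsub>A\<^esub> y) r = pure_tensor A R x r \<otimes>\<^bsub>AR\<^esub> pure_tensor A R y r"
    if "x \<in> carrier A" "y \<in> carrier A" for x y
    unfolding pure_tensor_def using that assms
    by (intro cl_eq_of_relation) (auto simp: tensor_relations_def intro!: generate.incl)
qed (use assms pure_tensor_closed in auto)

lemma pure_tensor_hom_right:
  assumes "x \<in> carrier A"
  shows "pure_tensor A R x \<in> hom (add_monoid R) AR"
proof (rule homI)
  show "pure_tensor A R x (r \<otimes>\<^bsub>add_monoid R\<^esub> r') = pure_tensor A R x r \<otimes>\<^bsub>AR\<^esub> pure_tensor A R x r'"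
    if "r \<in> carrier (add_monoid R)" "r' \<in> carrier (add_monoid R)" for r r'
    unfolding pure_tensor_def using that assms
    by (intro cl_eq_of_relation) (auto simp: tensor_relations_def intro!: generate.incl)
qed (use assms pure_tensor_closed in auto)

lemma tensor_generated:
  "carrier AR = generate AR {pure_tensor A R x r | x r. x \<in> carrier A \<and> r \<in> carrier R}"
proof
  let ?T = "{pure_tensor A R x r | x r. x \<in> carrier A \<and> r \<in> carrier R}"
  have T: "?T \<subseteq> carrier AR" using pure_tensor_closed by blast
  show "generate AR ?T \<subseteq> carrier AR" by (rule AR.generate_incl[OF T])
  interpret K: subgroup "generate AR ?T" AR by (rule AR.generate_is_subgroup[OF T])
  interpret cl: group_hom F AR "\<lambda>p. cl p"
    by (intro group_hom.intro group_hom_axioms.intro F.is_group AR.is_group cl_hom)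
  have "cl p \<in> generate AR ?T" if "Poly_Mapping.keys p \<subseteq> carrier A \<times> carrier R" for p
    using that
  proof (rule free_Abelian_group_induct)
    show "cl 0 \<in> generate AR ?T" using cl.hom_one K.one_closed by simp
  next
    fix p q :: "'a \<times> 'r \<Rightarrow>\<^sub>0 int"
    assume pq: "Poly_Mapping.keys p \<subseteq> carrier A \<times> carrier R" "Poly_Mapping.keys q \<subseteq> carrier A \<times> carrier R"
      "cl p \<in> generate AR ?T" "cl q \<in> generate AR ?T"
    then have "cl (p - q) = cl p \<otimes>\<^bsub>AR\<^esub> inv\<^bsub>AR\<^esub> cl q"
      using cl.hom_mult[of p "- q"] cl.hom_inv[of q] by simp
    then show "cl (p - q) \<in> generate AR ?T" using K.m_closed[OF pq(3) K.m_inv_closed[OF pq(4)]] by (simp only:)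
  next
    show "cl (frag_of z) \<in> generate AR ?T" if z: "z \<in> carrier A \<times> carrier R" for z
    proof -
      obtain x r where "z = (x, r)" "x \<in> carrier A" "r \<in> carrier R" using z by blast
      moreover from this have "cl (frag_of z) = pure_tensor A R x r" by (simp only: pure_tensor_def)
      ultimately show ?thesis by (intro generate.incl) blast
    qed
  qed
  then show "carrier AR \<subseteq> generate AR ?T"
    by (auto simp: tensor_def carrier_FactGroup)
qed

text \<open>
  The hypotheses say that \<open>k\<close> kills the two families of generators of the relations.
\<close>

lemma Rel_in_kernel:
  assumes "comm_group D" "k \<in> hom F D"
    and "\<And>x y r. \<lbrakk>x \<in> carrier A; y \<in> carrier A; r \<in> carrier R\<rbrakk> \<Longrightarrow>
      k (frag_of (x \<otimes>\<^bsub>A\<^esub> y, r)) = k (frag_of (x, r)) \<otimes>\<^bsub>D\<^esub> k (frag_of (y, r))"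
    and "\<And>x r r'. \<lbrakk>x \<in> carrier A; r \<in> carrier R; r' \<in> carrier R\<rbrakk> \<Longrightarrow>
      k (frag_of (x, r \<oplus>\<^bsub>R\<^esub> r')) = k (frag_of (x, r)) \<otimes>\<^bsub>D\<^esub> k (frag_of (x, r'))"
  shows "Rel \<subseteq> kernel F D k"
proof -
  interpret D: comm_group D by fact
  interpret k: group_hom F D k
    by (intro group_hom.intro group_hom_axioms.intro F.is_group D.is_group assms(2))
  have *: "p - q - q' \<in> kernel F D k"
    if "p \<in> carrier F" "q \<in> carrier F" "q' \<in> carrier F" "k p = k q \<otimes>\<^bsub>D\<^esub> k q'" for p q q'
  proof -
    have "p - q - q' \<in> carrier F" using that by (intro minus_in_F)
    moreover have "k ((p - q - q') \<otimes>\<^bsub>F\<^esub> (q \<otimes>\<^bsub>F\<^esub> q')) = k q \<otimes>\<^bsub>D\<^esub> k q'"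
      using that(4) by simp
    ultimately have "k (p - q - q') \<otimes>\<^bsub>D\<^esub> (k q \<otimes>\<^bsub>D\<^esub> k q') = k q \<otimes>\<^bsub>D\<^esub> k q'"
      using that by (metis k.hom_mult F.m_closed)
    then show ?thesis
      using that \<open>p - q - q' \<in> carrier F\<close> D.l_cancel_one by (simp add: kernel_def del: carrier_free_Abelian_group_iff)
  qed
  show ?thesis
    unfolding tensor_relations_def
    by (rule F.generate_subgroup_incl[OF _ k.subgroup_kernel]) (auto intro!: * simp: assms(3,4))
qed

lemma tensor_lift:
  assumes D: "comm_group D"
    and left: "\<And>r. r \<in> carrier R \<Longrightarrow> (\<lambda>x. \<beta> x r) \<in> hom A D"
    and right: "\<And>x. x \<in> carrier A \<Longrightarrow> \<beta> x \<in> hom (add_monoid R) D"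
  obtains k where "k \<in> hom AR D"
    "\<And>x r. x \<in> carrier A \<Longrightarrow> r \<in> carrier R \<Longrightarrow> k (pure_tensor A R x r) = \<beta> x r"
proof -
  interpret D: comm_group D by fact
  have cl: "\<beta> x r \<in> carrier D" if "x \<in> carrier A" "r \<in> carrier R" for x r
    using hom_in_carrier[OF left] that by blast
  obtain h where h: "h \<in> hom F D" "\<And>z. z \<in> carrier A \<times> carrier R \<Longrightarrow> h (frag_of z) = case_prod \<beta> z"
    by (rule D.free_Abelian_group_universal[of "case_prod \<beta>" "carrier A \<times> carrier R"]) (use cl in auto)
  interpret h: group_hom F D h
    by (intro group_hom.intro group_hom_axioms.intro F.is_group D.is_group h)
  have "Rel \<subseteq> kernel F D h"
    by (rule Rel_in_kernel[OF D h(1)])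
      (use h(2) hom_mult[OF left] hom_mult[OF right] in auto)
  then obtain k where "k \<in> hom (F Mod Rel) D" "\<And>p. p \<in> carrier F \<Longrightarrow> k (cl p) = h p"
    using h.FactGroup_universal_kernel[OF Rel.normal_axioms] by blast
  then show thesis using that[of k] h(2) by (simp add: tensor_def pure_tensor_def)
qed

end

lemma (in cring) tensor_smult_hom:
  assumes "comm_group A" and r: "r \<in> carrier R"
  shows tensor_smult_in_hom: "tensor_smult A R r \<in> hom (tensor A R) (tensor A R)"
    and tensor_smult_pure: "\<And>x r'. x \<in> carrier A \<Longrightarrow> r' \<in> carrier R \<Longrightarrow>
      tensor_smult A R r (pure_tensor A R x r') = pure_tensor A R x (r \<otimes> r')"
proof -
  interpret A: comm_group A by fact
  interpret tensor_factors A R by (intro tensor_factors.intro assms abelian_group_axioms)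
  let ?m = "frag_extend (\<lambda>(x, r'). frag_of (x, r \<otimes> r'))"
  have m_closed: "?m p \<in> carrier F" if "p \<in> carrier F" for p
  proof -
    have "Poly_Mapping.keys (case z of (x, r') \<Rightarrow> frag_of (x, r \<otimes> r')) \<subseteq> carrier A \<times> carrier R"
      if "z \<in> Poly_Mapping.keys p" for z
      using \<open>p \<in> carrier F\<close> that r by (cases z) auto
    then show ?thesis
      unfolding carrier_free_Abelian_group_iff by (intro order.trans[OF keys_frag_extend] UN_least)
  qed
  then have "?m \<in> hom F F" by (auto simp: hom_def frag_extend_add)
  then have h: "(\<lambda>p. cl (?m p)) \<in> hom F AR"
    using hom_compose[OF _ cl_hom] by (simp add: comp_def)
  interpret h: group_hom F AR "\<lambda>p. cl (?m p)"
    by (intro group_hom.intro group_hom_axioms.intro F.is_group AR.is_group h)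
  have "Rel \<subseteq> kernel F AR (\<lambda>p. cl (?m p))"
  proof (rule Rel_in_kernel[OF comm_group_tensor h])
    show "cl (?m (frag_of (x \<otimes>\<^bsub>A\<^esub> y, r'))) = cl (?m (frag_of (x, r'))) \<otimes>\<^bsub>AR\<^esub> cl (?m (frag_of (y, r')))"
      if "x \<in> carrier A" "y \<in> carrier A" "r' \<in> carrier R" for x y r'
      using hom_mult[OF pure_tensor_hom_left, of "r \<otimes> r'" x y] that r by (simp add: pure_tensor_def)
    show "cl (?m (frag_of (x, r' \<oplus> r''))) = cl (?m (frag_of (x, r'))) \<otimes>\<^bsub>AR\<^esub> cl (?m (frag_of (x, r'')))"
      if "x \<in> carrier A" "r' \<in> carrier R" "r'' \<in> carrier R" for x r' r''
      using hom_mult[OF pure_tensor_hom_right, of x "r \<otimes> r'" "r \<otimes> r''"] that r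
      by (simp add: pure_tensor_def r_distr)
  qed
  then obtain k where k: "k \<in> hom AR AR" "\<And>p. p \<in> carrier F \<Longrightarrow> k (cl p) = cl (?m p)"
    using h.FactGroup_universal_kernel[OF Rel.normal_axioms] by (auto simp: tensor_def)
  \<comment> \<open>All members of a coset are sent to one coset, so the union in the definition has one term.\<close>
  have smult_eq: "tensor_smult A R r c = k c" if c: "c \<in> carrier AR" for c
  proof -
    obtain p where p: "p \<in> carrier F" "c = cl p"
      using c unfolding tensor_def carrier_FactGroup by blast
    have "cl (?m q) = k c" if "q \<in> c" for q
    proof -
      have "q \<in> carrier F" using F.r_coset_subset_G[OF Rel.subset p(1)] that p by blast
      moreover have "cl q = c" using F.repr_independence[OF _ p(1) subgroup_Rel] that p by metis
      ultimately show ?thesis using k(2) by metis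
    qed
    moreover have "p \<in> c" using F.rcos_self[OF p(1) subgroup_Rel] p by simp
    ultimately show ?thesis unfolding tensor_smult_def by blast
  qed
  show "tensor_smult A R r \<in> hom AR AR"
    using k(1) AR.m_closed by (auto simp: hom_def smult_eq Pi_iff)
  show "tensor_smult A R r (pure_tensor A R x r') = pure_tensor A R x (r \<otimes> r')"
    if "x \<in> carrier A" "r' \<in> carrier R" for x r'
    using smult_eq[OF pure_tensor_closed[OF that]] k(2)[OF pair_in_F[OF that]] by (simp add: pure_tensor_def)
qed

section \<open>Commutators\<close>

context group
begin

abbreviation comm :: "'a \<Rightarrow> 'a \<Rightarrow> 'a" where
  "comm x y \<equiv> commutator G x y"

lemma comm_closed [simp]: "x \<in> carrier G \<Longrightarrow> y \<in> carrier G \<Longrightarrow> comm x y \<in> carrier G"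
  by (simp add: commutator_def)

lemma inv_mult_cancel [simp]: "x \<in> carrier G \<Longrightarrow> y \<in> carrier G \<Longrightarrow> inv x \<otimes> (x \<otimes> y) = y"
  by (simp add: m_assoc[symmetric])

lemma mult_inv_cancel [simp]: "x \<in> carrier G \<Longrightarrow> y \<in> carrier G \<Longrightarrow> x \<otimes> (inv x \<otimes> y) = y"
  by (simp add: m_assoc[symmetric])

lemma conj_eq_mult_comm:
  "x \<in> carrier G \<Longrightarrow> y \<in> carrier G \<Longrightarrow> inv y \<otimes> x \<otimes> y = x \<otimes> comm x y"
  by (simp add: commutator_def m_assoc)

lemma inv_comm: "x \<in> carrier G \<Longrightarrow> y \<in> carrier G \<Longrightarrow> inv (comm x y) = comm y x"
  by (simp add: commutator_def m_assoc inv_mult_group)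

lemma comm_self: "x \<in> carrier G \<Longrightarrow> comm x x = \<one>"
  by (simp add: commutator_def m_assoc)

lemma comm_mult_left:
  assumes "x \<in> carrier G" "y \<in> carrier G" "z \<in> carrier G"
  shows "comm (x \<otimes> y) z = comm x z \<otimes> comm (comm x z) y \<otimes> comm y z"
  using assms by (simp add: commutator_def m_assoc inv_mult_group)

lemma comm_mult_right:
  assumes "x \<in> carrier G" "y \<in> carrier G" "z \<in> carrier G"
  shows "comm x (y \<otimes> z) = comm x z \<otimes> comm x y \<otimes> comm (comm x y) z"
  using assms by (simp add: commutator_def m_assoc inv_mult_group)

lemma comm_inv_right:
  "x \<in> carrier G \<Longrightarrow> y \<in> carrier G \<Longrightarrow> comm x y \<otimes> comm x (inv y) \<otimes> comm (comm x (inv y)) y = \<one>"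
  by (simp add: commutator_def m_assoc inv_mult_group)

lemma comm_inv_left:
  "x \<in> carrier G \<Longrightarrow> y \<in> carrier G \<Longrightarrow> comm x y \<otimes> comm (comm x y) (inv x) \<otimes> comm (inv x) y = \<one>"
  by (simp add: commutator_def m_assoc inv_mult_group)

text \<open>
  The Hall--Witt identity for the convention \<open>[x, y] = x\<^sup>-\<^sup>1 y\<^sup>-\<^sup>1 x y\<close>: written out, all factors cancel.
\<close>

lemma hall_witt:
  assumes "x \<in> carrier G" "y \<in> carrier G" "z \<in> carrier G"
  shows "(inv y \<otimes> comm (comm x (inv y)) z \<otimes> y) \<otimes> (inv z \<otimes> comm (comm y (inv z)) x \<otimes> z)
    \<otimes> (inv x \<otimes> comm (comm z (inv x)) y \<otimes> x) = \<one>"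
  using assms by (simp add: commutator_def m_assoc inv_mult_group)

end

text \<open>
  The setting shared by the quotients of a filter and of a layering. The last condition contains the
  normality of \<open>K\<close> in \<open>H\<close> as well as the commutativity of the quotient.
\<close>

locale abelian_section = group G for G (structure) +
  fixes H K
  assumes subgroup_top: "subgroup H G" and subgroup_bottom: "subgroup K G"
    and bottom_subset: "K \<subseteq> H"
    and comm_in_bottom: "x \<in> H \<Longrightarrow> y \<in> H \<Longrightarrow> comm x y \<in> K"
begin

abbreviation "Sec \<equiv> G\<lparr>carrier := H\<rparr> Mod K"

sublocale top: subgroup H G by (rule subgroup_top)
sublocale bottom: subgroup K G by (rule subgroup_bottom)

lemma group_top: "group (G\<lparr>carrier := H\<rparr>)"
  by (rule subgroup_imp_group[OF subgroup_top])

lemma normal_bottom: "K \<lhd> G\<lparr>carrier := H\<rparr>"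
proof -
  interpret top_group: group "G\<lparr>carrier := H\<rparr>" by (rule group_top)
  have "x \<otimes> k \<otimes> inv x \<in> K" if "x \<in> H" "k \<in> K" for x k
  proof -
    have "k \<otimes> comm k (inv x) \<in> K"
      using that bottom_subset comm_in_bottom by (intro bottom.m_closed) auto
    also have "k \<otimes> comm k (inv x) = x \<otimes> k \<otimes> inv x"
      using that conj_eq_mult_comm[of k "inv x"] by (simp add: top.mem_carrier bottom.mem_carrier)
    finally show ?thesis .
  qed
  then show ?thesis
    using subgroup_incl[OF subgroup_bottom subgroup_top bottom_subset]
    by (simp add: top_group.normal_inv_iff m_inv_consistent[OF subgroup_top])
qed

lemma cls_hom: "(\<lambda>x. K #> x) \<in> hom (G\<lparr>carrier := H\<rparr>) Sec"
  using normal.r_coset_hom_Mod[OF normal_bottom] by (simp add: r_coset_def)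

lemma carrier_Sec: "carrier Sec = (\<lambda>x. K #> x) ` H"
  by (simp add: carrier_FactGroup r_coset_def)

lemma cls_closed: "x \<in> H \<Longrightarrow> K #> x \<in> carrier Sec"
  by (simp add: carrier_Sec)

lemma cls_mult: "x \<in> H \<Longrightarrow> y \<in> H \<Longrightarrow> K #> (x \<otimes> y) = (K #> x) \<otimes>\<^bsub>Sec\<^esub> (K #> y)"
  using hom_mult[OF cls_hom] by simp

lemma cls_trivial: "x \<in> K \<Longrightarrow> K #> x = \<one>\<^bsub>Sec\<^esub>"
  using bottom.rcos_const[OF is_group] by simp

lemma comm_group_Sec: "comm_group Sec"
proof (rule group.group_comm_groupI[OF normal.factorgroup_is_group[OF normal_bottom]])
  fix c d assume "c \<in> carrier Sec" "d \<in> carrier Sec"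
  then obtain x y where xy: "x \<in> H" "c = K #> x" "y \<in> H" "d = K #> y" by (auto simp: carrier_Sec)
  have "x \<otimes> y = y \<otimes> x \<otimes> comm x y"
    using xy by (simp add: commutator_def m_assoc top.mem_carrier)
  also have "K #> \<dots> = (K #> (y \<otimes> x)) \<otimes>\<^bsub>Sec\<^esub> (K #> comm x y)"
    using xy comm_in_bottom[of x y] bottom_subset by (intro cls_mult) auto
  also have "\<dots> = K #> (y \<otimes> x)"
    using xy comm_in_bottom[of x y] cls_closed[of "y \<otimes> x"] cls_trivial[of "comm x y"]
      group.is_monoid[OF normal.factorgroup_is_group[OF normal_bottom]]
    by (simp add: monoid.r_one del: mult_FactGroup one_FactGroup)
  finally show "c \<otimes>\<^bsub>Sec\<^esub> d = d \<otimes>\<^bsub>Sec\<^esub> c"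
    using xy by (simp add: cls_mult del: mult_FactGroup)
qed

sublocale Sec: comm_group Sec
  by (rule comm_group_Sec)

lemma cls_inv: "x \<in> H \<Longrightarrow> K #> inv x = inv\<^bsub>Sec\<^esub> (K #> x)"
proof -
  assume x: "x \<in> H"
  interpret cls: group_hom "G\<lparr>carrier := H\<rparr>" Sec "\<lambda>x. K #> x"
    by (intro group_hom.intro group_hom_axioms.intro group_top Sec.is_group cls_hom)
  show ?thesis using cls.hom_inv[of x] x m_inv_consistent[OF subgroup_top] by simp
qed

lemma quot_lift:
  assumes "group D" "h \<in> hom (G\<lparr>carrier := H\<rparr>) D" "\<And>x. x \<in> K \<Longrightarrow> h x = \<one>\<^bsub>D\<^esub>"
  obtains g where "g \<in> hom Sec D" "\<And>x. x \<in> H \<Longrightarrow> g (K #> x) = h x"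
proof -
  interpret h: group_hom "G\<lparr>carrier := H\<rparr>" D h
    by (intro group_hom.intro group_hom_axioms.intro group_top assms)
  have "K \<subseteq> kernel (G\<lparr>carrier := H\<rparr>) D h"
    using bottom_subset assms(3) by (auto simp: kernel_def)
  then obtain g where "g \<in> hom Sec D" "\<And>x. x \<in> H \<Longrightarrow> g (K #>\<^bsub>G\<lparr>carrier := H\<rparr>\<^esub> x) = h x"
    using h.FactGroup_universal_kernel[OF normal_bottom] by auto
  then show thesis using that[of g] by (simp add: r_coset_def)
qed

text \<open>
  The elements \<open>x\<close>, \<open>x'\<close>, \<open>y\<close> may lie outside the section; only their commutators are in it. This
  is what makes the bracket of two different sections land biadditively in a third one.
\<close>

lemma cls_comm_mult_left:
  assumes "x \<in> carrier G" "x' \<in> carrier G" "y \<in> carrier G"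
    and "comm x y \<in> H" "comm x' y \<in> H" "comm (comm x y) x' \<in> K"
  shows "K #> comm (x \<otimes> x') y = (K #> comm x y) \<otimes>\<^bsub>Sec\<^esub> (K #> comm x' y)"
  using assms bottom_subset
  by (simp add: comm_mult_left cls_mult cls_trivial cls_closed subsetD[OF bottom_subset] del: mult_FactGroup one_FactGroup)

lemma cls_comm_mult_right:
  assumes "x \<in> carrier G" "y \<in> carrier G" "y' \<in> carrier G"
    and "comm x y \<in> H" "comm x y' \<in> H" "comm (comm x y) y' \<in> K"
  shows "K #> comm x (y \<otimes> y') = (K #> comm x y) \<otimes>\<^bsub>Sec\<^esub> (K #> comm x y')"
  using assms bottom_subset Sec.m_comm[of "K #> comm x y" "K #> comm x y'"]
  by (simp add: comm_mult_right cls_mult cls_trivial cls_closed subsetD[OF bottom_subset] del: mult_FactGroup one_FactGroup)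

lemma cls_conj:
  assumes "x \<in> H" "y \<in> carrier G" "comm x y \<in> K"
  shows "inv y \<otimes> x \<otimes> y \<in> H" "K #> (inv y \<otimes> x \<otimes> y) = K #> x"
  using assms
  by (simp_all add: conj_eq_mult_comm top.mem_carrier cls_mult cls_trivial cls_closed
      subsetD[OF bottom_subset] del: mult_FactGroup one_FactGroup)

text \<open>
  If the three conjugations in the Hall--Witt identity act trivially on the section, the
  identity becomes an additive relation between triple commutators.
\<close>

lemma cls_hall_witt:
  assumes "x \<in> carrier G" "y \<in> carrier G" "z \<in> carrier G"
    and a: "comm (comm x (inv y)) z \<in> H" "comm (comm (comm x (inv y)) z) y \<in> K"
    and b: "comm (comm y (inv z)) x \<in> H" "comm (comm (comm y (inv z)) x) z \<in> K"
    and c: "comm (comm z (inv x)) y \<in> H" "comm (comm (comm z (inv x)) y) x \<in> K"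
  shows "(K #> comm (comm x (inv y)) z) \<otimes>\<^bsub>Sec\<^esub> (K #> comm (comm y (inv z)) x)
    \<otimes>\<^bsub>Sec\<^esub> (K #> comm (comm z (inv x)) y) = \<one>\<^bsub>Sec\<^esub>"
proof -
  have "K #> \<one> = K #> ((inv y \<otimes> comm (comm x (inv y)) z \<otimes> y)
    \<otimes> (inv z \<otimes> comm (comm y (inv z)) x \<otimes> z) \<otimes> (inv x \<otimes> comm (comm z (inv x)) y \<otimes> x))"
    using hall_witt assms by simp
  also have "\<dots> = (K #> (inv y \<otimes> comm (comm x (inv y)) z \<otimes> y)) \<otimes>\<^bsub>Sec\<^esub>
    (K #> (inv z \<otimes> comm (comm y (inv z)) x \<otimes> z)) \<otimes>\<^bsub>Sec\<^esub>
    (K #> (inv x \<otimes> comm (comm z (inv x)) y \<otimes> x))"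
    using cls_conj(1)[OF a(1) assms(2) a(2)] cls_conj(1)[OF b(1) assms(3) b(2)]
      cls_conj(1)[OF c(1) assms(1) c(2)]
    by (simp add: cls_mult del: mult_FactGroup)
  finally show ?thesis
    using cls_conj(2)[OF a(1) assms(2) a(2)] cls_conj(2)[OF b(1) assms(3) b(2)]
      cls_conj(2)[OF c(1) assms(1) c(2)] cls_trivial[OF bottom.one_closed] by simp
qed

end

section \<open>The sections of a filter\<close>

locale filtered_group = preordered_comm_monoid prec + group G
  for prec :: "'m::comm_monoid_add \<Rightarrow> 'm \<Rightarrow> bool" and G :: "('g, 'x) monoid_scheme" (structure) +
  fixes \<phi> :: "'m \<Rightarrow> 'g set"
  assumes filter: "group_filter G prec \<phi>"
begin

lemma prec_add: "prec s (s + t)"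
  using add_mono[OF reflpD[OF reflp] zero_le, of s t] by simp

lemma subgroup_filter: "subgroup (\<phi> s) G"
  using filter by (simp add: group_filter_def)

sublocale fil: subgroup "\<phi> s" G for s
  by (rule subgroup_filter)

lemma comm_in_filter: "x \<in> \<phi> s \<Longrightarrow> y \<in> \<phi> t \<Longrightarrow> comm x y \<in> \<phi> (s + t)"
proof -
  assume "x \<in> \<phi> s" "y \<in> \<phi> t"
  then have "comm x y \<in> commutator_subgroup G (\<phi> s) (\<phi> t)"
    unfolding commutator_subgroup_def by (intro generate.incl) blast
  then show ?thesis using filter by (auto simp: group_filter_def)
qed

lemma filter_antimono: "prec s t \<Longrightarrow> \<phi> t \<subseteq> \<phi> s"
  using filter by (simp add: group_filter_def)

lemma filter_add_subset: "\<phi> (s + t) \<subseteq> \<phi> s" "\<phi> (s + t) \<subseteq> \<phi> t"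
  using filter_antimono[OF prec_add] by (simp, metis add.commute filter_antimono prec_add)

abbreviation "bd \<equiv> filter_boundary G \<phi>"

lemma subgroup_boundary: "subgroup (bd s) G"
  unfolding filter_boundary_def
  by (rule generate_is_subgroup) (auto simp: fil.mem_carrier)

sublocale boundary: subgroup "bd s" G for s
  by (rule subgroup_boundary)

lemma in_boundary: "t \<noteq> 0 \<Longrightarrow> x \<in> \<phi> (s + t) \<Longrightarrow> x \<in> bd s"
  unfolding filter_boundary_def by (intro generate.incl) blast

lemma boundary_subset: "bd s \<subseteq> \<phi> s"
  unfolding filter_boundary_def
  by (rule generate_subgroup_incl[OF _ subgroup_filter]) (use filter_add_subset in blast)

text \<open>
  The boundary is only generated by the terms \<open>\<phi> (s + u)\<close>, so a statement about \<open>[z, y]\<close> has to be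
  propagated to products. By \<open>[x z, y] = [x, y] [[x, y], z] [z, y]\<close> it suffices that \<open>J\<close> also absorbs
  the triple commutators.
\<close>

lemma comm_boundary_in_subgroup:
  assumes J: "subgroup J G" and y: "y \<in> carrier G"
    and base: "\<And>u x. u \<noteq> 0 \<Longrightarrow> x \<in> \<phi> (s + u) \<Longrightarrow> comm x y \<in> J"
    and step: "\<And>x z. x \<in> bd s \<Longrightarrow> z \<in> bd s \<Longrightarrow> comm x y \<in> J \<Longrightarrow> comm (comm x y) z \<in> J"
    and z: "z \<in> bd s"
  shows "comm z y \<in> J"
proof -
  interpret J: subgroup J G by (rule J)
  show ?thesis
    using z unfolding filter_boundary_def
  proof (induction z rule: generate.induct)
    case one
    then show ?case using y by (simp add: commutator_def J.one_closed)
  next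
    case (incl h)
    then show ?case using base by blast
  next
    case (inv h)
    then show ?case using base fil.m_inv_closed by blast
  next
    case (eng h1 h2)
    then have h: "h1 \<in> bd s" "h2 \<in> bd s" by (simp_all add: filter_boundary_def)
    then show ?case
      using eng.IH y step[OF h] by (simp add: comm_mult_left boundary.mem_carrier J.m_closed)
  qed
qed

text \<open>
  The preceding lemma is used twice: the inner use shows that the boundary of degree \<open>s + t\<close> is
  normalised by \<open>\<phi> 0\<close>, which is the absorption hypothesis of the outer one.
\<close>

lemma comm_boundary:
  assumes "z \<in> bd s" "y \<in> \<phi> t"
  shows "comm z y \<in> bd (s + t)"
proof (rule comm_boundary_in_subgroup[OF subgroup_boundary _ _ _ assms(1)])
  show "y \<in> carrier G" using assms(2) by (rule fil.mem_carrier)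
next
  fix u x assume "u \<noteq> 0" "x \<in> \<phi> (s + u)"
  then show "comm x y \<in> bd (s + t)"
    using comm_in_filter[OF _ assms(2), of x "s + u"] in_boundary[of u _ "s + t"] by (simp add: ac_simps)
next
  fix x z assume x: "x \<in> bd s" and z: "z \<in> bd s" and xy: "comm x y \<in> bd (s + t)"
  have "z \<in> \<phi> 0" using z boundary_subset filter_add_subset(1)[of 0 s] by auto
  have "comm w z \<in> bd (s + t)" if "w \<in> bd (s + t)" for w
  proof (rule comm_boundary_in_subgroup[OF subgroup_boundary _ _ _ that])
    show "z \<in> carrier G" using z by (rule boundary.mem_carrier)
    fix u x assume "u \<noteq> 0" "x \<in> \<phi> (s + t + u)"
    then show "comm x z \<in> bd (s + t)"
      using comm_in_filter[OF _ \<open>z \<in> \<phi> 0\<close>, of x "s + t + u"] in_boundary by simp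
  next
    fix x z' assume "x \<in> bd (s + t)" "z' \<in> bd (s + t)" "comm x z \<in> bd (s + t)"
    then show "comm (comm x z) z' \<in> bd (s + t)"
      by (simp add: commutator_def boundary.m_closed boundary.m_inv_closed)
  qed
  then show "comm (comm x y) z \<in> bd (s + t)" using xy by blast
qed

text \<open>
  Here \<open>[\<phi> s, \<phi> s] \<subseteq> \<phi> (s + s)\<close> lies in the boundary because the second \<open>s\<close> is not \<open>0\<close>.
\<close>

lemma filter_section:
  assumes "s \<noteq> 0"
  shows "abelian_section G (\<phi> s) (bd s)"
proof (intro abelian_section.intro abelian_section_axioms.intro)
  show "comm x y \<in> bd s" if "x \<in> \<phi> s" "y \<in> \<phi> s" for x y
    using comm_in_filter[OF that] in_boundary[OF assms] by blast
qed (rule is_group subgroup_filter subgroup_boundary boundary_subset)+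

text \<open>
  If a nonzero degree \<open>s\<close> has an inverse \<open>t\<close>, then \<open>u = (u + s) + t\<close> is preceded by \<open>u + s\<close>, so
  \<open>\<phi> u \<subseteq> \<phi> (u + s)\<close>, which is one of the generating terms of the boundary.
\<close>

lemma filter_eq_boundary:
  fixes s t u :: 'm
  assumes "s + t = 0" "s \<noteq> 0"
  shows "\<phi> u = bd u"
proof
  have "prec (u + s) u" using prec_add[of "u + s" t] assms by (simp add: add.assoc)
  then show "\<phi> u \<subseteq> bd u" using filter_antimono in_boundary[OF assms(2)] by blast
qed (rule boundary_subset)

end

locale coefficient_filter = filtered_group prec G \<phi> + R: cring R
  for prec :: "'m::comm_monoid_add \<Rightarrow> 'm \<Rightarrow> bool" and G :: "('g, 'x) monoid_scheme" (structure)
    and R :: "('r, 'y) ring_scheme" and \<phi> :: "'m \<Rightarrow> 'g set"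
begin

abbreviation "L \<equiv> filter_sum G R \<phi>"
abbreviation "gen \<equiv> filter_elem G R \<phi>"

lemma filter_quotient_section:
  assumes "s \<noteq> 0"
  shows filter_quotient_comm_group: "comm_group (filter_quotient G \<phi> s)"
    and filter_tensor_factors: "tensor_factors (filter_quotient G \<phi> s) R"
proof -
  interpret abelian_section G "\<phi> s" "bd s" by (rule filter_section[OF assms])
  show "comm_group (filter_quotient G \<phi> s)" unfolding filter_quotient_def by (rule comm_group_Sec)
  then show "tensor_factors (filter_quotient G \<phi> s) R"
    by (intro tensor_factors.intro R.abelian_group_axioms)
qed

lemma comm_group_filter_component: "comm_group (filter_component G R \<phi> s)"
proof (cases "s = 0")
  case True
  have "comm_group (singleton_group {0 :: 'g set \<times> 'r \<Rightarrow>\<^sub>0 int})"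
    by (rule comm_groupI) (auto simp: singleton_group_def)
  then show ?thesis using True by (simp add: filter_component_def)
next
  case False
  interpret tensor_factors "filter_quotient G \<phi> s" R by (rule filter_tensor_factors[OF False])
  show ?thesis using False comm_group_tensor by (simp add: filter_component_def)
qed

sublocale Lsum: comm_group_family "filter_component G R \<phi>"
  by (intro comm_group_family.intro comm_group_filter_component)

lemma filter_component_zero: "carrier (filter_component G R \<phi> 0) = {\<one>\<^bsub>filter_component G R \<phi> 0\<^esub>}"
  by (simp add: filter_component_def singleton_group_def)

lemma gen_closed:
  assumes "s \<noteq> 0" "x \<in> \<phi> s" "r \<in> carrier R"
  shows "gen s x r \<in> homogeneous (filter_component G R \<phi>) s"
proof -
  interpret abelian_section G "\<phi> s" "bd s" by (rule filter_section[OF assms(1)])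
  interpret tensor_factors "filter_quotient G \<phi> s" R by (rule filter_tensor_factors[OF assms(1)])
  have "pure_tensor (filter_quotient G \<phi> s) R (bd s #> x) r \<in> carrier (filter_component G R \<phi> s)"
    using pure_tensor_closed[of "bd s #> x" r] cls_closed assms
    by (simp add: filter_quotient_def filter_component_def)
  then show ?thesis by (auto simp: filter_elem_def homogeneous_def)
qed

lemma gen_in_L: "s \<noteq> 0 \<Longrightarrow> x \<in> \<phi> s \<Longrightarrow> r \<in> carrier R \<Longrightarrow> gen s x r \<in> carrier L"
  using gen_closed Lsum.homogeneous_in_carrier by blast

lemma gen_hom_left:
  assumes "s \<noteq> 0" "r \<in> carrier R"
  shows "(\<lambda>x. gen s x r) \<in> hom (G\<lparr>carrier := \<phi> s\<rparr>) L"
proof -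
  interpret abelian_section G "\<phi> s" "bd s" by (rule filter_section[OF assms(1)])
  interpret tensor_factors "filter_quotient G \<phi> s" R by (rule filter_tensor_factors[OF assms(1)])
  have "(\<lambda>x. bd s #> x) \<in> hom (G\<lparr>carrier := \<phi> s\<rparr>) (filter_quotient G \<phi> s)"
    unfolding filter_quotient_def by (rule cls_hom)
  then have "(\<lambda>x. pure_tensor (filter_quotient G \<phi> s) R (bd s #> x) r) \<in>
      hom (G\<lparr>carrier := \<phi> s\<rparr>) (filter_component G R \<phi> s)"
    using Group.hom_compose[OF _ pure_tensor_hom_left[OF assms(2)]] assms(1) by (simp add: comp_def filter_component_def)
  then show ?thesis
    using Group.hom_compose[OF _ Lsum.sum_inj_hom] unfolding filter_elem_def by (simp add: comp_def)
qed

lemma gen_hom_right: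
  assumes "s \<noteq> 0" "x \<in> \<phi> s"
  shows "gen s x \<in> hom (add_monoid R) L"
proof -
  interpret abelian_section G "\<phi> s" "bd s" by (rule filter_section[OF assms(1)])
  interpret tensor_factors "filter_quotient G \<phi> s" R by (rule filter_tensor_factors[OF assms(1)])
  have "bd s #> x \<in> carrier (filter_quotient G \<phi> s)"
    using cls_closed assms unfolding filter_quotient_def by blast
  then have "pure_tensor (filter_quotient G \<phi> s) R (bd s #> x) \<in> hom (add_monoid R) (filter_component G R \<phi> s)"
    using pure_tensor_hom_right assms(1) by (simp add: filter_component_def)
  then show ?thesis
    using Group.hom_compose[OF _ Lsum.sum_inj_hom] unfolding filter_elem_def by (simp add: comp_def)
qed

lemma gen_mult_left:
  "s \<noteq> 0 \<Longrightarrow> x \<in> \<phi> s \<Longrightarrow> y \<in> \<phi> s \<Longrightarrow> r \<in> carrier R \<Longrightarrow> gen s (x \<otimes> y) r = gen s x r \<otimes>\<^bsub>L\<^esub> gen s y r"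
  using hom_mult[OF gen_hom_left] by simp

lemma gen_add_right:
  "s \<noteq> 0 \<Longrightarrow> x \<in> \<phi> s \<Longrightarrow> r \<in> carrier R \<Longrightarrow> r' \<in> carrier R \<Longrightarrow>
    gen s x (r \<oplus>\<^bsub>R\<^esub> r') = gen s x r \<otimes>\<^bsub>L\<^esub> gen s x r'"
  using hom_mult[OF gen_hom_right] by simp

lemma gen_cong:
  "bd s #> x = bd s #> y \<Longrightarrow> gen s x r = gen s y r"
  by (simp add: filter_elem_def)

lemma gen_boundary:
  assumes "s \<noteq> 0" "x \<in> bd s" "r \<in> carrier R"
  shows "gen s x r = \<one>\<^bsub>L\<^esub>"
proof -
  have "gen s x r = gen s \<one> r"
    using assms by (intro gen_cong) (simp add: boundary.rcos_const[OF is_group])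
  also have "\<dots> = \<one>\<^bsub>L\<^esub>"
    using hom_one[OF gen_hom_left[OF assms(1,3)]] subgroup_imp_group[OF subgroup_filter]
    by (simp del: one_sum_group)
  finally show ?thesis .
qed

lemma gen_inv:
  assumes "s \<noteq> 0" "x \<in> \<phi> s" "r \<in> carrier R"
  shows "gen s (inv x) r = inv\<^bsub>L\<^esub> gen s x r"
proof -
  interpret gen: group_hom "G\<lparr>carrier := \<phi> s\<rparr>" L "\<lambda>x. gen s x r"
    by (intro group_hom.intro group_hom_axioms.intro subgroup_imp_group[OF subgroup_filter]
        Lsum.S.is_group gen_hom_left assms)
  show ?thesis using gen.hom_inv[of x] assms m_inv_consistent[OF subgroup_filter] by simp
qed

definition "gens = {gen s x r | s x r. s \<noteq> 0 \<and> x \<in> \<phi> s \<and> r \<in> carrier R}"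

lemma gens_in_L: "gens \<subseteq> carrier L"
  using gen_in_L by (auto simp: gens_def)

text \<open>
  A homogeneous element of nonzero degree is a product of generators of the same degree, and one of
  degree \<open>0\<close> is trivial.
\<close>

lemma homogeneous_hom_in_subgroup:
  assumes "group D" "f \<in> hom L D" "subgroup K D"
    and gens: "\<And>x r. s \<noteq> 0 \<Longrightarrow> x \<in> \<phi> s \<Longrightarrow> r \<in> carrier R \<Longrightarrow> f (gen s x r) \<in> K"
    and "a \<in> homogeneous (filter_component G R \<phi>) s"
  shows "f a \<in> K"
proof -
  interpret f: group_hom L D f
    by (intro group_hom.intro group_hom_axioms.intro Lsum.S.is_group assms)
  obtain c where c: "c \<in> carrier (filter_component G R \<phi> s)" "a = sum_inj (filter_component G R \<phi>) s c"
    using assms(5) by (auto simp: homogeneous_def)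
  show ?thesis
  proof (cases "s = 0")
    case True
    then have "a = \<one>\<^bsub>L\<^esub>" using c filter_component_zero Lsum.inj.hom_one[of s] by (metis singletonD)
    then show ?thesis using f.hom_one subgroup.one_closed[OF assms(3)] by simp
  next
    case False
    interpret abelian_section G "\<phi> s" "bd s" by (rule filter_section[OF False])
    interpret tensor_factors "filter_quotient G \<phi> s" R by (rule filter_tensor_factors[OF False])
    have comp: "filter_component G R \<phi> s = tensor (filter_quotient G \<phi> s) R"
      using False by (simp add: filter_component_def)
    have "(\<lambda>c. f (sum_inj (filter_component G R \<phi>) s c)) \<in> hom (tensor (filter_quotient G \<phi> s) R) D"
      using Group.hom_compose[OF Lsum.sum_inj_hom[of s] assms(2)] unfolding comp by (simp add: comp_def)
    then have "f (sum_inj (filter_component G R \<phi>) s c) \<in> K"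
    proof (rule hom_generators_in_subgroup[OF AR.is_group assms(1) _ assms(3) tensor_generated])
      show "c \<in> carrier (tensor (filter_quotient G \<phi> s) R)" using c comp by simp
      fix t
      assume "t \<in> {pure_tensor (filter_quotient G \<phi> s) R x r |x r. x \<in> carrier (filter_quotient G \<phi> s) \<and> r \<in> carrier R}"
      then obtain x r where "x \<in> \<phi> s" "r \<in> carrier R" "t = pure_tensor (filter_quotient G \<phi> s) R (bd s #> x) r"
        unfolding filter_quotient_def carrier_Sec by blast
      then show "f (sum_inj (filter_component G R \<phi>) s t) \<in> K"
        using gens False by (simp add: filter_elem_def)
    qed
    then show ?thesis using c by simp
  qed
qed

lemma L_generated: "carrier L = generate L gens"
proof
  show "generate L gens \<subseteq> carrier L" by (rule Lsum.S.generate_incl[OF gens_in_L])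
  have K: "subgroup (generate L gens) L" by (rule Lsum.S.generate_is_subgroup[OF gens_in_L])
  have "(\<lambda>a. a) \<in> hom L L" by (simp add: hom_def)
  then have "a \<in> generate L gens" if "a \<in> homogeneous (filter_component G R \<phi>) s" for a s
    by (rule homogeneous_hom_in_subgroup[OF Lsum.S.is_group _ K _ that])
      (auto simp: gens_def intro!: generate.incl)
  then have "generate L {sum_inj (filter_component G R \<phi>) s c | s c. c \<in> carrier (filter_component G R \<phi> s)} \<subseteq> generate L gens"
    by (intro Lsum.S.generate_subgroup_incl K) (auto simp: homogeneous_def)
  then show "carrier L \<subseteq> generate L gens" using Lsum.S_generated by simp
qed

text \<open>
  The universal property of the graded group. By the hypotheses \<open>F s\<close> descends to the quotient by the
  boundary and is biadditive there, so it factors through the tensor product; the direct sum imposes no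
  relation between different degrees.
\<close>

lemma filter_sum_lift:
  assumes D: "comm_group D"
    and left: "\<And>s r. s \<noteq> 0 \<Longrightarrow> r \<in> carrier R \<Longrightarrow> (\<lambda>x. F s x r) \<in> hom (G\<lparr>carrier := \<phi> s\<rparr>) D"
    and boundary: "\<And>s x r. s \<noteq> 0 \<Longrightarrow> x \<in> bd s \<Longrightarrow> r \<in> carrier R \<Longrightarrow> F s x r = \<one>\<^bsub>D\<^esub>"
    and right: "\<And>s x. s \<noteq> 0 \<Longrightarrow> x \<in> \<phi> s \<Longrightarrow> F s x \<in> hom (add_monoid R) D"
  obtains k where "k \<in> hom L D"
    "\<And>s x r. s \<noteq> 0 \<Longrightarrow> x \<in> \<phi> s \<Longrightarrow> r \<in> carrier R \<Longrightarrow> k (gen s x r) = F s x r"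
proof -
  interpret D: comm_group D by fact
  have comp: "\<exists>h. h \<in> hom (filter_component G R \<phi> s) D \<and> (s \<noteq> 0 \<longrightarrow> (\<forall>x\<in>\<phi> s. \<forall>r\<in>carrier R.
    h (pure_tensor (filter_quotient G \<phi> s) R (bd s #> x) r) = F s x r))" for s
  proof (cases "s = 0")
    case True
    have "(\<lambda>_. \<one>\<^bsub>D\<^esub>) \<in> hom (filter_component G R \<phi> s) D" by (simp add: hom_def)
    then show ?thesis using True by blast
  next
    case False
    interpret abelian_section G "\<phi> s" "bd s" by (rule filter_section[OF False])
    interpret tensor_factors "filter_quotient G \<phi> s" R by (rule filter_tensor_factors[OF False])
    have "\<exists>g. r \<in> carrier R \<longrightarrow> g \<in> hom (filter_quotient G \<phi> s) D \<and> (\<forall>x\<in>\<phi> s. g (bd s #> x) = F s x r)" for r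
    proof (cases "r \<in> carrier R")
      case True
      then show ?thesis
        using quot_lift[OF D.is_group left[OF False True] boundary[OF False _ True]]
        unfolding filter_quotient_def by metis
    qed simp
    then obtain g where g: "\<And>r. r \<in> carrier R \<Longrightarrow> g r \<in> hom (filter_quotient G \<phi> s) D"
      "\<And>r x. r \<in> carrier R \<Longrightarrow> x \<in> \<phi> s \<Longrightarrow> g r (bd s #> x) = F s x r"
      by metis
    have "(\<lambda>r. g r c) \<in> hom (add_monoid R) D" if c: "c \<in> carrier (filter_quotient G \<phi> s)" for c
    proof -
      obtain x where x: "x \<in> \<phi> s" "c = bd s #> x"
        using c unfolding filter_quotient_def carrier_Sec by blast
      then show ?thesis
        using g(2) right[OF False x(1)] by (auto simp: hom_def Pi_iff)
    qed
    then obtain h where "h \<in> hom (tensor (filter_quotient G \<phi> s) R) D"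
      "\<And>c r. c \<in> carrier (filter_quotient G \<phi> s) \<Longrightarrow> r \<in> carrier R \<Longrightarrow>
        h (pure_tensor (filter_quotient G \<phi> s) R c r) = g r c"
      using tensor_lift[where \<beta> = "\<lambda>c r. g r c", OF D g(1)] by blast
    then show ?thesis
      using g(2) cls_closed False unfolding filter_quotient_def filter_component_def by auto
  qed
  then obtain h where h: "\<And>s. h s \<in> hom (filter_component G R \<phi> s) D"
    "\<And>s x r. s \<noteq> 0 \<Longrightarrow> x \<in> \<phi> s \<Longrightarrow> r \<in> carrier R \<Longrightarrow>
      h s (pure_tensor (filter_quotient G \<phi> s) R (bd s #> x) r) = F s x r"
    by metis
  obtain k where k: "k \<in> hom L D"
    "\<And>s c. c \<in> carrier (filter_component G R \<phi> s) \<Longrightarrow> k (sum_inj (filter_component G R \<phi>) s c) = h s c"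
    using Lsum.sum_lift[OF D h(1)] by blast
  have "k (gen s x r) = F s x r" if "s \<noteq> 0" "x \<in> \<phi> s" "r \<in> carrier R" for s x r
  proof -
    interpret abelian_section G "\<phi> s" "bd s" by (rule filter_section[OF that(1)])
    interpret tensor_factors "filter_quotient G \<phi> s" R by (rule filter_tensor_factors[OF that(1)])
    have "pure_tensor (filter_quotient G \<phi> s) R (bd s #> x) r \<in> carrier (filter_component G R \<phi> s)"
      using pure_tensor_closed[of "bd s #> x" r] cls_closed that
      by (simp add: filter_quotient_def filter_component_def)
    then show ?thesis using h(2)[OF that] k(2) by (simp add: filter_elem_def)
  qed
  then show thesis using that k(1) by blast
qed

lemma L_trivial:
  fixes s t :: 'm
  assumes "s + t = 0" "s \<noteq> 0"
  shows "carrier L = {\<one>\<^bsub>L\<^esub>}"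
proof -
  have "gens \<subseteq> {\<one>\<^bsub>L\<^esub>}"
    using gen_boundary filter_eq_boundary[OF assms] by (auto simp: gens_def simp del: one_sum_group)
  then have "generate L gens \<subseteq> {\<one>\<^bsub>L\<^esub>}"
    by (rule Lsum.S.generate_subgroup_incl[OF _ Lsum.S.triv_subgroup])
  then show ?thesis using L_generated Lsum.S.one_closed by blast
qed


text \<open>
  The universal property of the graded group applied to the group of homomorphisms from \<open>B\<close> to \<open>C\<close>.
  The relations have to be verified on generators of \<open>B\<close> only.
\<close>

lemma biadditive_lift:
  assumes B: "group B" "carrier B = generate B U" and C: "comm_group C"
    and N: "\<And>s x r. s \<noteq> 0 \<Longrightarrow> x \<in> \<phi> s \<Longrightarrow> r \<in> carrier R \<Longrightarrow> N s x r \<in> hom B C"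
    and mult: "\<And>s x x' r y. s \<noteq> 0 \<Longrightarrow> x \<in> \<phi> s \<Longrightarrow> x' \<in> \<phi> s \<Longrightarrow> r \<in> carrier R \<Longrightarrow> y \<in> U \<Longrightarrow>
      N s (x \<otimes> x') r y = N s x r y \<otimes>\<^bsub>C\<^esub> N s x' r y"
    and bdry: "\<And>s x r y. s \<noteq> 0 \<Longrightarrow> x \<in> bd s \<Longrightarrow> r \<in> carrier R \<Longrightarrow> y \<in> U \<Longrightarrow> N s x r y = \<one>\<^bsub>C\<^esub>"
    and add: "\<And>s x r r' y. s \<noteq> 0 \<Longrightarrow> x \<in> \<phi> s \<Longrightarrow> r \<in> carrier R \<Longrightarrow> r' \<in> carrier R \<Longrightarrow> y \<in> U \<Longrightarrow>
      N s x (r \<oplus>\<^bsub>R\<^esub> r') y = N s x r y \<otimes>\<^bsub>C\<^esub> N s x r' y"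
  shows "\<exists>\<beta>. biadditive L B C \<beta> \<and> case_prod \<beta> \<in> extensional (carrier L \<times> carrier B) \<and>
    (\<forall>s x r b. s \<noteq> 0 \<longrightarrow> x \<in> \<phi> s \<longrightarrow> r \<in> carrier R \<longrightarrow> b \<in> carrier B \<longrightarrow> \<beta> (gen s x r) b = N s x r b)"
proof -
  interpret B: group B by fact
  interpret C: comm_group C by fact
  interpret D: comm_group "hom_group B C" by (rule comm_group_hom_group[OF B(1) C])
  have U: "U \<subseteq> carrier B" using B(2) generate.incl by fast
  let ?N = "\<lambda>s x r. restrict (N s x r) (carrier B)"
  have N': "?N s x r \<in> carrier (hom_group B C)" if "s \<noteq> 0" "x \<in> \<phi> s" "r \<in> carrier R" for s x r
    using restrict_in_hom_group[OF B(1) N[OF that]] .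
  have eqI: "f = g" if "f \<in> carrier (hom_group B C)" "g \<in> carrier (hom_group B C)" "\<And>y. y \<in> U \<Longrightarrow> f y = g y" for f g
    using hom_group_eqI[OF B(1) C.is_group that(1,2) B(2)] that(3) by blast
  have mult_apply: "(f \<otimes>\<^bsub>hom_group B C\<^esub> g) y = f y \<otimes>\<^bsub>C\<^esub> g y" if "y \<in> U" for f g y
    using U that by (auto simp: hom_group_def)
  have one_apply: "\<one>\<^bsub>hom_group B C\<^esub> y = \<one>\<^bsub>C\<^esub>" if "y \<in> U" for y
    using U that by (auto simp: hom_group_def)
  have rest: "?N s x r y = N s x r y" if "y \<in> U" for s x r y
    using U that by auto
  obtain \<beta> where \<beta>: "\<beta> \<in> hom L (hom_group B C)"
    "\<And>s x r. s \<noteq> 0 \<Longrightarrow> x \<in> \<phi> s \<Longrightarrow> r \<in> carrier R \<Longrightarrow> \<beta> (gen s x r) = ?N s x r"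
  proof (rule filter_sum_lift[where F = ?N and D = "hom_group B C"])
    show "comm_group (hom_group B C)" by (rule comm_group_hom_group[OF B(1) C])
    show "(\<lambda>x. ?N s x r) \<in> hom (G\<lparr>carrier := \<phi> s\<rparr>) (hom_group B C)" if "s \<noteq> 0" "r \<in> carrier R" for s r
    proof (rule homI)
      fix x x' assume "x \<in> carrier (G\<lparr>carrier := \<phi> s\<rparr>)" "x' \<in> carrier (G\<lparr>carrier := \<phi> s\<rparr>)"
      then have x: "x \<in> \<phi> s" "x' \<in> \<phi> s" by auto
      then have "?N s (x \<otimes> x') r = ?N s x r \<otimes>\<^bsub>hom_group B C\<^esub> ?N s x' r"
        using that by (intro eqI D.m_closed N' fil.m_closed) (simp_all add: mult_apply rest mult del: restrict_apply)
      then show "?N s (x \<otimes>\<^bsub>G\<lparr>carrier := \<phi> s\<rparr>\<^esub> x') r = ?N s x r \<otimes>\<^bsub>hom_group B C\<^esub> ?N s x' r" by simp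
    qed (use that N' in auto)
    show "?N s x r = \<one>\<^bsub>hom_group B C\<^esub>" if "s \<noteq> 0" "x \<in> bd s" "r \<in> carrier R" for s x r
      using that boundary_subset[of s] by (intro eqI D.one_closed N') (auto simp: one_apply rest bdry simp del: restrict_apply)
    show "?N s x \<in> hom (add_monoid R) (hom_group B C)" if "s \<noteq> 0" "x \<in> \<phi> s" for s x
    proof (rule homI)
      fix r r' assume "r \<in> carrier (add_monoid R)" "r' \<in> carrier (add_monoid R)"
      then have r: "r \<in> carrier R" "r' \<in> carrier R" by auto
      then have "?N s x (r \<oplus>\<^bsub>R\<^esub> r') = ?N s x r \<otimes>\<^bsub>hom_group B C\<^esub> ?N s x r'"
        using that by (intro eqI D.m_closed N' R.a_closed) (simp_all add: mult_apply rest add del: restrict_apply)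
      then show "?N s x (r \<otimes>\<^bsub>add_monoid R\<^esub> r') = ?N s x r \<otimes>\<^bsub>hom_group B C\<^esub> ?N s x r'" by simp
    qed (use that N' in auto)
  qed blast
  let ?\<beta> = "\<lambda>a b. if a \<in> carrier L then \<beta> a b else undefined"
  have bi: "biadditive L B C \<beta>" by (rule biadditive_of_hom_to_hom_group[OF \<beta>(1)])
  show ?thesis
  proof (intro exI[of _ ?\<beta>] conjI)
    show "biadditive L B C ?\<beta>"
    proof (rule biadditiveI)
      show "?\<beta> a \<in> hom B C" if "a \<in> carrier L" for a using biadditive_hom_right[OF bi that] that by simp
      show "(\<lambda>a. ?\<beta> a b) \<in> hom L C" if "b \<in> carrier B" for b
        using biadditive_hom_left[OF bi that] Lsum.S.m_closed by (simp add: hom_def Pi_iff del: mult_sum_group)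
    qed
    show "case_prod ?\<beta> \<in> extensional (carrier L \<times> carrier B)"
      using hom_in_carrier[OF \<beta>(1)] by (auto simp: extensional_def hom_group_def)
  qed (use \<beta>(2) gen_in_L in auto)
qed

section \<open>The product of the graded Lie ring\<close>

text \<open>
  The triple commutators \<open>[[x, y], x']\<close> and \<open>[[x, y], y']\<close> have degrees \<open>s + t + s\<close> and \<open>s + t + t\<close>,
  hence lie in the boundary of degree \<open>s + t\<close>.
\<close>

lemma gen_comm_hom:
  assumes "s \<noteq> 0" "t \<noteq> 0" "s + t \<noteq> 0" "r \<in> carrier R"
  shows gen_comm_mult_left: "x \<in> \<phi> s \<Longrightarrow> x' \<in> \<phi> s \<Longrightarrow> y \<in> \<phi> t \<Longrightarrow>
      gen (s + t) (comm (x \<otimes> x') y) r = gen (s + t) (comm x y) r \<otimes>\<^bsub>L\<^esub> gen (s + t) (comm x' y) r"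
    and gen_comm_mult_right: "x \<in> \<phi> s \<Longrightarrow> y \<in> \<phi> t \<Longrightarrow> y' \<in> \<phi> t \<Longrightarrow>
      gen (s + t) (comm x (y \<otimes> y')) r = gen (s + t) (comm x y) r \<otimes>\<^bsub>L\<^esub> gen (s + t) (comm x y') r"
proof -
  interpret abelian_section G "\<phi> (s + t)" "bd (s + t)" by (rule filter_section[OF assms(3)])
  show "gen (s + t) (comm (x \<otimes> x') y) r = gen (s + t) (comm x y) r \<otimes>\<^bsub>L\<^esub> gen (s + t) (comm x' y) r"
    if x: "x \<in> \<phi> s" "x' \<in> \<phi> s" "y \<in> \<phi> t"
  proof -
    have c: "comm x y \<in> \<phi> (s + t)" "comm x' y \<in> \<phi> (s + t)" using comm_in_filter x by auto
    have "comm (comm x y) x' \<in> bd (s + t)"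
      using in_boundary[OF assms(1)] comm_in_filter[OF c(1) x(2)] by simp
    then have "bd (s + t) #> comm (x \<otimes> x') y = bd (s + t) #> (comm x y \<otimes> comm x' y)"
      using c x fil.mem_carrier by (simp add: cls_comm_mult_left cls_mult del: mult_FactGroup)
    then show ?thesis
      using gen_cong gen_mult_left[OF assms(3) c assms(4)] by metis
  qed
  show "gen (s + t) (comm x (y \<otimes> y')) r = gen (s + t) (comm x y) r \<otimes>\<^bsub>L\<^esub> gen (s + t) (comm x y') r"
    if x: "x \<in> \<phi> s" "y \<in> \<phi> t" "y' \<in> \<phi> t"
  proof -
    have c: "comm x y \<in> \<phi> (s + t)" "comm x y' \<in> \<phi> (s + t)" using comm_in_filter x by auto
    have "comm (comm x y) y' \<in> bd (s + t)"
      using in_boundary[OF assms(2)] comm_in_filter[OF c(1) x(3)] by simp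
    then have "bd (s + t) #> comm x (y \<otimes> y') = bd (s + t) #> (comm x y \<otimes> comm x y')"
      using c x fil.mem_carrier by (simp add: cls_comm_mult_right cls_mult del: mult_FactGroup)
    then show ?thesis
      using gen_cong gen_mult_left[OF assms(3) c assms(4)] by metis
  qed
qed

lemma gen_comm_boundary:
  assumes "s + t \<noteq> 0" "r \<in> carrier R"
  shows gen_comm_boundary_left: "x \<in> bd s \<Longrightarrow> y \<in> \<phi> t \<Longrightarrow> gen (s + t) (comm x y) r = \<one>\<^bsub>L\<^esub>"
    and gen_comm_boundary_right: "x \<in> \<phi> s \<Longrightarrow> y \<in> bd t \<Longrightarrow> gen (s + t) (comm x y) r = \<one>\<^bsub>L\<^esub>"
proof -
  show "gen (s + t) (comm x y) r = \<one>\<^bsub>L\<^esub>" if "x \<in> bd s" "y \<in> \<phi> t"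
    using gen_boundary[OF assms(1) comm_boundary[OF that] assms(2)] .
  show "gen (s + t) (comm x y) r = \<one>\<^bsub>L\<^esub>" if "x \<in> \<phi> s" "y \<in> bd t"
  proof -
    have "inv (comm y x) \<in> bd (s + t)"
      using boundary.m_inv_closed[OF comm_boundary[OF that(2,1)]] by (simp add: add.commute)
    then show ?thesis
      using that by (intro gen_boundary assms) (simp add: inv_comm fil.mem_carrier boundary.mem_carrier)
  qed
qed

text \<open>
  The prescribed products of generators. The case distinction reflects that the component of degree
  \<open>0\<close> is zero, although \<open>gen 0\<close> itself need not be.
\<close>

definition pairing where
  "pairing s x r t y r' = (if s + t = 0 then \<one>\<^bsub>L\<^esub> else gen (s + t) (comm x y) (r \<otimes>\<^bsub>R\<^esub> r'))"

lemma pairing_closed: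
  "x \<in> \<phi> s \<Longrightarrow> r \<in> carrier R \<Longrightarrow> y \<in> \<phi> t \<Longrightarrow> r' \<in> carrier R \<Longrightarrow> pairing s x r t y r' \<in> carrier L"
  unfolding pairing_def using gen_in_L comm_in_filter Lsum.S.one_closed by simp

lemma ex_product: "\<exists>b. is_filter_product G R \<phi> b"
proof -
  have one_one: "\<one>\<^bsub>L\<^esub> \<otimes>\<^bsub>L\<^esub> \<one>\<^bsub>L\<^esub> = \<one>\<^bsub>L\<^esub>" by (rule Lsum.S.l_one[OF Lsum.S.one_closed])
  have "\<exists>k. s \<noteq> 0 \<and> x \<in> \<phi> s \<and> r \<in> carrier R \<longrightarrow> k \<in> hom L L \<and>
    (\<forall>t y r'. t \<noteq> 0 \<and> y \<in> \<phi> t \<and> r' \<in> carrier R \<longrightarrow> k (gen t y r') = pairing s x r t y r')" for s x r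
  proof (cases "s \<noteq> 0 \<and> x \<in> \<phi> s \<and> r \<in> carrier R")
    case True
    then have s: "s \<noteq> 0" and x: "x \<in> \<phi> s" and r: "r \<in> carrier R" by auto
    show ?thesis
    proof (rule filter_sum_lift[where F = "pairing s x r" and D = L])
      show "comm_group L" by (rule Lsum.comm_group_S)
      show "(\<lambda>y. pairing s x r t y r') \<in> hom (G\<lparr>carrier := \<phi> t\<rparr>) L" if "t \<noteq> 0" "r' \<in> carrier R" for t r'
      proof (rule homI)
        show "pairing s x r t (y \<otimes>\<^bsub>G\<lparr>carrier := \<phi> t\<rparr>\<^esub> y') r' = pairing s x r t y r' \<otimes>\<^bsub>L\<^esub> pairing s x r t y' r'"
          if "y \<in> carrier (G\<lparr>carrier := \<phi> t\<rparr>)" "y' \<in> carrier (G\<lparr>carrier := \<phi> t\<rparr>)" for y y'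
          using s x r \<open>t \<noteq> 0\<close> \<open>r' \<in> carrier R\<close> that gen_comm_mult_right[of s t "r \<otimes>\<^bsub>R\<^esub> r'" x y y'] one_one
          by (simp add: pairing_def del: mult_sum_group one_sum_group)
      qed (use that x r pairing_closed in auto)
      show "pairing s x r t y r' = \<one>\<^bsub>L\<^esub>" if "t \<noteq> 0" "y \<in> bd t" "r' \<in> carrier R" for t y r'
        using gen_comm_boundary_right that x r by (simp add: pairing_def)
      show "pairing s x r t y \<in> hom (add_monoid R) L" if "t \<noteq> 0" "y \<in> \<phi> t" for t y
      proof (rule homI)
        show "pairing s x r t y (r' \<otimes>\<^bsub>add_monoid R\<^esub> r'') = pairing s x r t y r' \<otimes>\<^bsub>L\<^esub> pairing s x r t y r''"
          if "r' \<in> carrier (add_monoid R)" "r'' \<in> carrier (add_monoid R)" for r' r''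
          using x r \<open>y \<in> \<phi> t\<close> that comm_in_filter one_one
          by (simp add: pairing_def R.r_distr gen_add_right del: mult_sum_group one_sum_group)
      qed (use that x r pairing_closed in auto)
    qed blast
  qed blast
  then obtain N where N: "\<And>s x r. s \<noteq> 0 \<Longrightarrow> x \<in> \<phi> s \<Longrightarrow> r \<in> carrier R \<Longrightarrow> N s x r \<in> hom L L"
    "\<And>s x r t y r'. \<lbrakk>s \<noteq> 0; x \<in> \<phi> s; r \<in> carrier R; t \<noteq> 0; y \<in> \<phi> t; r' \<in> carrier R\<rbrakk> \<Longrightarrow>
      N s x r (gen t y r') = pairing s x r t y r'"
    by metis
  have mult: "N s (x \<otimes> x') r g = N s x r g \<otimes>\<^bsub>L\<^esub> N s x' r g"
    if *: "s \<noteq> 0" "x \<in> \<phi> s" "x' \<in> \<phi> s" "r \<in> carrier R" "g \<in> gens" for s x x' r g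
  proof -
    obtain t y r' where "t \<noteq> 0" "y \<in> \<phi> t" "r' \<in> carrier R" "g = gen t y r'" using * by (auto simp: gens_def)
    then show ?thesis
      using * gen_comm_mult_left[of s t "r \<otimes>\<^bsub>R\<^esub> r'" x x' y] one_one
      by (simp add: N(2) pairing_def fil.m_closed del: mult_sum_group one_sum_group)
  qed
  have bdry: "N s x r g = \<one>\<^bsub>L\<^esub>"
    if *: "s \<noteq> 0" "x \<in> bd s" "r \<in> carrier R" "g \<in> gens" for s x r g
  proof -
    obtain t y r' where "t \<noteq> 0" "y \<in> \<phi> t" "r' \<in> carrier R" "g = gen t y r'" using * by (auto simp: gens_def)
    then show ?thesis
      using * gen_comm_boundary_left boundary_subset[of s]
      by (simp add: N(2) pairing_def subset_iff del: one_sum_group)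
  qed
  have add: "N s x (r \<oplus>\<^bsub>R\<^esub> r') g = N s x r g \<otimes>\<^bsub>L\<^esub> N s x r' g"
    if *: "s \<noteq> 0" "x \<in> \<phi> s" "r \<in> carrier R" "r' \<in> carrier R" "g \<in> gens" for s x r r' g
  proof -
    obtain t y q where "t \<noteq> 0" "y \<in> \<phi> t" "q \<in> carrier R" "g = gen t y q" using * by (auto simp: gens_def)
    then show ?thesis
      using * one_one comm_in_filter
      by (simp add: N(2) pairing_def R.l_distr gen_add_right del: mult_sum_group one_sum_group)
  qed
  have "\<exists>b. biadditive L L L b \<and> case_prod b \<in> extensional (carrier L \<times> carrier L) \<and>
    (\<forall>s x r a. s \<noteq> 0 \<longrightarrow> x \<in> \<phi> s \<longrightarrow> r \<in> carrier R \<longrightarrow> a \<in> carrier L \<longrightarrow> b (gen s x r) a = N s x r a)"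
    by (rule biadditive_lift[OF Lsum.S.is_group L_generated Lsum.comm_group_S]) (fact N(1) mult bdry add)+
  then obtain b where b: "biadditive L L L b" "case_prod b \<in> extensional (carrier L \<times> carrier L)"
    "\<forall>s x r a. s \<noteq> 0 \<longrightarrow> x \<in> \<phi> s \<longrightarrow> r \<in> carrier R \<longrightarrow> a \<in> carrier L \<longrightarrow> b (gen s x r) a = N s x r a"
    by (elim exE conjE)
  have "is_filter_product G R \<phi> b"
    unfolding is_filter_product_def
    using b gen_in_L N(2) by (simp add: pairing_def del: one_sum_group)
  then show ?thesis by blast
qed

lemma unique_product:
  assumes "is_filter_product G R \<phi> b" "is_filter_product G R \<phi> b'"
  shows "b = b'"
proof (rule extensional_biadditive_eqI[OF Lsum.S.is_group Lsum.S.is_group Lsum.S.is_group _ _ _ _ L_generated L_generated])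
  show "b x y = b' x y" if "x \<in> gens" "y \<in> gens" for x y
    using that assms by (auto simp: is_filter_product_def gens_def simp del: one_sum_group)
qed (use assms in \<open>auto simp: is_filter_product_def\<close>)


definition lie where "lie = (THE b. is_filter_product G R \<phi> b)"

lemma is_filter_product_lie: "is_filter_product G R \<phi> lie"
  unfolding lie_def by (rule theI'[of "is_filter_product G R \<phi>"]) (use ex_product unique_product in blast)

lemma lie_biadditive: "biadditive L L L lie"
  using is_filter_product_lie by (simp add: is_filter_product_def)

lemma lie_gen:
  assumes "s \<noteq> 0" "t \<noteq> 0" "s + t \<noteq> 0" "x \<in> \<phi> s" "y \<in> \<phi> t" "r \<in> carrier R" "r' \<in> carrier R"
  shows "lie (gen s x r) (gen t y r') = gen (s + t) (comm x y) (r \<otimes>\<^bsub>R\<^esub> r')"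
  using is_filter_product_lie assms by (simp add: is_filter_product_def)

lemma lie_gen_zero:
  assumes "s \<noteq> 0" "t \<noteq> 0" "s + t = 0" "x \<in> \<phi> s" "y \<in> \<phi> t" "r \<in> carrier R" "r' \<in> carrier R"
  shows "lie (gen s x r) (gen t y r') = \<one>\<^bsub>L\<^esub>"
  using is_filter_product_lie assms by (simp add: is_filter_product_def del: one_sum_group)

lemma lie_closed: "a \<in> carrier L \<Longrightarrow> b \<in> carrier L \<Longrightarrow> lie a b \<in> carrier L"
  by (rule biadditive_closed[OF lie_biadditive])

lemmas lie_mult_left = hom_mult[OF biadditive_hom_left[OF lie_biadditive]]
lemmas lie_mult_right = hom_mult[OF biadditive_hom_right[OF lie_biadditive]]
lemmas lie_inv_left = biadditive_inv_left[OF Lsum.S.is_group Lsum.S.is_group Lsum.S.is_group lie_biadditive]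
lemmas lie_inv_right = biadditive_inv_right[OF Lsum.S.is_group Lsum.S.is_group Lsum.S.is_group lie_biadditive]
lemmas lie_one_left = biadditive_one_left[OF Lsum.S.is_group Lsum.S.is_group Lsum.S.is_group lie_biadditive]

lemma lie_antisymmetric:
  assumes "a \<in> carrier L" "b \<in> carrier L"
  shows "lie a b = inv\<^bsub>L\<^esub> lie b a"
proof -
  have bi: "biadditive L L L (\<lambda>a b. inv\<^bsub>L\<^esub> lie b a)"
    by (intro comp_biadditive[OF biadditive_transpose[OF lie_biadditive]] Lsum.S.inv_in_hom)
  show ?thesis
  proof (rule biadditive_eq_on_generators[OF Lsum.S.is_group Lsum.S.is_group Lsum.S.is_group
        lie_biadditive bi L_generated L_generated _ assms])
    fix g h assume "g \<in> gens" "h \<in> gens"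
    then obtain s x r t y r' where g: "g = gen s x r" "s \<noteq> 0" "x \<in> \<phi> s" "r \<in> carrier R"
      and h: "h = gen t y r'" "t \<noteq> 0" "y \<in> \<phi> t" "r' \<in> carrier R"
      unfolding gens_def by blast
    show "lie g h = inv\<^bsub>L\<^esub> lie h g"
    proof (cases "s + t = 0")
      case True
      then have "t + s = 0" by (simp add: add.commute)
      then show ?thesis using lie_gen_zero True g h Lsum.S.inv_one by (simp del: one_sum_group)
    next
      case False
      then have "t + s \<noteq> 0" by (simp add: add.commute)
      then have "inv\<^bsub>L\<^esub> lie h g = gen (t + s) (inv (comm y x)) (r' \<otimes>\<^bsub>R\<^esub> r)"
        using g h comm_in_filter by (simp add: lie_gen gen_inv del: inv_sum_group)
      also have "\<dots> = lie g h"
        using g h False by (simp add: lie_gen inv_comm fil.mem_carrier add.commute R.m_comm)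
      finally show ?thesis by simp
    qed
  qed
qed

text \<open>
  On a generator \<open>[x, x] = 1\<close>. The set of all \<open>a\<close> with \<open>lie a a = \<one>\<close> is closed under products by
  antisymmetry.
\<close>

lemma lie_self:
  assumes "a \<in> carrier L"
  shows "lie a a = \<one>\<^bsub>L\<^esub>"
proof -
  have gens_self: "lie g g = \<one>\<^bsub>L\<^esub>" if "g \<in> gens" for g
  proof -
    obtain s x r where g: "g = gen s x r" "s \<noteq> 0" "x \<in> \<phi> s" "r \<in> carrier R"
      using \<open>g \<in> gens\<close> unfolding gens_def by blast
    show ?thesis
    proof (cases "s + s = 0")
      case True
      then show ?thesis using lie_gen_zero g by (simp del: one_sum_group)
    next
      case False
      then have "lie g g = gen (s + s) \<one> (r \<otimes>\<^bsub>R\<^esub> r)"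
        using g by (simp add: lie_gen comm_self fil.mem_carrier)
      also have "\<dots> = \<one>\<^bsub>L\<^esub>"
        by (rule gen_boundary) (use False g boundary.one_closed in auto)
      finally show ?thesis .
    qed
  qed
  have "a \<in> generate L gens" using assms L_generated by simp
  then show ?thesis
  proof (induction a rule: generate.induct)
    case one
    then show ?case using lie_one_left[OF Lsum.S.one_closed] .
  next
    case (incl g)
    then show ?case by (rule gens_self)
  next
    case (inv g)
    then have "g \<in> carrier L" using gens_in_L by blast
    then have "lie (inv\<^bsub>L\<^esub> g) (inv\<^bsub>L\<^esub> g) = lie g g"
      by (simp add: lie_inv_left lie_inv_right lie_closed Lsum.S.inv_closed Lsum.S.inv_inv del: inv_sum_group)
    then show ?case using gens_self[OF inv] by simp
  next
    case (eng a b)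
    then have c: "a \<in> carrier L" "b \<in> carrier L" using L_generated by auto
    have "lie (a \<otimes>\<^bsub>L\<^esub> b) (a \<otimes>\<^bsub>L\<^esub> b) = (lie a a \<otimes>\<^bsub>L\<^esub> lie b a) \<otimes>\<^bsub>L\<^esub> (lie a b \<otimes>\<^bsub>L\<^esub> lie b b)"
      using c by (simp add: lie_mult_left lie_mult_right Lsum.S.m_closed del: mult_sum_group)
    also have "\<dots> = lie b a \<otimes>\<^bsub>L\<^esub> inv\<^bsub>L\<^esub> lie b a"
      using eng.IH c lie_closed lie_antisymmetric[of a b] by (simp del: mult_sum_group one_sum_group inv_sum_group)
    also have "\<dots> = \<one>\<^bsub>L\<^esub>" using c lie_closed Lsum.S.r_inv by blast
    finally show ?case .
  qed
qed

text \<open>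
  The Hall--Witt identity carries inverses in its inner commutators. They become signs, because
  the bracket of classes is biadditive.
\<close>

lemma lie_gen_cyclic:
  assumes g: "g \<in> gens" and h: "h \<in> gens" and k: "k \<in> gens"
  shows "lie (lie g h) k \<otimes>\<^bsub>L\<^esub> lie (lie h k) g \<otimes>\<^bsub>L\<^esub> lie (lie k g) h = \<one>\<^bsub>L\<^esub>"
proof -
  obtain s x r where g': "g = gen s x r" "s \<noteq> 0" "x \<in> \<phi> s" "r \<in> carrier R"
    using g unfolding gens_def by blast
  obtain t y r' where h': "h = gen t y r'" "t \<noteq> 0" "y \<in> \<phi> t" "r' \<in> carrier R"
    using h unfolding gens_def by blast
  obtain u z r'' where k': "k = gen u z r''" "u \<noteq> 0" "z \<in> \<phi> u" "r'' \<in> carrier R"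
    using k unfolding gens_def by blast
  have c: "g \<in> carrier L" "h \<in> carrier L" "k \<in> carrier L" using g h k gens_in_L by auto
  show ?thesis
  \<comment> \<open>An inner bracket whose degree is \<open>0\<close> vanishes, but then so does the whole ring.\<close>
  proof (cases "\<exists>v w :: 'm. v + w = 0 \<and> v \<noteq> 0")
    case True
    then have "carrier L = {\<one>\<^bsub>L\<^esub>}" using L_trivial by blast
    moreover have "lie (lie g h) k \<otimes>\<^bsub>L\<^esub> lie (lie h k) g \<otimes>\<^bsub>L\<^esub> lie (lie k g) h \<in> carrier L"
      using c by (intro Lsum.S.m_closed lie_closed)
    ultimately show ?thesis by (simp only: singleton_iff)
  next
    case False
    then have nz: "v + w \<noteq> 0" if "v \<noteq> 0" for v w :: 'm using that by blast
    let ?d = "s + t + u" and ?q = "r \<otimes>\<^bsub>R\<^esub> r' \<otimes>\<^bsub>R\<^esub> r''"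
    have triple: "lie (lie (gen v1 x1 q1) (inv\<^bsub>L\<^esub> gen v2 x2 q2)) (gen v3 x3 q3)
        = gen (v1 + v2 + v3) (comm (comm x1 (inv x2)) x3) (q1 \<otimes>\<^bsub>R\<^esub> q2 \<otimes>\<^bsub>R\<^esub> q3)"
      if "v1 \<noteq> 0" "v2 \<noteq> 0" "v3 \<noteq> 0" "x1 \<in> \<phi> v1" "x2 \<in> \<phi> v2" "x3 \<in> \<phi> v3"
        "q1 \<in> carrier R" "q2 \<in> carrier R" "q3 \<in> carrier R" for v1 v2 v3 x1 x2 x3 q1 q2 q3
      using that by (simp add: gen_inv[symmetric] lie_gen nz comm_in_filter fil.m_inv_closed del: inv_sum_group)
    interpret abelian_section G "\<phi> ?d" "bd ?d" by (rule filter_section) (simp add: nz g')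
    let ?a = "comm (comm x (inv y)) z" and ?b = "comm (comm y (inv z)) x" and ?c = "comm (comm z (inv x)) y"
    have in_top: "?a \<in> \<phi> ?d" "?b \<in> \<phi> ?d" "?c \<in> \<phi> ?d"
      using comm_in_filter[OF comm_in_filter[of x s "inv y" t], of z u]
        comm_in_filter[OF comm_in_filter[of y t "inv z" u], of x s]
        comm_in_filter[OF comm_in_filter[of z u "inv x" s], of y t] g' h' k'
      by (simp_all add: fil.m_inv_closed ac_simps)
    have "(bd ?d #> ?a) \<otimes>\<^bsub>Sec\<^esub> (bd ?d #> ?b) \<otimes>\<^bsub>Sec\<^esub> (bd ?d #> ?c) = \<one>\<^bsub>Sec\<^esub>"
      by (rule cls_hall_witt)
        (use g' h' k' in_top comm_in_filter[OF in_top(1)] comm_in_filter[OF in_top(2)]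
          comm_in_filter[OF in_top(3)] in_boundary in \<open>auto simp: fil.mem_carrier\<close>)
    then have "bd ?d #> (?a \<otimes> ?b \<otimes> ?c) = bd ?d #> \<one>"
      using in_top cls_trivial[OF boundary.one_closed] by (simp add: cls_mult del: mult_FactGroup one_FactGroup)
    then have "gen ?d (?a \<otimes> ?b \<otimes> ?c) ?q = gen ?d \<one> ?q" by (rule gen_cong)
    moreover have "gen ?d \<one> ?q = \<one>\<^bsub>L\<^esub>"
      by (rule gen_boundary) (use g' h' k' nz in auto)
    ultimately have "gen ?d ?a ?q \<otimes>\<^bsub>L\<^esub> gen ?d ?b ?q \<otimes>\<^bsub>L\<^esub> gen ?d ?c ?q = \<one>\<^bsub>L\<^esub>"
      using in_top g' h' k' nz by (simp add: gen_mult_left del: mult_sum_group one_sum_group)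
    moreover have "gen ?d ?a ?q = lie (lie g (inv\<^bsub>L\<^esub> h)) k"
      using triple[of s t u x y z r r' r''] g' h' k' by simp
    moreover have "gen ?d ?b ?q = lie (lie h (inv\<^bsub>L\<^esub> k)) g"
      using triple[of t u s y z x r' r'' r] g' h' k' by (simp add: ac_simps R.m_ac)
    moreover have "gen ?d ?c ?q = lie (lie k (inv\<^bsub>L\<^esub> g)) h"
      using triple[of u s t z x y r'' r r'] g' h' k' by (simp add: ac_simps R.m_ac)
    ultimately have "inv\<^bsub>L\<^esub> lie (lie g h) k \<otimes>\<^bsub>L\<^esub> inv\<^bsub>L\<^esub> lie (lie h k) g \<otimes>\<^bsub>L\<^esub> inv\<^bsub>L\<^esub> lie (lie k g) h = \<one>\<^bsub>L\<^esub>"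
      using c by (simp add: lie_inv_right lie_inv_left lie_closed Lsum.S.inv_closed del: mult_sum_group one_sum_group inv_sum_group)
    then have "inv\<^bsub>L\<^esub> (lie (lie g h) k \<otimes>\<^bsub>L\<^esub> lie (lie h k) g \<otimes>\<^bsub>L\<^esub> lie (lie k g) h) = \<one>\<^bsub>L\<^esub>"
      using c by (simp add: Lsum.S.inv_mult lie_closed Lsum.S.m_closed del: mult_sum_group one_sum_group inv_sum_group)
    then show ?thesis
      using c lie_closed Lsum.S.m_closed Lsum.S.inv_eq_1_iff by metis
  qed
qed

text \<open>
  The Jacobi sum is cyclically invariant, so additivity in the first argument suffices to pass from
  generators to arbitrary elements in all three arguments, one after the other.
\<close>

lemma lie_jacobi:
  assumes "a \<in> carrier L" "b \<in> carrier L" "c \<in> carrier L"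
  shows "lie a (lie b c) \<otimes>\<^bsub>L\<^esub> lie b (lie c a) \<otimes>\<^bsub>L\<^esub> lie c (lie a b) = \<one>\<^bsub>L\<^esub>"
proof -
  let ?J = "\<lambda>a b c. lie a (lie b c) \<otimes>\<^bsub>L\<^esub> lie b (lie c a) \<otimes>\<^bsub>L\<^esub> lie c (lie a b)"
  have cyclic: "?J a b c = ?J b c a" if "a \<in> carrier L" "b \<in> carrier L" "c \<in> carrier L" for a b c
    using that lie_closed Lsum.S.m_ac Lsum.S.m_closed by (simp del: mult_sum_group)
  have step: "?J a b c = \<one>\<^bsub>L\<^esub>"
    if J: "\<And>g. g \<in> gens \<Longrightarrow> ?J g b c = \<one>\<^bsub>L\<^esub>" and c: "a \<in> carrier L" "b \<in> carrier L" "c \<in> carrier L" for a b c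
  proof (rule hom_eq_on_generators[OF Lsum.S.is_group Lsum.S.is_group _ _ L_generated, of "\<lambda>a. ?J a b c" "\<lambda>_. \<one>\<^bsub>L\<^esub>"])
    have "(\<lambda>a. lie a (lie b c)) \<in> hom L L"
      using biadditive_hom_left[OF lie_biadditive] lie_closed c by blast
    moreover have "(\<lambda>a. lie b (lie c a)) \<in> hom L L"
      using Group.hom_compose[OF biadditive_hom_right[OF lie_biadditive] biadditive_hom_right[OF lie_biadditive]] c
      by (simp add: comp_def)
    moreover have "(\<lambda>a. lie c (lie a b)) \<in> hom L L"
      using Group.hom_compose[OF biadditive_hom_left[OF lie_biadditive] biadditive_hom_right[OF lie_biadditive]] c
      by (simp add: comp_def)
    ultimately show "(\<lambda>a. ?J a b c) \<in> hom L L" by (intro Lsum.S.hom_mult_pointwise)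
    show "(\<lambda>_. \<one>\<^bsub>L\<^esub>) \<in> hom L L"
      using Lsum.S.one_closed Lsum.S.l_one[OF Lsum.S.one_closed] by (simp add: hom_def del: mult_sum_group one_sum_group)
  qed (use J c in auto)
  have gens: "?J g h k = \<one>\<^bsub>L\<^esub>" if "g \<in> gens" "h \<in> gens" "k \<in> gens" for g h k
  proof -
    have c: "g \<in> carrier L" "h \<in> carrier L" "k \<in> carrier L" using that gens_in_L by auto
    then have "?J g h k = inv\<^bsub>L\<^esub> lie (lie h k) g \<otimes>\<^bsub>L\<^esub> inv\<^bsub>L\<^esub> lie (lie k g) h \<otimes>\<^bsub>L\<^esub> inv\<^bsub>L\<^esub> lie (lie g h) k"
      using lie_antisymmetric lie_closed by metis
    also have "\<dots> = inv\<^bsub>L\<^esub> (lie (lie h k) g \<otimes>\<^bsub>L\<^esub> lie (lie k g) h \<otimes>\<^bsub>L\<^esub> lie (lie g h) k)"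
      using c by (simp add: Lsum.S.inv_mult lie_closed Lsum.S.m_closed del: mult_sum_group one_sum_group inv_sum_group)
    also have "\<dots> = \<one>\<^bsub>L\<^esub>" using lie_gen_cyclic[OF that(2,3,1)] Lsum.S.inv_one by (simp only:)
    finally show ?thesis .
  qed
  have 1: "?J a h k = \<one>\<^bsub>L\<^esub>" if "a \<in> carrier L" "h \<in> gens" "k \<in> gens" for a h k
    using step[OF gens] that gens_in_L by blast
  have 2: "?J a b k = \<one>\<^bsub>L\<^esub>" if c: "a \<in> carrier L" "b \<in> carrier L" "k \<in> gens" for a b k
  proof (rule step)
    fix g assume g: "g \<in> gens"
    have "?J g b k = ?J b k g" by (rule cyclic) (use c g gens_in_L in auto)
    also have "\<dots> = \<one>\<^bsub>L\<^esub>" by (rule 1[OF c(2,3) g])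
    finally show "?J g b k = \<one>\<^bsub>L\<^esub>" .
  qed (use c gens_in_L in auto)
  show ?thesis
  proof (rule step)
    fix g assume g: "g \<in> gens"
    have "?J g b c = ?J b c g" by (rule cyclic) (use assms g gens_in_L in auto)
    also have "\<dots> = \<one>\<^bsub>L\<^esub>" by (rule 2[OF assms(2,3) g])
    finally show "?J g b c = \<one>\<^bsub>L\<^esub>" .
  qed (use assms in auto)
qed


abbreviation "Lie \<equiv> filter_lie_ring G R \<phi>"

lemma Lie_simps:
  shows carrier_Lie: "carrier Lie = carrier L"
    and add_Lie: "ring.add Lie = monoid.mult L"
    and zero_Lie: "ring.zero Lie = \<one>\<^bsub>L\<^esub>"
    and mult_Lie: "monoid.mult Lie = lie"
  by (simp_all add: filter_lie_ring_def lie_def)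

lemmas hom_Lie_dom = hom_add_monoid_dom[OF carrier_Lie add_Lie]
lemmas hom_Lie_cod = hom_add_monoid_cod[OF carrier_Lie add_Lie]

lemma lie_ring_Lie: "lie_ring Lie"
proof (intro lie_ring.intro lie_ring_axioms.intro)
  show "abelian_group Lie"
    by (rule abelian_group_of_comm_group[OF Lsum.comm_group_S carrier_Lie add_Lie zero_Lie])
  show "biadditive (add_monoid Lie) (add_monoid Lie) (add_monoid Lie) (\<otimes>\<^bsub>Lie\<^esub>)"
    using lie_biadditive unfolding biadditive_def hom_Lie_dom hom_Lie_cod mult_Lie by (simp add: carrier_Lie)
  show "a \<otimes>\<^bsub>Lie\<^esub> a = \<zero>\<^bsub>Lie\<^esub>" if "a \<in> carrier Lie" for a
    using lie_self that unfolding Lie_simps .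
  show "a \<otimes>\<^bsub>Lie\<^esub> (b \<otimes>\<^bsub>Lie\<^esub> c) \<oplus>\<^bsub>Lie\<^esub> b \<otimes>\<^bsub>Lie\<^esub> (c \<otimes>\<^bsub>Lie\<^esub> a) \<oplus>\<^bsub>Lie\<^esub> c \<otimes>\<^bsub>Lie\<^esub> (a \<otimes>\<^bsub>Lie\<^esub> b) = \<zero>\<^bsub>Lie\<^esub>"
    if "a \<in> carrier Lie" "b \<in> carrier Lie" "c \<in> carrier Lie" for a b c
    using lie_jacobi that unfolding Lie_simps .
qed

lemma lie_graded:
  assumes a: "a \<in> homogeneous (filter_component G R \<phi>) s"
    and b: "b \<in> homogeneous (filter_component G R \<phi>) t"
  shows "lie a b \<in> homogeneous (filter_component G R \<phi>) (s + t)"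
proof (rule homogeneous_hom_in_subgroup[OF Lsum.S.is_group _ Lsum.subgroup_homogeneous _ a])
  show "(\<lambda>a. lie a b) \<in> hom L L"
    using biadditive_hom_left[OF lie_biadditive] Lsum.homogeneous_in_carrier[OF b] .
next
  fix x r assume s: "s \<noteq> 0" "x \<in> \<phi> s" "r \<in> carrier R"
  show "lie (gen s x r) b \<in> homogeneous (filter_component G R \<phi>) (s + t)"
  proof (rule homogeneous_hom_in_subgroup[OF Lsum.S.is_group _ Lsum.subgroup_homogeneous _ b])
    show "lie (gen s x r) \<in> hom L L"
      using biadditive_hom_right[OF lie_biadditive] gen_in_L s by blast
    fix y r' assume t: "t \<noteq> 0" "y \<in> \<phi> t" "r' \<in> carrier R"
    show "lie (gen s x r) (gen t y r') \<in> homogeneous (filter_component G R \<phi>) (s + t)"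
    proof (cases "s + t = 0")
      case True
      then show ?thesis
        using lie_gen_zero s t subgroup.one_closed[OF Lsum.subgroup_homogeneous] by (simp del: one_sum_group)
    next
      case False
      then show ?thesis using s t by (simp add: lie_gen gen_closed comm_in_filter)
    qed
  qed
qed

lemma graded_lie_ring_Lie: "graded_lie_ring Lie (homogeneous (filter_component G R \<phi>))"
proof (intro graded_lie_ring.intro graded_lie_ring_axioms.intro lie_ring_Lie)
  show "internal_direct_sum Lie (homogeneous (filter_component G R \<phi>))"
    by (rule Lsum.internal_direct_sum_homogeneous[OF carrier_Lie add_Lie zero_Lie])
qed (simp add: mult_Lie lie_graded)

lemma smult_Lie:
  assumes r: "r \<in> carrier R"
  shows smult_Lie_hom: "module.smult Lie r \<in> hom L L"
    and smult_Lie_gen: "\<And>s x r'. s \<noteq> 0 \<Longrightarrow> x \<in> \<phi> s \<Longrightarrow> r' \<in> carrier R \<Longrightarrow>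
      module.smult Lie r (gen s x r') = gen s x (r \<otimes>\<^bsub>R\<^esub> r')"
proof -
  define h where "h s c = (if s = 0 then \<one>\<^bsub>filter_component G R \<phi> 0\<^esub>
    else tensor_smult (filter_quotient G \<phi> s) R r c)" for s :: 'm and c
  have h: "h s \<in> hom (filter_component G R \<phi> s) (filter_component G R \<phi> s)" for s
  proof (cases "s = 0")
    case True
    then show ?thesis
      using Lsum.component.one_closed[of 0] Lsum.component.l_one[of "\<one>\<^bsub>filter_component G R \<phi> 0\<^esub>" 0]
      by (simp add: h_def hom_def)
  next
    case False
    then have "h s = tensor_smult (filter_quotient G \<phi> s) R r" by (simp add: h_def fun_eq_iff)
    then show ?thesis
      using R.tensor_smult_in_hom[OF filter_quotient_comm_group[OF False] r] False
      by (simp add: filter_component_def)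
  qed
  have eq: "module.smult Lie r = (\<lambda>a s. h s (a s))"
    by (simp add: filter_lie_ring_def h_def fun_eq_iff)
  show "module.smult Lie r \<in> hom L L"
    unfolding eq by (rule Lsum.componentwise_in_hom[OF h])
  fix s x r' assume s: "s \<noteq> 0" "x \<in> \<phi> s" "r' \<in> carrier R"
  interpret abelian_section G "\<phi> s" "bd s" by (rule filter_section[OF s(1)])
  have "bd s #> x \<in> carrier (filter_quotient G \<phi> s)"
    using cls_closed s unfolding filter_quotient_def by blast
  then have "h s (pure_tensor (filter_quotient G \<phi> s) R (bd s #> x) r')
      = pure_tensor (filter_quotient G \<phi> s) R (bd s #> x) (r \<otimes>\<^bsub>R\<^esub> r')"
    using R.tensor_smult_pure[OF filter_quotient_comm_group[OF s(1)] r] s by (simp add: h_def)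
  then show "module.smult Lie r (gen s x r') = gen s x (r \<otimes>\<^bsub>R\<^esub> r')"
    unfolding eq filter_elem_def by (simp add: Lsum.componentwise_sum_inj[OF h])
qed

lemma module_Lie: "module R Lie"
proof (rule moduleI)
  show "cring R" by (rule R.is_cring)
  show "abelian_group Lie"
    by (rule abelian_group_of_comm_group[OF Lsum.comm_group_S carrier_Lie add_Lie zero_Lie])
  show "r \<odot>\<^bsub>Lie\<^esub> a \<in> carrier Lie" if "r \<in> carrier R" "a \<in> carrier Lie" for r a
    using hom_in_carrier[OF smult_Lie_hom] that by (simp add: carrier_Lie)
  show "r \<odot>\<^bsub>Lie\<^esub> (a \<oplus>\<^bsub>Lie\<^esub> b) = r \<odot>\<^bsub>Lie\<^esub> a \<oplus>\<^bsub>Lie\<^esub> r \<odot>\<^bsub>Lie\<^esub> b"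
    if "r \<in> carrier R" "a \<in> carrier Lie" "b \<in> carrier Lie" for r a b
    using hom_mult[OF smult_Lie_hom] that unfolding Lie_simps .
  show "(r \<oplus>\<^bsub>R\<^esub> r') \<odot>\<^bsub>Lie\<^esub> a = r \<odot>\<^bsub>Lie\<^esub> a \<oplus>\<^bsub>Lie\<^esub> r' \<odot>\<^bsub>Lie\<^esub> a"
    if "r \<in> carrier R" "r' \<in> carrier R" "a \<in> carrier Lie" for r r' a
    unfolding add_Lie
  proof (rule hom_eq_on_generators[OF Lsum.S.is_group Lsum.S.is_group _ _ L_generated, of _ "\<lambda>a. (r \<odot>\<^bsub>Lie\<^esub> a) \<otimes>\<^bsub>L\<^esub> (r' \<odot>\<^bsub>Lie\<^esub> a)"])
    fix g assume "g \<in> gens"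
    then show "(r \<oplus>\<^bsub>R\<^esub> r') \<odot>\<^bsub>Lie\<^esub> g = (r \<odot>\<^bsub>Lie\<^esub> g) \<otimes>\<^bsub>L\<^esub> (r' \<odot>\<^bsub>Lie\<^esub> g)"
      using that by (auto simp: gens_def smult_Lie_gen R.l_distr gen_add_right simp del: mult_sum_group)
  qed (use that smult_Lie_hom in \<open>auto simp: carrier_Lie simp del: mult_sum_group intro!: Lsum.S.hom_mult_pointwise\<close>)
  show "(r \<otimes>\<^bsub>R\<^esub> r') \<odot>\<^bsub>Lie\<^esub> a = r \<odot>\<^bsub>Lie\<^esub> (r' \<odot>\<^bsub>Lie\<^esub> a)"
    if "r \<in> carrier R" "r' \<in> carrier R" "a \<in> carrier Lie" for r r' a
  proof (rule hom_eq_on_generators[OF Lsum.S.is_group Lsum.S.is_group _ _ L_generated, of _ "\<lambda>a. r \<odot>\<^bsub>Lie\<^esub> (r' \<odot>\<^bsub>Lie\<^esub> a)"])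
    show "(\<lambda>a. r \<odot>\<^bsub>Lie\<^esub> (r' \<odot>\<^bsub>Lie\<^esub> a)) \<in> hom L L"
      using Group.hom_compose[OF smult_Lie_hom smult_Lie_hom] that by (simp add: comp_def)
    fix g assume "g \<in> gens"
    then show "(r \<otimes>\<^bsub>R\<^esub> r') \<odot>\<^bsub>Lie\<^esub> g = r \<odot>\<^bsub>Lie\<^esub> (r' \<odot>\<^bsub>Lie\<^esub> g)"
      using that by (auto simp: gens_def smult_Lie_gen R.m_assoc)
  qed (use that smult_Lie_hom in \<open>auto simp: carrier_Lie\<close>)
  show "\<one>\<^bsub>R\<^esub> \<odot>\<^bsub>Lie\<^esub> a = a" if "a \<in> carrier Lie" for a
  proof (rule hom_eq_on_generators[OF Lsum.S.is_group Lsum.S.is_group _ _ L_generated, of _ "\<lambda>a. a"])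
    show "(\<lambda>a. a) \<in> hom L L" by (simp add: hom_def)
  qed (use that smult_Lie_hom in \<open>auto simp: carrier_Lie gens_def smult_Lie_gen\<close>)
qed

end

section \<open>The sections of a layering\<close>

locale filter_layering = coefficient_filter prec G R \<phi> + Q: module R Q
  for prec :: "'m::comm_monoid_add \<Rightarrow> 'm \<Rightarrow> bool" and G :: "('g, 'x) monoid_scheme" (structure)
    and R :: "('r, 'y) ring_scheme" and \<phi> :: "'m \<Rightarrow> 'g set" and Q :: "('r, 'q, 'z) module_scheme" +
  fixes \<pi> :: "'m \<Rightarrow> 'g set"
  assumes layering: "layering G prec \<pi>"
    and filter_acts: "commutator_subgroup G (\<phi> s) (\<pi> (s + t)) \<subseteq> \<pi> t"
begin

abbreviation "lbd \<equiv> layer_boundary G \<pi>"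

lemma subgroup_layer: "subgroup (\<pi> s) G"
  using layering by (simp add: layering_def)

sublocale layer: subgroup "\<pi> s" G for s
  by (rule subgroup_layer)

lemma subgroup_lbd: "subgroup (lbd s) G"
  unfolding layer_boundary_def
  by (rule subgroupI) (auto intro: layer.one_closed layer.m_inv_closed layer.m_closed)

sublocale layer_bd: subgroup "lbd s" G for s
  by (rule subgroup_lbd)

lemma comm_filter_layer: "x \<in> \<phi> s \<Longrightarrow> y \<in> \<pi> (s + t) \<Longrightarrow> comm x y \<in> \<pi> t"
  using filter_acts unfolding commutator_subgroup_def by (blast intro: generate.incl)

lemma comm_layer_lbd: "x \<in> \<pi> s \<Longrightarrow> y \<in> lbd t \<Longrightarrow> comm x y \<in> \<pi> t"
  using layering unfolding layering_def commutator_subgroup_def by (blast intro: generate.incl)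

lemma layer_subset_lbd: "\<pi> s \<subseteq> lbd s"
proof -
  have "\<pi> s \<subseteq> \<pi> (s + t)" for t using layering prec_add by (simp add: layering_def)
  then show ?thesis using layer.subset by (auto simp: layer_boundary_def)
qed

lemma lbd_subset_layer: "t \<noteq> 0 \<Longrightarrow> lbd s \<subseteq> \<pi> (s + t)"
  unfolding layer_boundary_def by blast

text \<open>
  As \<open>s \<noteq> 0\<close>, the boundary of degree \<open>s\<close> is contained in \<open>\<pi> (s + s)\<close>, and every term of a layering
  centralises the boundary of degree \<open>s\<close> modulo \<open>\<pi> s\<close>.
\<close>

lemma layer_section:
  assumes "s \<noteq> 0"
  shows "abelian_section G (lbd s) (\<pi> s)"
proof (intro abelian_section.intro abelian_section_axioms.intro)
  show "comm x y \<in> \<pi> s" if "x \<in> lbd s" "y \<in> lbd s" for x y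
    using comm_layer_lbd[OF _ that(2)] that(1) lbd_subset_layer[OF assms] by blast
qed (rule is_group subgroup_layer subgroup_lbd layer_subset_lbd)+

text \<open>
  The boundary is the intersection of the \<open>\<pi> (s + t + u)\<close> with \<open>u \<noteq> 0\<close>, and commutation with \<open>x\<close>
  lowers each of them by \<open>s\<close>.
\<close>

lemma comm_filter_lbd:
  assumes "x \<in> \<phi> s" "y \<in> lbd (s + t)"
  shows "comm x y \<in> lbd t"
proof -
  have "comm x y \<in> \<pi> (t + u)" if "u \<noteq> 0" for u
    using comm_filter_layer[OF assms(1), of y "t + u"] assms(2) lbd_subset_layer[OF that, of "s + t"]
    by (auto simp: add.assoc)
  then show ?thesis
    using fil.mem_carrier[OF assms(1)] layer_bd.mem_carrier[OF assms(2)]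
    by (simp add: layer_boundary_def)
qed

lemma comm_lbd_layer: "x \<in> lbd t \<Longrightarrow> y \<in> \<pi> s \<Longrightarrow> comm x y \<in> \<pi> t"
  using layer.m_inv_closed[OF comm_layer_lbd, of y s x t]
  by (simp add: inv_comm layer.mem_carrier layer_bd.mem_carrier)

text \<open>
  In nonzero degree \<open>s\<close> the filter centralises each section of the layering, because the boundary of
  degree \<open>t\<close> is contained in \<open>\<pi> (s + t)\<close>.
\<close>

lemma comm_lbd_filter:
  assumes "x \<in> lbd t" "y \<in> \<phi> s" "s \<noteq> 0"
  shows "comm x y \<in> \<pi> t"
proof -
  have "comm y x \<in> \<pi> t"
    using comm_filter_layer[OF assms(2), of x t] lbd_subset_layer[OF assms(3), of t] assms(1)
    by (auto simp: add.commute)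
  then show ?thesis
    using layer.m_inv_closed inv_comm assms fil.mem_carrier layer_bd.mem_carrier by metis
qed

abbreviation "lq \<equiv> layer_quotient G \<pi>"
abbreviation "lc \<equiv> layer_component G Q \<pi>"
abbreviation "V \<equiv> layer_sum G Q \<pi>"
abbreviation "linj \<equiv> sum_inj (layer_component G Q \<pi>)"

lemma layer_quotient_nonzero: "s \<noteq> 0 \<Longrightarrow> lq s = G\<lparr>carrier := lbd s\<rparr> Mod \<pi> s"
  by (simp add: layer_quotient_def)

text \<open>
  The action is dual to this homomorphism. Its error term \<open>[[x, y], y']\<close> vanishes since \<open>[x, y]\<close> is
  in the boundary of degree \<open>t\<close> and \<open>y'\<close> in some term of the layering; in the next lemma the
  error term is \<open>[[x, y], x']\<close>, with \<open>x'\<close> of nonzero degree in the filter.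
\<close>

lemma comm_hom_right:
  assumes s: "s \<noteq> 0" and t: "t \<noteq> 0" and x: "x \<in> \<phi> s"
  shows "(\<lambda>y. \<pi> t #> comm x y) \<in> hom (G\<lparr>carrier := lbd (s + t)\<rparr>) (lq t)"
proof -
  interpret abelian_section G "lbd t" "\<pi> t" by (rule layer_section[OF t])
  have c: "comm x y \<in> lbd t" if "y \<in> lbd (s + t)" for y
    by (rule comm_filter_lbd[OF x that])
  show ?thesis
    unfolding layer_quotient_nonzero[OF t]
  proof (rule homI)
    fix y y' assume "y \<in> carrier (G\<lparr>carrier := lbd (s + t)\<rparr>)" "y' \<in> carrier (G\<lparr>carrier := lbd (s + t)\<rparr>)"
    then have y: "y \<in> lbd (s + t)" "y' \<in> lbd (s + t)" by auto
    have "comm (comm x y) y' \<in> \<pi> t"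
      using comm_lbd_layer[OF c[OF y(1)]] y(2) lbd_subset_layer[OF s] by blast
    then show "\<pi> t #> comm x (y \<otimes>\<^bsub>G\<lparr>carrier := lbd (s + t)\<rparr>\<^esub> y')
        = (\<pi> t #> comm x y) \<otimes>\<^bsub>Sec\<^esub> (\<pi> t #> comm x y')"
      using y c x fil.mem_carrier layer_bd.mem_carrier
      by (simp add: cls_comm_mult_right del: mult_FactGroup)
  qed (use cls_closed c in auto)
qed

lemma comm_hom_left:
  assumes s: "s \<noteq> 0" and t: "t \<noteq> 0" and y: "y \<in> lbd (s + t)"
  shows "(\<lambda>x. \<pi> t #> comm x y) \<in> hom (G\<lparr>carrier := \<phi> s\<rparr>) (lq t)"
proof -
  interpret abelian_section G "lbd t" "\<pi> t" by (rule layer_section[OF t])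
  have c: "comm x y \<in> lbd t" if "x \<in> \<phi> s" for x
    by (rule comm_filter_lbd[OF that y])
  show ?thesis
    unfolding layer_quotient_nonzero[OF t]
  proof (rule homI)
    fix x x' assume "x \<in> carrier (G\<lparr>carrier := \<phi> s\<rparr>)" "x' \<in> carrier (G\<lparr>carrier := \<phi> s\<rparr>)"
    then have x: "x \<in> \<phi> s" "x' \<in> \<phi> s" by auto
    then show "\<pi> t #> comm (x \<otimes>\<^bsub>G\<lparr>carrier := \<phi> s\<rparr>\<^esub> x') y
        = (\<pi> t #> comm x y) \<otimes>\<^bsub>Sec\<^esub> (\<pi> t #> comm x' y)"
      using y c comm_lbd_filter[OF c _ s] fil.mem_carrier layer_bd.mem_carrier
      by (simp add: cls_comm_mult_left del: mult_FactGroup)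
  qed (use cls_closed c in auto)
qed

lemma layer_cls_trivial: "t \<noteq> 0 \<Longrightarrow> w \<in> \<pi> t \<Longrightarrow> \<pi> t #> w = \<one>\<^bsub>lq t\<^esub>"
  using abelian_section.cls_trivial[OF layer_section] by (simp add: layer_quotient_nonzero)

lemma comm_boundary_layer:
  assumes s: "s \<noteq> 0" and x: "x \<in> bd s" and y: "y \<in> lbd (s + t)"
  shows "comm x y \<in> \<pi> t"
proof (rule comm_boundary_in_subgroup[OF subgroup_layer _ _ _ x])
  show "y \<in> carrier G" using y by (rule layer_bd.mem_carrier)
  show "comm x y \<in> \<pi> t" if "u \<noteq> 0" "x \<in> \<phi> (s + u)" for u x
    using comm_filter_layer[OF that(2), of y t] y lbd_subset_layer[OF that(1), of "s + t"]
    by (auto simp: ac_simps)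
  show "comm (comm x y) z \<in> \<pi> t" if "z \<in> bd s" "comm x y \<in> \<pi> t" for x z
    using comm_lbd_filter[OF _ _ s] that layer_subset_lbd boundary_subset by blast
qed

lemma group_layer_quotient: "group (lq s)"
proof (cases "s = 0")
  case True
  have "group (singleton_group {\<one>})"
    by (rule groupI) (auto simp: singleton_group_def)
  then show ?thesis using True by (simp add: layer_quotient_def)
next
  case False
  interpret abelian_section G "lbd s" "\<pi> s" by (rule layer_section[OF False])
  show ?thesis using Sec.is_group by (simp add: layer_quotient_nonzero[OF False])
qed

lemma layer_component_eq: "lc s = hom_group (lq s) (add_monoid Q)"
  by (simp add: layer_component_def hom_group_def)

lemma comm_group_Q: "comm_group (add_monoid Q)"
  using Q.a_comm_group .

sublocale Vsum: comm_group_family "layer_component G Q \<pi>"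
  unfolding layer_component_eq
  by (intro comm_group_family.intro comm_group_hom_group group_layer_quotient comm_group_Q)

lemma carrier_lq: "s \<noteq> 0 \<Longrightarrow> carrier (lq s) = (\<lambda>y. \<pi> s #> y) ` lbd s"
  using abelian_section.carrier_Sec[OF layer_section] by (simp add: layer_quotient_nonzero)

lemma lc_zero:
  assumes "f \<in> carrier (lc 0)"
  shows "f = \<one>\<^bsub>lc 0\<^esub>"
proof -
  have f: "f \<in> hom (lq 0) (add_monoid Q)" "f \<in> extensional (carrier (lq 0))"
    using assms by (simp_all add: layer_component_def)
  have "f \<one>\<^bsub>lq 0\<^esub> = \<zero>\<^bsub>Q\<^esub>"
    using hom_one[OF f(1) group_layer_quotient] comm_group.axioms(2)[OF comm_group_Q] by simp
  moreover have "carrier (lq 0) = {\<one>\<^bsub>lq 0\<^esub>}"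
    by (simp add: layer_quotient_def singleton_group_def)
  ultimately show ?thesis
    using f(2) by (auto simp: layer_component_def extensional_def fun_eq_iff)
qed

text \<open>
  In degree \<open>0\<close> there is only one element, so no values need to be compared there.
\<close>

lemma lc_eqI:
  assumes "f \<in> carrier (lc s)" "g \<in> carrier (lc s)"
    and "\<And>y. s \<noteq> 0 \<Longrightarrow> y \<in> lbd s \<Longrightarrow> f (\<pi> s #> y) = g (\<pi> s #> y)"
  shows "f = g"
proof (cases "s = 0")
  case True
  then show ?thesis using lc_zero assms by metis
next
  case False
  show ?thesis
  proof
    fix c
    show "f c = g c"
    proof (cases "c \<in> carrier (lq s)")
      case True
      then show ?thesis using assms(3) carrier_lq[OF False] False by auto
    next
      case False
      then show ?thesis using assms(1,2) by (simp add: layer_component_def extensional_def)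
    qed
  qed
qed

lemma lc_value_closed: "s \<noteq> 0 \<Longrightarrow> f \<in> carrier (lc s) \<Longrightarrow> y \<in> lbd s \<Longrightarrow> f (\<pi> s #> y) \<in> carrier Q"
  using carrier_lq by (auto simp: layer_component_def hom_def Pi_iff)

lemma lc_mult_apply: "s \<noteq> 0 \<Longrightarrow> y \<in> lbd s \<Longrightarrow> (f \<otimes>\<^bsub>lc s\<^esub> g) (\<pi> s #> y) = f (\<pi> s #> y) \<oplus>\<^bsub>Q\<^esub> g (\<pi> s #> y)"
  using carrier_lq by (auto simp: layer_component_def)

lemma lc_one_apply: "s \<noteq> 0 \<Longrightarrow> y \<in> lbd s \<Longrightarrow> \<one>\<^bsub>lc s\<^esub> (\<pi> s #> y) = \<zero>\<^bsub>Q\<^esub>"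
  using carrier_lq by (auto simp: layer_component_def)

lemma lc_hom: "f \<in> carrier (lc s) \<Longrightarrow> f \<in> hom (lq s) (add_monoid Q)"
  by (simp add: layer_component_def)

lemma neg_smult_hom: "r \<in> carrier R \<Longrightarrow> (\<lambda>v. \<ominus>\<^bsub>Q\<^esub> (r \<odot>\<^bsub>Q\<^esub> v)) \<in> hom (add_monoid Q) (add_monoid Q)"
  by (rule homI) (simp_all add: Q.smult_r_distr Q.minus_add)

section \<open>The action\<close>

text \<open>
  The formula for \<open>A f\<close> is composition with the descended map \<open>y \<mapsto> [x, y]\<close> on one side and
  with \<open>v \<mapsto> - r v\<close> on the other.
\<close>

lemma ex_component_action:
  assumes s: "s \<noteq> 0" and x: "x \<in> \<phi> s" and r: "r \<in> carrier R"
  shows "\<exists>A. A \<in> hom (lc t) (lc (s + t)) \<and> (t \<noteq> 0 \<longrightarrow> s + t \<noteq> 0 \<longrightarrow>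
    (\<forall>f. \<forall>y\<in>lbd (s + t). A f (\<pi> (s + t) #> y) = \<ominus>\<^bsub>Q\<^esub> (r \<odot>\<^bsub>Q\<^esub> f (\<pi> t #> comm x y))))"
proof (cases "t \<noteq> 0 \<and> s + t \<noteq> 0")
  case False
  have "(\<lambda>_. \<one>\<^bsub>lc (s + t)\<^esub>) \<in> hom (lc t) (lc (s + t))"
    by (simp add: hom_def)
  then show ?thesis using False by blast
next
  case True
  then have t: "t \<noteq> 0" and st: "s + t \<noteq> 0" by auto
  interpret abelian_section G "lbd (s + t)" "\<pi> (s + t)" by (rule layer_section[OF st])
  obtain d where d: "d \<in> hom Sec (lq t)" "\<And>y. y \<in> lbd (s + t) \<Longrightarrow> d (\<pi> (s + t) #> y) = \<pi> t #> comm x y"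
  proof (rule quot_lift[OF group_layer_quotient comm_hom_right[OF s t x]])
    show "\<pi> t #> comm x y = \<one>\<^bsub>lq t\<^esub>" if "y \<in> \<pi> (s + t)" for y
      by (rule layer_cls_trivial[OF t comm_filter_layer[OF x that]])
  qed blast
  let ?A = "\<lambda>f. \<lambda>Y\<in>carrier (lq (s + t)). \<ominus>\<^bsub>Q\<^esub> (r \<odot>\<^bsub>Q\<^esub> f (d Y))"
  have "?A \<in> hom (lc t) (lc (s + t))"
    unfolding layer_component_eq
    by (rule hom_group_map[OF group_layer_quotient comm_group.axioms(2)[OF comm_group_Q] _ neg_smult_hom[OF r]])
      (use d(1) st in \<open>simp add: layer_quotient_nonzero\<close>)
  moreover have "?A f (\<pi> (s + t) #> y) = \<ominus>\<^bsub>Q\<^esub> (r \<odot>\<^bsub>Q\<^esub> f (\<pi> t #> comm x y))" if "y \<in> lbd (s + t)" for f y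
    using that d(2) carrier_lq[OF st] by auto
  ultimately show ?thesis by (intro exI[of _ ?A]) blast
qed

definition layer_gens where "layer_gens = {linj t f | t f. f \<in> carrier (lc t)}"

text \<open>
  The component actions are added up over the degrees of the module, and the resulting endomorphisms
  are extended from generators to the graded ring. In degree \<open>0\<close> of the module both sides of the
  relations are trivial; elsewhere they are compared on classes.
\<close>

lemma ex_action: "\<exists>act. is_layer_action G R Q \<phi> \<pi> act"
proof -
  have "\<forall>s x r t. \<exists>A. s \<noteq> 0 \<and> x \<in> \<phi> s \<and> r \<in> carrier R \<longrightarrow> A \<in> hom (lc t) (lc (s + t)) \<and> (t \<noteq> 0 \<longrightarrow> s + t \<noteq> 0 \<longrightarrow>
    (\<forall>f. \<forall>y\<in>lbd (s + t). A f (\<pi> (s + t) #> y) = \<ominus>\<^bsub>Q\<^esub> (r \<odot>\<^bsub>Q\<^esub> f (\<pi> t #> comm x y))))"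
    using ex_component_action by blast
  then obtain A where A: "\<And>s x r t. s \<noteq> 0 \<Longrightarrow> x \<in> \<phi> s \<Longrightarrow> r \<in> carrier R \<Longrightarrow> A s x r t \<in> hom (lc t) (lc (s + t))"
    "\<And>s x r t f y. \<lbrakk>s \<noteq> 0; x \<in> \<phi> s; r \<in> carrier R; t \<noteq> 0; s + t \<noteq> 0; y \<in> lbd (s + t)\<rbrakk> \<Longrightarrow>
      A s x r t f (\<pi> (s + t) #> y) = \<ominus>\<^bsub>Q\<^esub> (r \<odot>\<^bsub>Q\<^esub> f (\<pi> t #> comm x y))"
    by metis
  have A_closed: "A s x r t f \<in> carrier (lc (s + t))"
    if "s \<noteq> 0" "x \<in> \<phi> s" "r \<in> carrier R" "f \<in> carrier (lc t)" for s x r t f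
    using hom_in_carrier[OF A(1)] that by blast
  have A_zero: "A s x r 0 f = \<one>\<^bsub>lc (s + 0)\<^esub>"
    if "s \<noteq> 0" "x \<in> \<phi> s" "r \<in> carrier R" "f \<in> carrier (lc 0)" for s x r f
    using lc_zero[OF that(4)] hom_one[OF A(1)[OF that(1-3)] Vsum.group_component Vsum.group_component] by simp
  have "\<forall>s x r. \<exists>k. s \<noteq> 0 \<and> x \<in> \<phi> s \<and> r \<in> carrier R \<longrightarrow> k \<in> hom V V \<and>
    (\<forall>t. \<forall>f\<in>carrier (lc t). k (linj t f) = linj (s + t) (A s x r t f))"
  proof (intro allI)
    fix s x r
    show "\<exists>k. s \<noteq> 0 \<and> x \<in> \<phi> s \<and> r \<in> carrier R \<longrightarrow> k \<in> hom V V \<and>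
      (\<forall>t. \<forall>f\<in>carrier (lc t). k (linj t f) = linj (s + t) (A s x r t f))"
    proof (cases "s \<noteq> 0 \<and> x \<in> \<phi> s \<and> r \<in> carrier R")
      case True
      then have comp: "(\<lambda>f. linj (s + t) (A s x r t f)) \<in> hom (lc t) V" for t
        using Group.hom_compose[OF A(1) Vsum.sum_inj_hom] by (simp add: comp_def)
      show ?thesis by (rule Vsum.sum_lift[OF Vsum.comm_group_S comp]) blast
    qed blast
  qed
  then obtain N where N: "\<And>s x r. s \<noteq> 0 \<Longrightarrow> x \<in> \<phi> s \<Longrightarrow> r \<in> carrier R \<Longrightarrow> N s x r \<in> hom V V"
    "\<And>s x r t f. s \<noteq> 0 \<Longrightarrow> x \<in> \<phi> s \<Longrightarrow> r \<in> carrier R \<Longrightarrow> f \<in> carrier (lc t) \<Longrightarrow>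
      N s x r (linj t f) = linj (s + t) (A s x r t f)"
    by metis
  have mult: "N s (x \<otimes> x') r v = N s x r v \<otimes>\<^bsub>V\<^esub> N s x' r v"
    if *: "s \<noteq> 0" "x \<in> \<phi> s" "x' \<in> \<phi> s" "r \<in> carrier R" "v \<in> layer_gens" for s x x' r v
  proof -
    obtain t f where f: "f \<in> carrier (lc t)" "v = linj t f" using *(5) unfolding layer_gens_def by blast
    have "A s (x \<otimes> x') r t f = A s x r t f \<otimes>\<^bsub>lc (s + t)\<^esub> A s x' r t f"
    proof (cases "t = 0")
      case True
      then show ?thesis using A_zero * f fil.m_closed by simp
    next
      case False
      show ?thesis
      proof (rule lc_eqI)
        fix y assume st: "s + t \<noteq> 0" and y: "y \<in> lbd (s + t)"
        have "\<pi> t #> comm (x \<otimes> x') y = (\<pi> t #> comm x y) \<otimes>\<^bsub>lq t\<^esub> (\<pi> t #> comm x' y)"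
          using hom_mult[OF comm_hom_left[OF *(1) False y], of x x'] * by simp
        moreover have "\<pi> t #> comm x y \<in> carrier (lq t)" "\<pi> t #> comm x' y \<in> carrier (lq t)"
          using hom_in_carrier[OF comm_hom_left[OF *(1) False y]] * by auto
        ultimately have "f (\<pi> t #> comm (x \<otimes> x') y) = f (\<pi> t #> comm x y) \<oplus>\<^bsub>Q\<^esub> f (\<pi> t #> comm x' y)"
          using hom_mult[OF lc_hom[OF f(1)]] by simp
        then show "A s (x \<otimes> x') r t f (\<pi> (s + t) #> y) = (A s x r t f \<otimes>\<^bsub>lc (s + t)\<^esub> A s x' r t f) (\<pi> (s + t) #> y)"
          using * st y False f lc_value_closed[OF False f(1)] comm_filter_lbd[OF _ y]
          by (simp add: lc_mult_apply A(2) fil.m_closed Q.smult_r_distr Q.minus_add)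
      qed (use * f A_closed Vsum.component.m_closed fil.m_closed in auto)
    qed
    then show ?thesis using * f A_closed fil.m_closed by (simp add: N(2) del: mult_sum_group)
  qed
  have bdry: "N s x r v = \<one>\<^bsub>V\<^esub>"
    if *: "s \<noteq> 0" "x \<in> bd s" "r \<in> carrier R" "v \<in> layer_gens" for s x r v
  proof -
    obtain t f where f: "f \<in> carrier (lc t)" "v = linj t f" using *(4) unfolding layer_gens_def by blast
    have x: "x \<in> \<phi> s" using * boundary_subset by blast
    have "A s x r t f = \<one>\<^bsub>lc (s + t)\<^esub>"
    proof (cases "t = 0")
      case True
      then show ?thesis using A_zero x * f by simp
    next
      case False
      show ?thesis
      proof (rule lc_eqI)
        fix y assume st: "s + t \<noteq> 0" and y: "y \<in> lbd (s + t)"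
        have "f (\<pi> t #> comm x y) = \<zero>\<^bsub>Q\<^esub>"
          using layer_cls_trivial[OF False comm_boundary_layer[OF *(1,2) y]]
            hom_one[OF lc_hom[OF f(1)] group_layer_quotient comm_group.axioms(2)[OF comm_group_Q]] by simp
        then show "A s x r t f (\<pi> (s + t) #> y) = \<one>\<^bsub>lc (s + t)\<^esub> (\<pi> (s + t) #> y)"
          using * x st y False by (simp add: lc_one_apply A(2))
      qed (use * x f A_closed in auto)
    qed
    then show ?thesis using * x f by (simp add: N(2) del: one_sum_group)
  qed
  have add: "N s x (r \<oplus>\<^bsub>R\<^esub> r') v = N s x r v \<otimes>\<^bsub>V\<^esub> N s x r' v"
    if *: "s \<noteq> 0" "x \<in> \<phi> s" "r \<in> carrier R" "r' \<in> carrier R" "v \<in> layer_gens" for s x r r' v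
  proof -
    obtain t f where f: "f \<in> carrier (lc t)" "v = linj t f" using *(5) unfolding layer_gens_def by blast
    have "A s x (r \<oplus>\<^bsub>R\<^esub> r') t f = A s x r t f \<otimes>\<^bsub>lc (s + t)\<^esub> A s x r' t f"
    proof (cases "t = 0")
      case True
      then show ?thesis using A_zero * f by simp
    next
      case False
      show ?thesis
      proof (rule lc_eqI)
        fix y assume st: "s + t \<noteq> 0" and y: "y \<in> lbd (s + t)"
        show "A s x (r \<oplus>\<^bsub>R\<^esub> r') t f (\<pi> (s + t) #> y) = (A s x r t f \<otimes>\<^bsub>lc (s + t)\<^esub> A s x r' t f) (\<pi> (s + t) #> y)"
          using * st y False f lc_value_closed[OF False f(1)] comm_filter_lbd[OF *(2) y]
          by (simp add: lc_mult_apply A(2) Q.smult_l_distr Q.minus_add)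
      qed (use * f A_closed Vsum.component.m_closed in auto)
    qed
    then show ?thesis using * f A_closed by (simp add: N(2) del: mult_sum_group)
  qed
  have gen_V: "carrier V = generate V layer_gens"
    using Vsum.S_generated by (simp add: layer_gens_def)
  have "\<exists>act. biadditive L V V act \<and> case_prod act \<in> extensional (carrier L \<times> carrier V) \<and>
    (\<forall>s x r v. s \<noteq> 0 \<longrightarrow> x \<in> \<phi> s \<longrightarrow> r \<in> carrier R \<longrightarrow> v \<in> carrier V \<longrightarrow> act (gen s x r) v = N s x r v)"
    by (rule biadditive_lift[OF Vsum.S.is_group gen_V Vsum.comm_group_S]) (fact N(1) mult bdry add)+
  then obtain act where act: "biadditive L V V act" "case_prod act \<in> extensional (carrier L \<times> carrier V)"
    "\<forall>s x r v. s \<noteq> 0 \<longrightarrow> x \<in> \<phi> s \<longrightarrow> r \<in> carrier R \<longrightarrow> v \<in> carrier V \<longrightarrow> act (gen s x r) v = N s x r v"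
    by (elim exE conjE)
  have "is_layer_action G R Q \<phi> \<pi> act"
    unfolding is_layer_action_def
  proof (intro conjI allI impI ballI act(1,2))
    fix s t x r f
    assume *: "s \<noteq> 0" "t \<noteq> 0" "x \<in> \<phi> s" "r \<in> carrier R" "f \<in> carrier (lc t)"
    show "\<exists>h\<in>carrier (lc (s + t)). act (gen s x r) (linj t f) = linj (s + t) h \<and>
      (s + t \<noteq> 0 \<longrightarrow> (\<forall>y\<in>lbd (s + t). h (\<pi> (s + t) #> y) = \<ominus>\<^bsub>Q\<^esub> (r \<odot>\<^bsub>Q\<^esub> f (\<pi> t #> comm x y))))"
      using * A_closed A(2) N(2) act(3) Vsum.inj.hom_closed[of f t] by (intro bexI[of _ "A s x r t f"]) auto
  qed
  then show ?thesis by blast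
qed


lemma V_generated: "carrier V = generate V layer_gens"
  using Vsum.S_generated by (simp add: layer_gens_def)

lemma layer_gens_in_V: "layer_gens \<subseteq> carrier V"
  using Vsum.inj.hom_closed by (auto simp: layer_gens_def)

lemma linj_zero: "f \<in> carrier (lc 0) \<Longrightarrow> linj 0 f = \<one>\<^bsub>V\<^esub>"
  using lc_zero Vsum.inj.hom_one by metis

lemma is_layer_action_gen:
  assumes act: "is_layer_action G R Q \<phi> \<pi> act"
    and s: "s \<noteq> 0" "x \<in> \<phi> s" "r \<in> carrier R"
    and t: "t \<noteq> 0" "f \<in> carrier (lc t)"
    and h: "h \<in> carrier (lc (s + t))"
      "\<And>y. s + t \<noteq> 0 \<Longrightarrow> y \<in> lbd (s + t) \<Longrightarrow>
        h (\<pi> (s + t) #> y) = \<ominus>\<^bsub>Q\<^esub> (r \<odot>\<^bsub>Q\<^esub> f (\<pi> t #> comm x y))"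
  shows "act (gen s x r) (linj t f) = linj (s + t) h"
proof -
  obtain h' where h': "h' \<in> carrier (lc (s + t))" "act (gen s x r) (linj t f) = linj (s + t) h'"
    "s + t \<noteq> 0 \<longrightarrow> (\<forall>y\<in>lbd (s + t). h' (\<pi> (s + t) #> y) = \<ominus>\<^bsub>Q\<^esub> (r \<odot>\<^bsub>Q\<^esub> f (\<pi> t #> comm x y)))"
    using act s t unfolding is_layer_action_def by blast
  have "h' = h"
    by (rule lc_eqI[OF h'(1) h(1)]) (use h' h in auto)
  then show ?thesis using h' by simp
qed

lemma unique_action:
  assumes "is_layer_action G R Q \<phi> \<pi> act" "is_layer_action G R Q \<phi> \<pi> act'"
  shows "act = act'"
proof (rule extensional_biadditive_eqI[OF Lsum.S.is_group Vsum.S.is_group Vsum.S.is_group _ _ _ _ L_generated V_generated])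
  show bi: "biadditive L V V act" "biadditive L V V act'"
    using assms by (simp_all add: is_layer_action_def)
  fix g v assume g: "g \<in> gens" and v: "v \<in> layer_gens"
  obtain s x r where g': "g = gen s x r" "s \<noteq> 0" "x \<in> \<phi> s" "r \<in> carrier R"
    using g unfolding gens_def by blast
  obtain t f where v': "f \<in> carrier (lc t)" "v = linj t f" using v unfolding layer_gens_def by blast
  show "act g v = act' g v"
  proof (cases "t = 0")
    case True
    then have "v = \<one>\<^bsub>V\<^esub>" using v' linj_zero by simp
    then show ?thesis
      using biadditive_one_right[OF Lsum.S.is_group Vsum.S.is_group Vsum.S.is_group bi(1), of g]
        biadditive_one_right[OF Lsum.S.is_group Vsum.S.is_group Vsum.S.is_group bi(2), of g]
        g gens_in_L by (auto simp del: one_sum_group)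
  next
    case False
    then obtain h where h: "h \<in> carrier (lc (s + t))" "act g v = linj (s + t) h"
      "s + t \<noteq> 0 \<longrightarrow> (\<forall>y\<in>lbd (s + t). h (\<pi> (s + t) #> y) = \<ominus>\<^bsub>Q\<^esub> (r \<odot>\<^bsub>Q\<^esub> f (\<pi> t #> comm x y)))"
      using assms(1) g' v' unfolding is_layer_action_def by blast
    then show ?thesis
      using is_layer_action_gen[OF assms(2) g'(2-4) False v'(1) h(1)] g' v' by simp
  qed
qed (use assms in \<open>auto simp: is_layer_action_def\<close>)

abbreviation "act \<equiv> layer_action G R Q \<phi> \<pi>"

lemma is_layer_action_act: "is_layer_action G R Q \<phi> \<pi> act"
  unfolding layer_action_def
  by (rule theI'[of "is_layer_action G R Q \<phi> \<pi>"]) (use ex_action unique_action in blast)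

lemma act_biadditive: "biadditive L V V act"
  using is_layer_action_act by (simp add: is_layer_action_def)

lemmas act_gen = is_layer_action_gen[OF is_layer_action_act]
lemmas act_one_left = biadditive_one_left[OF Lsum.S.is_group Vsum.S.is_group Vsum.S.is_group act_biadditive]
lemmas act_one_right = biadditive_one_right[OF Lsum.S.is_group Vsum.S.is_group Vsum.S.is_group act_biadditive]

lemma act_closed: "a \<in> carrier L \<Longrightarrow> v \<in> carrier V \<Longrightarrow> act a v \<in> carrier V"
  by (rule biadditive_closed[OF act_biadditive])

lemma act_genE:
  assumes "s \<noteq> 0" "x \<in> \<phi> s" "r \<in> carrier R" "t \<noteq> 0" "f \<in> carrier (lc t)"
  obtains h where "h \<in> carrier (lc (s + t))" "act (gen s x r) (linj t f) = linj (s + t) h"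
    "\<And>y. s + t \<noteq> 0 \<Longrightarrow> y \<in> lbd (s + t) \<Longrightarrow>
      h (\<pi> (s + t) #> y) = \<ominus>\<^bsub>Q\<^esub> (r \<odot>\<^bsub>Q\<^esub> f (\<pi> t #> comm x y))"
proof -
  have "\<exists>h\<in>carrier (lc (s + t)). act (gen s x r) (linj t f) = linj (s + t) h \<and>
    (s + t \<noteq> 0 \<longrightarrow> (\<forall>y\<in>lbd (s + t). h (\<pi> (s + t) #> y) = \<ominus>\<^bsub>Q\<^esub> (r \<odot>\<^bsub>Q\<^esub> f (\<pi> t #> comm x y))))"
    using is_layer_action_act assms unfolding is_layer_action_def by blast
  then show thesis using that by blast
qed

lemma act_graded:
  assumes a: "a \<in> homogeneous (filter_component G R \<phi>) s" and v: "v \<in> homogeneous (layer_component G Q \<pi>) t"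
  shows "act a v \<in> homogeneous (layer_component G Q \<pi>) (s + t)"
proof (rule homogeneous_hom_in_subgroup[OF Vsum.S.is_group _ Vsum.subgroup_homogeneous _ a])
  show "(\<lambda>a. act a v) \<in> hom L V"
    using biadditive_hom_left[OF act_biadditive] Vsum.homogeneous_in_carrier[OF v] .
  fix x r assume s: "s \<noteq> 0" "x \<in> \<phi> s" "r \<in> carrier R"
  obtain f where f: "f \<in> carrier (lc t)" "v = linj t f" using v by (auto simp: homogeneous_def)
  show "act (gen s x r) v \<in> homogeneous (layer_component G Q \<pi>) (s + t)"
  proof (cases "t = 0")
    case True
    then have "act (gen s x r) v = \<one>\<^bsub>V\<^esub>" using f linj_zero act_one_right gen_in_L s by simp
    then show ?thesis using subgroup.one_closed[OF Vsum.subgroup_homogeneous] by simp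
  next
    case False
    obtain h where "h \<in> carrier (lc (s + t))" "act (gen s x r) v = linj (s + t) h"
      using act_genE[OF s False f(1)] f(2) by blast
    then show ?thesis by (auto simp: homogeneous_def)
  qed
qed

section \<open>The module law\<close>

text \<open>
  The Hall--Witt identity for \<open>x\<close>, \<open>y\<close>, \<open>z\<close> in the section of degree \<open>u\<close>. Its three triple commutators
  are, up to inversion of arguments, those in the statement; each inversion is undone by one of the
  homomorphisms \<open>c \<mapsto> [c, z]\<close>, \<open>w \<mapsto> [x, w]\<close> and \<open>w \<mapsto> [y, w]\<close> into the section.
\<close>

lemma cls_comm_comm:
  assumes s: "s \<noteq> 0" "x \<in> \<phi> s" and t: "t \<noteq> 0" "y \<in> \<phi> t" and u: "u \<noteq> 0"
    and st: "s + t \<noteq> 0" and su: "s + u \<noteq> 0" and tu: "t + u \<noteq> 0"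
    and z: "z \<in> lbd (s + (t + u))"
  shows "(\<pi> u #> comm (comm x y) z) \<otimes>\<^bsub>lq u\<^esub> (\<pi> u #> comm y (comm x z)) = \<pi> u #> comm x (comm y z)"
proof -
  interpret abelian_section G "lbd u" "\<pi> u" by (rule layer_section[OF u])
  have Sec: "lq u = Sec" by (rule layer_quotient_nonzero[OF u])
  have carr: "x \<in> carrier G" "y \<in> carrier G" "z \<in> carrier G"
    using s t z fil.mem_carrier layer_bd.mem_carrier by auto
  have z': "z \<in> lbd ((s + t) + u)" "z \<in> lbd (t + (s + u))" using z by (simp_all add: ac_simps)
  have xi: "inv x \<in> \<phi> s" "inv y \<in> \<phi> t" "inv z \<in> lbd (s + (t + u))" "inv z \<in> lbd (t + (s + u))"
    using s t z z' by (auto intro: fil.m_inv_closed layer_bd.m_inv_closed)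
  have z_layer: "z \<in> \<pi> (s + t + u + s)" using lbd_subset_layer[OF s(1)] z'(1) by blast
  \<comment> \<open>Replacing \<open>y\<close>, \<open>z\<close> or \<open>x\<close> by its inverse in an inner commutator changes the sign of the class.\<close>
  interpret k: group_hom "G\<lparr>carrier := \<phi> (s + t)\<rparr>" Sec "\<lambda>c. \<pi> u #> comm c z"
    using comm_hom_left[OF st u z'(1)] subgroup_imp_group[OF subgroup_filter]
    by (intro group_hom.intro group_hom_axioms.intro Sec.is_group) (simp_all add: Sec)
  have c: "comm x y \<in> \<phi> (s + t)" "comm x (inv y) \<in> \<phi> (s + t)"
    using comm_in_filter s t xi by auto
  have cy: "comm (comm x (inv y)) y \<in> bd (s + t)"
    using in_boundary[OF t(1) comm_in_filter[OF c(2) t(2)]] .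
  have first: "\<pi> u #> comm (comm x (inv y)) z = inv\<^bsub>Sec\<^esub> (\<pi> u #> comm (comm x y) z)"
    by (rule k.hom_eq_inv_if_trivial_product[where e = "comm (comm x (inv y)) y"])
      (use c cy boundary_subset cls_trivial comm_boundary_layer[OF st cy z'(1)] comm_inv_right carr in auto)
  interpret p: group_hom "G\<lparr>carrier := lbd (s + u)\<rparr>" Sec "\<lambda>w. \<pi> u #> comm x w"
    using comm_hom_right[OF s(1) u s(2)] subgroup_imp_group[OF subgroup_lbd]
    by (intro group_hom.intro group_hom_axioms.intro Sec.is_group) (simp_all add: Sec)
  have d: "comm y z \<in> lbd (s + u)" "comm y (inv z) \<in> lbd (s + u)"
    using comm_filter_lbd[OF t(2)] z'(2) xi by auto
  have dz: "comm (comm y (inv z)) z \<in> \<pi> (s + u)"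
    using comm_lbd_layer[OF d(2) z_layer] .
  have second: "\<pi> u #> comm x (comm y (inv z)) = inv\<^bsub>Sec\<^esub> (\<pi> u #> comm x (comm y z))"
    by (rule p.hom_eq_inv_if_trivial_product[where e = "comm (comm y (inv z)) z"])
      (use d dz layer_subset_lbd cls_trivial comm_filter_layer[OF s(2) dz] comm_inv_right carr in auto)
  interpret q: group_hom "G\<lparr>carrier := lbd (t + u)\<rparr>" Sec "\<lambda>w. \<pi> u #> comm y w"
    using comm_hom_right[OF t(1) u t(2)] subgroup_imp_group[OF subgroup_lbd]
    by (intro group_hom.intro group_hom_axioms.intro Sec.is_group) (simp_all add: Sec)
  have e: "comm x z \<in> lbd (t + u)" "comm (inv x) z \<in> lbd (t + u)"
    using comm_filter_lbd[OF _ z] s(2) xi by auto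
  have ex: "comm (comm x z) (inv x) \<in> \<pi> (t + u)"
    using comm_lbd_filter[OF e(1) xi(1) s(1)] .
  have third: "\<pi> u #> comm y (comm (inv x) z) = inv\<^bsub>Sec\<^esub> (\<pi> u #> comm y (comm x z))"
    by (rule q.hom_eq_inv_if_trivial_product[where e = "comm (comm x z) (inv x)"])
      (use e ex layer_subset_lbd cls_trivial comm_filter_layer[OF t(2) ex] comm_inv_left carr in auto)
  let ?A = "comm (comm x (inv y)) z" and ?B = "comm (comm y (inv z)) x" and ?C = "comm (comm z (inv x)) y"
  have B: "?B = inv (comm x (comm y (inv z)))" using carr by (simp add: inv_comm)
  have C: "?C = inv (comm y (inv (comm (inv x) z)))" using carr by (simp add: inv_comm)
  have in_top: "?A \<in> lbd u" "comm x (comm y (inv z)) \<in> lbd u" "comm y (inv (comm (inv x) z)) \<in> lbd u"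
    using comm_filter_lbd[OF c(2) z'(1)] comm_filter_lbd[OF s(2) d(2)]
      comm_filter_lbd[OF t(2) layer_bd.m_inv_closed[OF e(2)]] by auto
  then have in_top': "?B \<in> lbd u" "?C \<in> lbd u" unfolding B C by (auto intro: layer_bd.m_inv_closed)
  have hw: "(\<pi> u #> ?A) \<otimes>\<^bsub>Sec\<^esub> (\<pi> u #> ?B) \<otimes>\<^bsub>Sec\<^esub> (\<pi> u #> ?C) = \<one>\<^bsub>Sec\<^esub>"
  proof (rule cls_hall_witt)
    show "comm ?B z \<in> \<pi> u"
      using comm_lbd_layer[OF in_top'(1), of z "s + t + u + s"] z_layer .
  qed (use carr in_top in_top' comm_lbd_filter s t in auto)
  have "\<pi> u #> ?B = \<pi> u #> comm x (comm y z)"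
    unfolding B using second in_top p.hom_closed[of "comm y z"] d
    by (simp add: cls_inv del: mult_FactGroup one_FactGroup)
  moreover have "\<pi> u #> ?C = inv\<^bsub>Sec\<^esub> (\<pi> u #> comm y (comm x z))"
    unfolding C using third in_top q.hom_inv[of "comm (inv x) z"] q.hom_closed[of "comm (inv x) z"] e
    by (simp add: cls_inv m_inv_consistent[OF subgroup_lbd] del: mult_FactGroup one_FactGroup)
  ultimately have "inv\<^bsub>Sec\<^esub> (\<pi> u #> comm (comm x y) z) \<otimes>\<^bsub>Sec\<^esub> (\<pi> u #> comm x (comm y z))
      \<otimes>\<^bsub>Sec\<^esub> inv\<^bsub>Sec\<^esub> (\<pi> u #> comm y (comm x z)) = \<one>\<^bsub>Sec\<^esub>"
    using hw first by simp
  then show ?thesis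
    using k.hom_closed[of "comm x y"] p.hom_closed[of "comm y z"] q.hom_closed[of "comm x z"] c d e
    unfolding Sec
    by (simp add: Sec.inv_solve_right' Sec.inv_solve_left' Sec.m_assoc del: mult_FactGroup one_FactGroup)
qed


text \<open>
  Each action contributes a sign and a commutator on the inside, so acting with \<open>h\<close> and then with \<open>g\<close>
  evaluates \<open>f\<close> at \<open>[y, [x, z]]\<close> without a sign. The left-hand side has the one sign of \<open>[[x, y], z]\<close>, and
  \<open>f\<close> is additive on the relation between the three classes.
\<close>

lemma act_lie_gen:
  assumes g: "g \<in> gens" and h: "h \<in> gens" and v: "v \<in> layer_gens"
  shows "act (lie g h) v = act g (act h v) \<otimes>\<^bsub>V\<^esub> inv\<^bsub>V\<^esub> act h (act g v)"
proof -
  obtain s x r where g': "g = gen s x r" "s \<noteq> 0" "x \<in> \<phi> s" "r \<in> carrier R"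
    using g unfolding gens_def by blast
  obtain t y r' where h': "h = gen t y r'" "t \<noteq> 0" "y \<in> \<phi> t" "r' \<in> carrier R"
    using h unfolding gens_def by blast
  obtain u f where f: "f \<in> carrier (lc u)" "v = linj u f" using v unfolding layer_gens_def by blast
  have c: "g \<in> carrier L" "h \<in> carrier L" "v \<in> carrier V" using g h v gens_in_L layer_gens_in_V by auto
  have cancel: "\<one>\<^bsub>V\<^esub> = \<one>\<^bsub>V\<^esub> \<otimes>\<^bsub>V\<^esub> inv\<^bsub>V\<^esub> \<one>\<^bsub>V\<^esub>"
    using Vsum.S.r_inv[OF Vsum.S.one_closed] by (simp only:)
  consider "\<exists>v w :: 'm. v + w = 0 \<and> v \<noteq> 0" | "u = 0" | "u \<noteq> 0" "\<And>v w :: 'm. v \<noteq> 0 \<Longrightarrow> v + w \<noteq> 0"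
    by blast
  then show ?thesis
  proof cases
    case 1
    then have "carrier L = {\<one>\<^bsub>L\<^esub>}" using L_trivial by blast
    then have "act a w = \<one>\<^bsub>V\<^esub>" if "a \<in> carrier L" "w \<in> carrier V" for a w
      using act_one_left[OF that(2)] that(1) by (simp del: one_sum_group)
    then show ?thesis using cancel c lie_closed act_closed by (simp only:)
  next
    case 2
    then have "v = \<one>\<^bsub>V\<^esub>" using f linj_zero by simp
    then show ?thesis using cancel c lie_closed act_one_right by (simp only:)
  next
    case 3
    note u = 3(1) and nz = 3(2)
    have nzs: "s + t \<noteq> 0" "s + u \<noteq> 0" "t + u \<noteq> 0" "s + t + u \<noteq> 0" "s + (t + u) \<noteq> 0" "t + (s + u) \<noteq> 0"
      using nz g'(2) h'(2) by auto
    obtain k1 where k1: "k1 \<in> carrier (lc (s + t + u))" "act (lie g h) v = linj (s + t + u) k1"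
      "\<And>z. z \<in> lbd (s + t + u) \<Longrightarrow> k1 (\<pi> (s + t + u) #> z) =
        \<ominus>\<^bsub>Q\<^esub> (r \<otimes>\<^bsub>R\<^esub> r' \<odot>\<^bsub>Q\<^esub> f (\<pi> u #> comm (comm x y) z))"
      using act_genE[OF nzs(1) comm_in_filter[OF g'(3) h'(3)] R.m_closed[OF g'(4) h'(4)] u f(1)]
        g' h' f nzs by (metis lie_gen)
    obtain h2 where h2: "h2 \<in> carrier (lc (t + u))" "act h v = linj (t + u) h2"
      "\<And>w. w \<in> lbd (t + u) \<Longrightarrow> h2 (\<pi> (t + u) #> w) = \<ominus>\<^bsub>Q\<^esub> (r' \<odot>\<^bsub>Q\<^esub> f (\<pi> u #> comm y w))"
      using act_genE[OF h'(2-4) u f(1)] h' f nzs by metis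
    obtain k2 where k2: "k2 \<in> carrier (lc (s + (t + u)))" "act g (act h v) = linj (s + (t + u)) k2"
      "\<And>z. z \<in> lbd (s + (t + u)) \<Longrightarrow> k2 (\<pi> (s + (t + u)) #> z) = \<ominus>\<^bsub>Q\<^esub> (r \<odot>\<^bsub>Q\<^esub> h2 (\<pi> (t + u) #> comm x z))"
      using act_genE[OF g'(2-4) nzs(3) h2(1)] g' h2(2) nzs by metis
    obtain h3 where h3: "h3 \<in> carrier (lc (s + u))" "act g v = linj (s + u) h3"
      "\<And>w. w \<in> lbd (s + u) \<Longrightarrow> h3 (\<pi> (s + u) #> w) = \<ominus>\<^bsub>Q\<^esub> (r \<odot>\<^bsub>Q\<^esub> f (\<pi> u #> comm x w))"
      using act_genE[OF g'(2-4) u f(1)] g' f nzs by metis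
    obtain k3 where k3: "k3 \<in> carrier (lc (t + (s + u)))" "act h (act g v) = linj (t + (s + u)) k3"
      "\<And>z. z \<in> lbd (t + (s + u)) \<Longrightarrow> k3 (\<pi> (t + (s + u)) #> z) = \<ominus>\<^bsub>Q\<^esub> (r' \<odot>\<^bsub>Q\<^esub> h3 (\<pi> (s + u) #> comm y z))"
      using act_genE[OF h'(2-4) nzs(2) h3(1)] h' h3(2) nzs by metis
    let ?d = "s + t + u"
    have d: "s + (t + u) = ?d" "t + (s + u) = ?d" by (simp_all add: ac_simps)
    note k2 = k2[unfolded d] and k3 = k3[unfolded d]
    have "k2 = k1 \<otimes>\<^bsub>lc ?d\<^esub> k3"
    proof (rule lc_eqI)
      fix z assume z: "z \<in> lbd ?d"
      have xz: "comm x z \<in> lbd (t + u)" and yz: "comm y z \<in> lbd (s + u)"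
        using comm_filter_lbd[OF g'(3)] comm_filter_lbd[OF h'(3)] z d by auto
      have tops: "comm (comm x y) z \<in> lbd u" "comm y (comm x z) \<in> lbd u" "comm x (comm y z) \<in> lbd u"
        using comm_filter_lbd[OF comm_in_filter[OF g'(3) h'(3)] z] comm_filter_lbd[OF h'(3) xz]
          comm_filter_lbd[OF g'(3) yz] by auto
      let ?a = "f (\<pi> u #> comm (comm x y) z)" and ?b = "f (\<pi> u #> comm y (comm x z))"
        and ?c = "f (\<pi> u #> comm x (comm y z))"
      have Q: "?a \<in> carrier Q" "?b \<in> carrier Q" "?c \<in> carrier Q"
        using lc_value_closed[OF u f(1)] tops by auto
      have lq: "\<pi> u #> comm (comm x y) z \<in> carrier (lq u)" "\<pi> u #> comm y (comm x z) \<in> carrier (lq u)"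
        using tops carrier_lq[OF u] by auto
      have c: "?c = ?a \<oplus>\<^bsub>Q\<^esub> ?b"
        using cls_comm_comm[OF g'(2,3) h'(2,3) u nzs(1-3), of z] z d hom_mult[OF lc_hom[OF f(1)] lq] by simp
      have k1z: "k1 (\<pi> ?d #> z) = \<ominus>\<^bsub>Q\<^esub> (r \<otimes>\<^bsub>R\<^esub> r' \<odot>\<^bsub>Q\<^esub> ?a)" using k1(3) z by simp
      have k2z: "k2 (\<pi> ?d #> z) = r \<otimes>\<^bsub>R\<^esub> r' \<odot>\<^bsub>Q\<^esub> ?b"
        using k2(3)[OF z] h2(3)[OF xz] g' h' Q by (simp add: Q.smult_r_minus Q.smult_assoc1)
      have k3z: "k3 (\<pi> ?d #> z) = r \<otimes>\<^bsub>R\<^esub> r' \<odot>\<^bsub>Q\<^esub> ?c"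
        using k3(3)[OF z] h3(3)[OF yz] g' h' Q R.m_comm[of r r']
        by (simp add: Q.smult_r_minus Q.smult_assoc1)
      show "k2 (\<pi> ?d #> z) = (k1 \<otimes>\<^bsub>lc ?d\<^esub> k3) (\<pi> ?d #> z)"
        unfolding lc_mult_apply[OF nzs(4) z] k1z k2z k3z c
        using g' h' Q by (simp add: Q.smult_r_distr Q.r_neg1 R.m_closed)
    qed (use k1 k2 k3 Vsum.component.m_closed in auto)
    then have "act g (act h v) = act (lie g h) v \<otimes>\<^bsub>V\<^esub> act h (act g v)"
      using k1 k2 k3 Vsum.inj.hom_mult[of k1 ?d k3] by (simp del: mult_sum_group)
    then show ?thesis
      using c lie_closed act_closed Vsum.S.inv_solve_right[of "act (lie g h) v" "act g (act h v)" "act h (act g v)"]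
      by (simp del: mult_sum_group inv_sum_group)
  qed
qed

text \<open>
  All terms are additive in \<open>a\<close>, \<open>b\<close> and \<open>v\<close>, so the arguments are freed from generators one at a time.
\<close>

lemma act_lie:
  assumes a: "a \<in> carrier L" and b: "b \<in> carrier L" and v: "v \<in> carrier V"
  shows "act (lie a b) v = act a (act b v) \<otimes>\<^bsub>V\<^esub> inv\<^bsub>V\<^esub> act b (act a v)"
proof -
  note left = biadditive_hom_left[OF act_biadditive] and right = biadditive_hom_right[OF act_biadditive]
  note inv_comp = Group.hom_compose[OF _ Vsum.S.inv_in_hom, unfolded comp_def]
  have 1: "act (lie g h) v = act g (act h v) \<otimes>\<^bsub>V\<^esub> inv\<^bsub>V\<^esub> act h (act g v)"
    if g: "g \<in> gens" "h \<in> gens" and v: "v \<in> carrier V" for g h v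
  proof (rule hom_eq_on_generators[OF Vsum.S.is_group Vsum.S.is_group _ _ V_generated _ v])
    have c: "g \<in> carrier L" "h \<in> carrier L" using g gens_in_L by auto
    show "act (lie g h) \<in> hom V V" by (rule right[OF lie_closed[OF c]])
    show "(\<lambda>v. act g (act h v) \<otimes>\<^bsub>V\<^esub> inv\<^bsub>V\<^esub> act h (act g v)) \<in> hom V V"
      using Group.hom_compose[OF right[OF c(2)] right[OF c(1)]] Group.hom_compose[OF right[OF c(1)] right[OF c(2)]]
      by (intro Vsum.S.hom_mult_pointwise inv_comp) (simp_all add: comp_def)
  qed (rule act_lie_gen[OF g])
  have 2: "act (lie a h) v = act a (act h v) \<otimes>\<^bsub>V\<^esub> inv\<^bsub>V\<^esub> act h (act a v)"
    if h: "h \<in> gens" and a: "a \<in> carrier L" and v: "v \<in> carrier V" for a h v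
  proof (rule hom_eq_on_generators[OF Lsum.S.is_group Vsum.S.is_group _ _ L_generated _ a])
    have c: "h \<in> carrier L" using h gens_in_L by auto
    show "(\<lambda>a. act (lie a h) v) \<in> hom L V"
      using Group.hom_compose[OF biadditive_hom_left[OF lie_biadditive c] left[OF v]] by (simp add: comp_def)
    show "(\<lambda>a. act a (act h v) \<otimes>\<^bsub>V\<^esub> inv\<^bsub>V\<^esub> act h (act a v)) \<in> hom L V"
      using left[OF act_closed[OF c v]] Group.hom_compose[OF left[OF v] right[OF c]]
      by (intro Vsum.S.hom_mult_pointwise inv_comp) (simp_all add: comp_def)
  qed (rule 1[OF _ h v])
  show ?thesis
  proof (rule hom_eq_on_generators[OF Lsum.S.is_group Vsum.S.is_group _ _ L_generated _ b])
    show "(\<lambda>b. act (lie a b) v) \<in> hom L V"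
      using Group.hom_compose[OF biadditive_hom_right[OF lie_biadditive a] left[OF v]] by (simp add: comp_def)
    show "(\<lambda>b. act a (act b v) \<otimes>\<^bsub>V\<^esub> inv\<^bsub>V\<^esub> act b (act a v)) \<in> hom L V"
      using left[OF act_closed[OF a v]] Group.hom_compose[OF left[OF v] right[OF a]]
      by (intro Vsum.S.hom_mult_pointwise inv_comp) (simp_all add: comp_def)
  qed (rule 2[OF _ a v])
qed

abbreviation "Vmod \<equiv> layer_module G Q \<pi>"

lemma Vmod_simps:
  shows carrier_Vmod: "carrier Vmod = carrier V"
    and add_Vmod: "ring.add Vmod = monoid.mult V"
    and zero_Vmod: "ring.zero Vmod = \<one>\<^bsub>V\<^esub>"
  by (simp_all add: layer_module_def)

lemmas hom_Vmod_dom = hom_add_monoid_dom[OF carrier_Vmod add_Vmod]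
lemmas hom_Vmod_cod = hom_add_monoid_cod[OF carrier_Vmod add_Vmod]

lemma graded_lie_module_act:
  "graded_lie_module Lie (homogeneous (filter_component G R \<phi>)) Vmod (homogeneous (layer_component G Q \<pi>)) act"
proof (intro graded_lie_module.intro graded_lie_module_axioms.intro graded_lie_ring_Lie)
  show "abelian_group Vmod"
    by (rule abelian_group_of_comm_group[OF Vsum.comm_group_S carrier_Vmod add_Vmod zero_Vmod])
  show "internal_direct_sum Vmod (homogeneous (layer_component G Q \<pi>))"
    by (rule Vsum.internal_direct_sum_homogeneous[OF carrier_Vmod add_Vmod zero_Vmod])
  show "biadditive (add_monoid Lie) (add_monoid Vmod) (add_monoid Vmod) act"
    using act_biadditive unfolding biadditive_def hom_Lie_dom hom_Vmod_dom hom_Vmod_cod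
    by (simp add: carrier_Lie carrier_Vmod)
  show "act (a \<otimes>\<^bsub>Lie\<^esub> b) v = act a (act b v) \<ominus>\<^bsub>Vmod\<^esub> act b (act a v)"
    if "a \<in> carrier Lie" "b \<in> carrier Lie" "v \<in> carrier Vmod" for a b v
    using act_lie that
    unfolding a_minus_def a_inv_eq_m_inv[OF carrier_Vmod add_Vmod zero_Vmod] Lie_simps Vmod_simps .
  show "act a v \<in> homogeneous (layer_component G Q \<pi>) (s + t)"
    if "a \<in> homogeneous (filter_component G R \<phi>) s" "v \<in> homogeneous (layer_component G Q \<pi>) t" for a v s t
    using act_graded that .
qed

section \<open>Scalars\<close>

lemma smult_Vmod:
  assumes r: "r \<in> carrier R"
  shows smult_Vmod_hom: "module.smult Vmod r \<in> hom V V"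
    and smult_Vmod_linj: "\<And>t f. module.smult Vmod r (linj t f) = linj t (\<lambda>Y\<in>carrier (lq t). r \<odot>\<^bsub>Q\<^esub> f Y)"
    and smult_lc_closed: "\<And>t f. f \<in> carrier (lc t) \<Longrightarrow> (\<lambda>Y\<in>carrier (lq t). r \<odot>\<^bsub>Q\<^esub> f Y) \<in> carrier (lc t)"
proof -
  let ?h = "\<lambda>s f. \<lambda>Y\<in>carrier (lq s). r \<odot>\<^bsub>Q\<^esub> f Y"
  have q: "(\<lambda>w. r \<odot>\<^bsub>Q\<^esub> w) \<in> hom (add_monoid Q) (add_monoid Q)"
    by (rule homI) (simp_all add: r Q.smult_r_distr)
  have h: "?h s \<in> hom (lc s) (lc s)" for s
  proof -
    have "(\<lambda>Y. Y) \<in> hom (lq s) (lq s)" by (simp add: hom_def)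
    then show ?thesis
      unfolding layer_component_eq
      by (rule hom_group_map[OF group_layer_quotient comm_group.axioms(2)[OF comm_group_Q] _ q])
  qed
  have eq: "module.smult Vmod r = (\<lambda>v s. ?h s (v s))"
    by (simp add: layer_module_def fun_eq_iff)
  show "module.smult Vmod r \<in> hom V V" unfolding eq by (rule Vsum.componentwise_in_hom[OF h])
  show "module.smult Vmod r (linj t f) = linj t (?h t f)" for t f
    unfolding eq by (rule Vsum.componentwise_sum_inj[OF h])
  show "?h t f \<in> carrier (lc t)" if "f \<in> carrier (lc t)" for t f
    by (rule hom_in_carrier[OF h that])
qed

lemma module_Vmod: "module R Vmod"
proof (rule moduleI)
  show "cring R" by (rule R.is_cring)
  show "abelian_group Vmod"
    by (rule abelian_group_of_comm_group[OF Vsum.comm_group_S carrier_Vmod add_Vmod zero_Vmod])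
  show "r \<odot>\<^bsub>Vmod\<^esub> v \<in> carrier Vmod" if "r \<in> carrier R" "v \<in> carrier Vmod" for r v
    using hom_in_carrier[OF smult_Vmod_hom] that by (simp add: carrier_Vmod)
  show "r \<odot>\<^bsub>Vmod\<^esub> (v \<oplus>\<^bsub>Vmod\<^esub> w) = r \<odot>\<^bsub>Vmod\<^esub> v \<oplus>\<^bsub>Vmod\<^esub> r \<odot>\<^bsub>Vmod\<^esub> w"
    if "r \<in> carrier R" "v \<in> carrier Vmod" "w \<in> carrier Vmod" for r v w
    using hom_mult[OF smult_Vmod_hom] that unfolding Vmod_simps .
  have val: "v s Y \<in> carrier Q" if "v \<in> carrier V" "Y \<in> carrier (lq s)" for v s Y
    using hom_in_carrier[OF lc_hom[OF Vsum.component_closed[OF that(1)]] that(2)] by simp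
  show "(r \<oplus>\<^bsub>R\<^esub> r') \<odot>\<^bsub>Vmod\<^esub> v = r \<odot>\<^bsub>Vmod\<^esub> v \<oplus>\<^bsub>Vmod\<^esub> r' \<odot>\<^bsub>Vmod\<^esub> v"
    if "r \<in> carrier R" "r' \<in> carrier R" "v \<in> carrier Vmod" for r r' v
    using that val[of v]
    by (auto simp: layer_module_def layer_component_def fun_eq_iff Q.smult_l_distr)
  show "(r \<otimes>\<^bsub>R\<^esub> r') \<odot>\<^bsub>Vmod\<^esub> v = r \<odot>\<^bsub>Vmod\<^esub> (r' \<odot>\<^bsub>Vmod\<^esub> v)"
    if "r \<in> carrier R" "r' \<in> carrier R" "v \<in> carrier Vmod" for r r' v
    using that val[of v]
    by (auto simp: layer_module_def fun_eq_iff Q.smult_assoc1)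
  show "\<one>\<^bsub>R\<^esub> \<odot>\<^bsub>Vmod\<^esub> v = v" if "v \<in> carrier Vmod" for v
  proof (intro ext)
    fix s Y
    have v: "v \<in> carrier V" using that by (simp add: carrier_Vmod)
    show "(\<one>\<^bsub>R\<^esub> \<odot>\<^bsub>Vmod\<^esub> v) s Y = v s Y"
      using val[OF v] Vsum.component_closed[OF v, of s]
      by (auto simp: layer_module_def layer_component_def extensional_def)
  qed
qed

lemma act_smult_gen:
  assumes r: "r \<in> carrier R" and g: "g \<in> gens" and v: "v \<in> layer_gens"
  shows "act (module.smult Lie r g) v = module.smult Vmod r (act g v)"
    and "act g (module.smult Vmod r v) = module.smult Vmod r (act g v)"
proof -
  obtain s x q where g': "g = gen s x q" "s \<noteq> 0" "x \<in> \<phi> s" "q \<in> carrier R"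
    using g unfolding gens_def by blast
  obtain t f where f: "f \<in> carrier (lc t)" "v = linj t f" using v unfolding layer_gens_def by blast
  have c: "g \<in> carrier L" "v \<in> carrier V" using g v gens_in_L layer_gens_in_V by auto
  have "act (module.smult Lie r g) v = module.smult Vmod r (act g v) \<and>
    act g (module.smult Vmod r v) = module.smult Vmod r (act g v)"
  proof (cases "t = 0")
    case True
    have smult_one: "module.smult Vmod r \<one>\<^bsub>V\<^esub> = \<one>\<^bsub>V\<^esub>"
      using hom_one[OF smult_Vmod_hom[OF r] Vsum.S.is_group Vsum.S.is_group] .
    have "v = \<one>\<^bsub>V\<^esub>" using True f linj_zero by simp
    then show ?thesis
      using smult_one act_one_right[OF c(1)] act_one_right[OF hom_in_carrier[OF smult_Lie_hom[OF r] c(1)]]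
      by (simp only:)
  next
    case t: False
    let ?rf = "\<lambda>Y\<in>carrier (lq t). r \<odot>\<^bsub>Q\<^esub> f Y"
    obtain h where h: "h \<in> carrier (lc (s + t))" "act g v = linj (s + t) h"
      "\<And>y. s + t \<noteq> 0 \<Longrightarrow> y \<in> lbd (s + t) \<Longrightarrow>
        h (\<pi> (s + t) #> y) = \<ominus>\<^bsub>Q\<^esub> (q \<odot>\<^bsub>Q\<^esub> f (\<pi> t #> comm x y))"
      using act_genE[OF g'(2-4) t f(1)] g' f by metis
    let ?rh = "\<lambda>Y\<in>carrier (lq (s + t)). r \<odot>\<^bsub>Q\<^esub> h Y"
    have rh: "?rh \<in> carrier (lc (s + t))" by (rule smult_lc_closed[OF r h(1)])
    have R: "module.smult Vmod r (act g v) = linj (s + t) ?rh"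
      using h(2) smult_Vmod_linj[OF r] by simp
    have fQ: "f (\<pi> t #> comm x y) \<in> carrier Q" if "y \<in> lbd (s + t)" for y
      using lc_value_closed[OF t f(1) comm_filter_lbd[OF g'(3) that]] .
    have rhy: "?rh (\<pi> (s + t) #> y) = \<ominus>\<^bsub>Q\<^esub> (r \<otimes>\<^bsub>R\<^esub> q \<odot>\<^bsub>Q\<^esub> f (\<pi> t #> comm x y))"
      if "s + t \<noteq> 0" "y \<in> lbd (s + t)" for y
      using that h(3)[OF that] carrier_lq[OF that(1)] fQ[OF that(2)] r g'
      by (auto simp: Q.smult_r_minus Q.smult_assoc1)
    have "act (gen s x (r \<otimes>\<^bsub>R\<^esub> q)) (linj t f) = linj (s + t) ?rh"
      by (rule act_gen[OF g'(2,3) R.m_closed[OF r g'(4)] t f(1) rh rhy])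
    moreover have "act (gen s x q) (linj t ?rf) = linj (s + t) ?rh"
    proof (rule act_gen[OF g'(2-4) t smult_lc_closed[OF r f(1)] rh])
      fix y assume y: "s + t \<noteq> 0" "y \<in> lbd (s + t)"
      have "\<pi> t #> comm x y \<in> carrier (lq t)"
        using carrier_lq[OF t] comm_filter_lbd[OF g'(3) y(2)] by auto
      then show "?rh (\<pi> (s + t) #> y) = \<ominus>\<^bsub>Q\<^esub> (q \<odot>\<^bsub>Q\<^esub> ?rf (\<pi> t #> comm x y))"
        using rhy[OF y] fQ[OF y(2)] r g' R.m_comm[of r q] by (simp add: Q.smult_assoc1)
    qed
    ultimately show ?thesis
      using R g' f r smult_Vmod_linj[OF r] by (simp add: smult_Lie_gen)
  qed
  then show "act (module.smult Lie r g) v = module.smult Vmod r (act g v)"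
    and "act g (module.smult Vmod r v) = module.smult Vmod r (act g v)" by blast+
qed

lemma act_smult:
  assumes r: "r \<in> carrier R" and a: "a \<in> carrier L" and v: "v \<in> carrier V"
  shows act_smult_left: "act (module.smult Lie r a) v = module.smult Vmod r (act a v)"
    and act_smult_right: "act a (module.smult Vmod r v) = module.smult Vmod r (act a v)"
proof -
  note left = biadditive_hom_left[OF act_biadditive] and right = biadditive_hom_right[OF act_biadditive]
  have 1: "biadditive L V V (\<lambda>a v. act (module.smult Lie r a) v)"
  proof (rule biadditiveI)
    show "act (module.smult Lie r a) \<in> hom V V" if "a \<in> carrier L" for a
      by (rule right[OF hom_in_carrier[OF smult_Lie_hom[OF r] that]])
    show "(\<lambda>a. act (module.smult Lie r a) v) \<in> hom L V" if "v \<in> carrier V" for v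
      using Group.hom_compose[OF smult_Lie_hom[OF r] left[OF that]] by (simp add: comp_def)
  qed
  have 2: "biadditive L V V (\<lambda>a v. act a (module.smult Vmod r v))"
  proof (rule biadditiveI)
    show "(\<lambda>v. act a (module.smult Vmod r v)) \<in> hom V V" if "a \<in> carrier L" for a
      using Group.hom_compose[OF smult_Vmod_hom[OF r] right[OF that]] by (simp add: comp_def)
    show "(\<lambda>a. act a (module.smult Vmod r v)) \<in> hom L V" if "v \<in> carrier V" for v
      by (rule left[OF hom_in_carrier[OF smult_Vmod_hom[OF r] that]])
  qed
  have 3: "biadditive L V V (\<lambda>a v. module.smult Vmod r (act a v))"
    by (rule comp_biadditive[OF act_biadditive smult_Vmod_hom[OF r]])
  show "act (module.smult Lie r a) v = module.smult Vmod r (act a v)"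
    by (rule biadditive_eq_on_generators[OF Lsum.S.is_group Vsum.S.is_group Vsum.S.is_group 1 3
          L_generated V_generated act_smult_gen(1)[OF r] a v])
  show "act a (module.smult Vmod r v) = module.smult Vmod r (act a v)"
    by (rule biadditive_eq_on_generators[OF Lsum.S.is_group Vsum.S.is_group Vsum.S.is_group 2 3
          L_generated V_generated act_smult_gen(2)[OF r] a v])
qed

lemma bilinear_act: "bilinear R Lie Vmod Vmod act"
  unfolding bilinear_def
  using module_Lie module_Vmod graded_lie_module.biadditive_act[OF graded_lie_module_act] act_smult
  by (simp add: carrier_Lie carrier_Vmod)

end

theorem theorem3:
  fixes prec :: "'m::comm_monoid_add \<Rightarrow> 'm \<Rightarrow> bool"
    and G :: "('g, 'x) monoid_scheme"
    and R :: "('r, 'y) ring_scheme"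
    and Q :: "('r, 'q, 'z) module_scheme"
    and \<phi> \<pi> :: "'m \<Rightarrow> 'g set"
  assumes "preordered_comm_monoid prec"
    and "group G"
    and "cring R"
    and "module R Q"
    and "group_filter G prec \<phi>"
    and "layering G prec \<pi>"
    and "\<forall>s t. commutator_subgroup G (\<phi> s) (\<pi> (s + t)) \<subseteq> \<pi> t"
  shows "(\<exists>!b. is_filter_product G R \<phi> b) \<and>
    (\<exists>!act. is_layer_action G R Q \<phi> \<pi> act) \<and>
    graded_lie_module
      (filter_lie_ring G R \<phi>) (homogeneous (filter_component G R \<phi>))
      (layer_module G Q \<pi>) (homogeneous (layer_component G Q \<pi>))
      (layer_action G R Q \<phi> \<pi>) \<and>
    bilinear R (filter_lie_ring G R \<phi>) (layer_module G Q \<pi>) (layer_module G Q \<pi>)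
      (layer_action G R Q \<phi> \<pi>)"
proof -
  interpret filter_layering prec G R \<phi> Q \<pi>
    by (intro filter_layering.intro filter_layering_axioms.intro coefficient_filter.intro
        filtered_group.intro filtered_group_axioms.intro)
      (use assms in auto)
  show ?thesis
    using ex_product unique_product ex_action unique_action graded_lie_module_act bilinear_act
    by blast
qed

end
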